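(* There is a dynamic algorithm for \textsc{Point Line Cover} with parameter $k$ which handles point insertions in $O(g(k)^2)$ time, point deletions in $O(g(k)^3)$ time, and queries in $O(g(k)^{2g(k)+2})$ time, under the promise that there is a computable function $g$ such that (throughout the sequence of updates) the point set can always be covered by at most $g(k)$ lines.
   Context: \textsc{Point Line Cover} (parameter $k$): given a finite set $\mathcal P$ of points in the plane and an integer $k\in\mathbb N$, find a set of at most $k$ lines such that every point of $\mathcal P$ lies on at least one of them. A dynamic algorithm stores the current point set ($k$ is fixed), supports insertion and deletion of a single point, and on a query returns a set of at most $k$ lines covering the current point set, or reports that none exists. The function $g:\mathbb N\to\mathbb N$ is computable and known; no guarantees are required if at some time the current point set cannot be covered by $g(k)$ lines. *)

theory Defs
  imports "HOL-Analysis.Analysis"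
begin

section \<open>Machine model\<close>

text \<open>
  Running times are measured on a real RAM: a memory cell holds a real number, and arithmetic,
  comparison, reading and writing a cell have unit cost. The model has no rounding operation, and
  the constants of a program are integers, so a program is a finite object.

  Memory is organised in named associative arrays. A cell is addressed by an array name, fixed in
  the program text, and a list of reals; scalars are the cells with the empty index. Indexing by
  arbitrary reals (for instance by the coordinates of a point) models a constant-time dictionary: an
  update time that does not depend on the number of stored points presupposes that a point given
  by its coordinates can be located in constant time.
\<close>

type_synonym vname = string
type_synonym state = "vname \<Rightarrow> real list \<Rightarrow> real"

datatype exp =
    Const int
  | Get vname "exp list"
  | Add exp exp
  | Sub exp exp
  | Mul exp exp
  | Div exp exp

datatype cond =
    Less exp exp
  | Not cond
  | And cond cond

datatype com =
    Skip
  | Put vname "exp list" exp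
  | Seq com com
  | If cond com com
  | While cond com

fun eval :: "state \<Rightarrow> exp \<Rightarrow> real" where
  "eval s (Const n) = of_int n"
| "eval s (Get v es) = s v (map (eval s) es)"
| "eval s (Add d e) = eval s d + eval s e"
| "eval s (Sub d e) = eval s d - eval s e"
| "eval s (Mul d e) = eval s d * eval s e"
| "eval s (Div d e) = eval s d / eval s e"

fun holds :: "state \<Rightarrow> cond \<Rightarrow> bool" where
  "holds s (Less d e) \<longleftrightarrow> eval s d < eval s e"
| "holds s (Not b) \<longleftrightarrow> \<not> holds s b"
| "holds s (And b b') \<longleftrightarrow> holds s b \<and> holds s b'"

fun exp_cost :: "exp \<Rightarrow> nat" where
  "exp_cost (Const n) = 1"
| "exp_cost (Get v es) = 1 + sum_list (map exp_cost es)"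
| "exp_cost (Add d e) = 1 + exp_cost d + exp_cost e"
| "exp_cost (Sub d e) = 1 + exp_cost d + exp_cost e"
| "exp_cost (Mul d e) = 1 + exp_cost d + exp_cost e"
| "exp_cost (Div d e) = 1 + exp_cost d + exp_cost e"

fun cond_cost :: "cond \<Rightarrow> nat" where
  "cond_cost (Less d e) = 1 + exp_cost d + exp_cost e"
| "cond_cost (Not b) = 1 + cond_cost b"
| "cond_cost (And b b') = 1 + cond_cost b + cond_cost b'"

definition set_cell :: "vname \<Rightarrow> real list \<Rightarrow> real \<Rightarrow> state \<Rightarrow> state" where
  "set_cell v ix a s = s(v := (s v)(ix := a))"

text \<open>\<open>exec c s t s'\<close>: started in \<open>s\<close>, the program \<open>c\<close> halts after \<open>t\<close> steps in \<open>s'\<close>.\<close>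

inductive exec :: "com \<Rightarrow> state \<Rightarrow> nat \<Rightarrow> state \<Rightarrow> bool" where
  Skip: "exec Skip s 1 s"
| Put: "exec (Put v es e) s (1 + sum_list (map exp_cost es) + exp_cost e)
          (set_cell v (map (eval s) es) (eval s e) s)"
| Seq: "exec c s t s' \<Longrightarrow> exec d s' t' s'' \<Longrightarrow> exec (Seq c d) s (t + t') s''"
| IfTrue: "holds s b \<Longrightarrow> exec c s t s' \<Longrightarrow> exec (If b c d) s (1 + cond_cost b + t) s'"
| IfFalse: "\<not> holds s b \<Longrightarrow> exec d s t s' \<Longrightarrow> exec (If b c d) s (1 + cond_cost b + t) s'"
| WhileFalse: "\<not> holds s b \<Longrightarrow> exec (While b c) s (1 + cond_cost b) s"
| WhileTrue: "holds s b \<Longrightarrow> exec c s t s' \<Longrightarrow> exec (While b c) s' t' s'' \<Longrightarrow>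
    exec (While b c) s (1 + cond_cost b + t + t') s''"

definition start_state :: "nat \<Rightarrow> state" where
  "start_state n = set_cell ''in'' [] (real n) (\<lambda>_ _. 0)"

text \<open>
  On natural inputs only rational numbers ever occur, so this is ordinary computability.
\<close>

definition computable :: "(nat \<Rightarrow> nat) \<Rightarrow> bool" where
  "computable f \<longleftrightarrow>
    (\<exists>c. \<forall>n. \<exists>t s. exec c (start_state n) t s \<and> s ''out'' [] = real (f n))"


section \<open>Point Line Cover\<close>

type_synonym point = "real \<times> real"

definition is_line :: "point set \<Rightarrow> bool" where
  "is_line L \<longleftrightarrow> affine L \<and> aff_dim L = 1"

definition line_cover :: "nat \<Rightarrow> point set \<Rightarrow> point set set \<Rightarrow> bool" where
  "line_cover m P Ls \<longleftrightarrow> finite Ls \<and> card Ls \<le> m \<and> (\<forall>L\<in>Ls. is_line L) \<and> P \<subseteq> \<Union>Ls"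

definition coverable :: "nat \<Rightarrow> point set \<Rightarrow> bool" where
  "coverable m P \<longleftrightarrow> (\<exists>Ls. line_cover m P Ls)"


section \<open>Dynamic algorithms\<close>

datatype operation = Insert point | Delete point | Query

fun apply_op :: "operation \<Rightarrow> point set \<Rightarrow> point set" where
  "apply_op (Insert p) P = insert p P"
| "apply_op (Delete p) P = P - {p}"
| "apply_op Query P = P"

definition points_after :: "operation list \<Rightarrow> point set" where
  "points_after ops = fold apply_op ops {}"

definition promise :: "nat \<Rightarrow> operation list \<Rightarrow> bool" where
  "promise m ops \<longleftrightarrow> (\<forall>n \<le> length ops. coverable m (points_after (take n ops)))"

record dynamic_algorithm =
  init_com :: com
  insert_com :: com
  delete_com :: com
  query_com :: com

fun op_com :: "dynamic_algorithm \<Rightarrow> operation \<Rightarrow> com" where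
  "op_com A (Insert p) = insert_com A"
| "op_com A (Delete p) = delete_com A"
| "op_com A Query = query_com A"

fun load :: "operation \<Rightarrow> state \<Rightarrow> state" where
  "load (Insert p) s = set_cell ''x'' [] (fst p) (set_cell ''y'' [] (snd p) s)"
| "load (Delete p) s = set_cell ''x'' [] (fst p) (set_cell ''y'' [] (snd p) s)"
| "load Query s = s"

text \<open>
  \<open>reaches A k ops s\<close>: the algorithm \<open>A\<close>, initialised with parameter \<open>k\<close> on zeroed memory, is in
  state \<open>s\<close> after processing \<open>ops\<close>. All programs work on the same memory, which persists between
  operations. Only \<open>k\<close> is given to the initialisation; a value such as \<open>g k\<close> has to be computed.
\<close>

inductive reaches :: "dynamic_algorithm \<Rightarrow> nat \<Rightarrow> operation list \<Rightarrow> state \<Rightarrow> bool"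
  for A k where
  init: "exec (init_com A) (start_state k) t s \<Longrightarrow> reaches A k [] s"
| step: "reaches A k ops s \<Longrightarrow> exec (op_com A opn) (load opn s) t s' \<Longrightarrow>
    reaches A k (ops @ [opn]) s'"

text \<open>
  The answer to a query is left in memory: \<open>found\<close> is zero to report that there is no cover;
  otherwise \<open>num\<close> is the number of lines, and the arrays \<open>a\<close>, \<open>b\<close>, \<open>c\<close> hold their coefficients.
  For \<open>a = b = 0\<close> the set below is not a line, hence never part of a correct answer.
\<close>

definition line_of :: "real \<Rightarrow> real \<Rightarrow> real \<Rightarrow> point set" where
  "line_of a b c = {(x, y). a * x + b * y = c}"

definition answer :: "state \<Rightarrow> point set set option" where
  "answer s =
    (if s ''found'' [] = 0 then None
     else Some {line_of (s ''a'' [real i]) (s ''b'' [real i]) (s ''c'' [real i]) | i :: nat.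
                  real i < s ''num'' []})"

fun correct_answer :: "nat \<Rightarrow> point set \<Rightarrow> point set set option \<Rightarrow> bool" where
  "correct_answer k P (Some Ls) \<longleftrightarrow> line_cover k P Ls"
| "correct_answer k P None \<longleftrightarrow> \<not> coverable k P"

text \<open>
  \<open>m\<close> is the number of lines in the promise and \<open>T\<close> bounds the worst-case time of each single
  operation. An operation is guaranteed to terminate in time and to be correct whenever the promise
  has held up to and including that operation; initialisation only has to terminate. Programs are
  deterministic, so the states quantified over are unique.
\<close>

definition solves_point_line_cover ::
  "dynamic_algorithm \<Rightarrow> nat \<Rightarrow> nat \<Rightarrow> (operation \<Rightarrow> nat) \<Rightarrow> bool" where
  "solves_point_line_cover A k m T \<longleftrightarrow>
    (\<exists>s. reaches A k [] s) \<and>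
    (\<forall>ops opn s. promise m (ops @ [opn]) \<longrightarrow> reaches A k ops s \<longrightarrow>
      (\<exists>t s'. exec (op_com A opn) (load opn s) t s' \<and> t \<le> T opn \<and>
        (opn = Query \<longrightarrow> correct_answer k (points_after ops) (answer s'))))"

end

theory Submission
  imports Defs
begin

text \<open>
  A line through more than \<open>m\<close> points belongs to every cover by at most \<open>m\<close> lines. The points are
  therefore split into at most \<open>m\<close> classes, each stored with a line carrying more than \<open>m\<close> of its
  points, and a set of loose points of which no line contains more than \<open>m\<close>; a cover by \<open>m\<close>
  lines bounds the latter by \<open>m\<^sup>2\<close>. An insertion counts the loose points by their direction from the
  new point. A deletion that makes a class too small reinserts its at most \<open>m\<close> points. A query keeps
  the heavy lines and branches on the loose points: among the first \<open>m + 1\<close> uncovered points, two lie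
  on a common line of the cover or each line covers just one of them, which gives at most
  \<open>(m + 1)\<^sup>2\<close> choices per line and \<open>(m + 1)\<^bsup>2m\<^esup> \<le> 9 m\<^bsup>2m\<^esup>\<close> branches.
\<close>

section \<open>Bounded runs\<close>

text \<open>All thresholds are taken from \<open>m\<close>, the number of lines in the promise, and
  not from the number \<open>k\<close> of lines asked for: only \<open>m\<close> is known to bound
  the loose points. A line forced into every cover by \<open>m\<close> lines is forced into every
  smaller cover too, so a query may start from the heavy lines whatever its target. The target is
  \<open>min k m\<close>, since a cover by \<open>m\<close> lines always exists; this bounds the
  depth of the search by \<open>m\<close>.

  Loose points are kept off all heavy lines, so that the other lines of a cover have to cover the
  loose points on their own. This, and the bound on collinear loose points, is why a deletion cannot
  just declare the points of a broken class loose: some may lie on other heavy lines, or complete a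
  heavy line together with old loose points.

  The language has no procedures, so the branching is done with a queue of partial covers. The
  number of rounds is not known beforehand, and the time is bounded by a potential. Insertion,
  deletion and query are fixed programs that read \<open>m\<close> from memory; only the
  initialisation depends on the program for \<open>g\<close>.\<close>

lemma exec_deterministic:
  "exec c s t s' \<Longrightarrow> exec c s u s'' \<Longrightarrow> u = t \<and> s'' = s'"
proof (induction arbitrary: u s'' rule: exec.induct)
  case (Skip s)
  then show ?case by (cases rule: exec.cases) auto
next
  case (Put v es e s)
  then show ?case by (cases rule: exec.cases) auto
next
  case (Seq c s t s' d t' s2)
  obtain t1 s1 t2 where "u = t1 + t2" "exec c s t1 s1" "exec d s1 t2 s''"
    using Seq.prems by (cases rule: exec.cases) auto
  then show ?case using Seq.IH by blast
next
  case (IfTrue s b c t s' d)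
  obtain t1 where "u = 1 + cond_cost b + t1" "exec c s t1 s''"
    using IfTrue.prems IfTrue.hyps(1) by (cases rule: exec.cases) auto
  then show ?case using IfTrue.IH by blast
next
  case (IfFalse s b d t s' c)
  obtain t1 where "u = 1 + cond_cost b + t1" "exec d s t1 s''"
    using IfFalse.prems IfFalse.hyps(1) by (cases rule: exec.cases) auto
  then show ?case using IfFalse.IH by blast
next
  case (WhileFalse s b c)
  from WhileFalse.prems WhileFalse.hyps show ?case by (cases rule: exec.cases) auto
next
  case (WhileTrue s b c t s' t' s2)
  obtain t1 s1 t2 where "u = 1 + cond_cost b + t1 + t2" "exec c s t1 s1" "exec (While b c) s1 t2 s''"
    using WhileTrue.prems WhileTrue.hyps(1) by (cases rule: exec.cases) auto
  then show ?case using WhileTrue.IH by blast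
qed

text \<open>The cost of the text with both branches of each test and a single round of each loop;
  repetition enters only through the factor \<open>F\<close> of \<open>runs\<close>.\<close>

fun weight :: "com \<Rightarrow> nat" where
  "weight Skip = 1"
| "weight (Put v es e) = 1 + sum_list (map exp_cost es) + exp_cost e"
| "weight (Seq c d) = weight c + weight d"
| "weight (If b c d) = 1 + cond_cost b + weight c + weight d"
| "weight (While b c) = 1 + cond_cost b + weight c"

text \<open>
  Measuring time in multiples of the fixed weight of the program text leaves only the factor
  \<open>F\<close>, which depends on the parameter, to be tracked.
\<close>

definition runs :: "com \<Rightarrow> state \<Rightarrow> nat \<Rightarrow> (state \<Rightarrow> bool) \<Rightarrow> bool" where
  "runs c s F Q \<longleftrightarrow> (\<exists>t s'. exec c s t s' \<and> t \<le> weight c * F \<and> Q s')"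

lemma runs_Skip: "Q s \<Longrightarrow> 1 \<le> F \<Longrightarrow> runs Skip s F Q"
  unfolding runs_def using exec.Skip by force

lemma runs_Put:
  assumes "Q (set_cell v (map (eval s) es) (eval s e) s)" "1 \<le> F"
  shows "runs (Put v es e) s F Q"
proof -
  have "1 + sum_list (map exp_cost es) + exp_cost e \<le> weight (Put v es e) * F"
    using mult_le_mono2[OF assms(2), of "weight (Put v es e)"] by simp
  then show ?thesis unfolding runs_def using exec.Put assms(1) by blast
qed

lemma runs_Seq:
  assumes "runs c s F (\<lambda>s'. runs d s' F Q)"
  shows "runs (Seq c d) s F Q"
proof -
  obtain t s' t' s'' where e: "exec c s t s'" "t \<le> weight c * F" "exec d s' t' s''"
    "t' \<le> weight d * F" "Q s''"
    using assms unfolding runs_def by blast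
  have "exec (Seq c d) s (t + t') s''" using e exec.Seq by blast
  moreover have "t + t' \<le> weight (Seq c d) * F" using e by (simp add: algebra_simps)
  ultimately show ?thesis unfolding runs_def using e by blast
qed

lemma runs_Put_Seq:
  assumes "runs d (set_cell v (map (eval s) es) (eval s e) s) F Q" "1 \<le> F"
  shows "runs (Seq (Put v es e) d) s F Q"
  using assms by (intro runs_Seq runs_Put)

lemma runs_If:
  assumes T: "holds s b \<Longrightarrow> runs c s F Q" and E: "\<not> holds s b \<Longrightarrow> runs d s F Q" and F: "1 \<le> F"
  shows "runs (If b c d) s F Q"
proof -
  have 0: "1 + cond_cost b \<le> (1 + cond_cost b) * F" using mult_le_mono2[OF F, of "1 + cond_cost b"] by simp
  show ?thesis
  proof (cases "holds s b")
    case True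
    then obtain t s' where e: "exec c s t s'" "t \<le> weight c * F" "Q s'"
      using T unfolding runs_def by blast
    have "exec (If b c d) s (1 + cond_cost b + t) s'" using e exec.IfTrue True by blast
    moreover have "1 + cond_cost b + t \<le> weight (If b c d) * F"
      using e 0 by (simp add: algebra_simps)
    ultimately show ?thesis unfolding runs_def using e by blast
  next
    case False
    then obtain t s' where e: "exec d s t s'" "t \<le> weight d * F" "Q s'"
      using E unfolding runs_def by blast
    have "exec (If b c d) s (1 + cond_cost b + t) s'" using e exec.IfFalse False by blast
    moreover have "1 + cond_cost b + t \<le> weight (If b c d) * F"
      using e 0 by (simp add: algebra_simps)
    ultimately show ?thesis unfolding runs_def using e by blast
  qed
qed

lemma runs_mono:
  assumes "runs c s F Q" "F \<le> F'" "\<And>s'. Q s' \<Longrightarrow> Q' s'"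
  shows "runs c s F' Q'"
  using assms unfolding runs_def by (meson le_trans mult_le_mono2)

text \<open>Amortised rule: the index \<open>n\<close> of the invariant is a budget, and a round
  whose body runs with factor \<open>F\<close> has to lower it by at least \<open>F\<close>. Neither
  the number of rounds nor a common bound on their costs has to be known. The extra unit pays for
  the failing test at the end.\<close>

lemma runs_While:
  assumes I: "I n s"
    and body: "\<And>n s. I n s \<Longrightarrow> holds s b \<Longrightarrow> \<exists>F\<ge>1. runs c s F (\<lambda>s'. \<exists>n'. I n' s' \<and> n' + F \<le> n)"
    and exit: "\<And>n s. I n s \<Longrightarrow> \<not> holds s b \<Longrightarrow> Q s"
    and time: "n + 1 \<le> F"
  shows "runs (While b c) s F Q"
proof -
  have "runs (While b c) s (n + 1) Q"
    using I
  proof (induction n arbitrary: s rule: less_induct)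
    case (less n)
    let ?w = "weight (While b c)"
    show ?case
    proof (cases "holds s b")
      case True
      then obtain F t s' n' where e: "F \<ge> 1" "exec c s t s'" "t \<le> weight c * F" "I n' s'"
          "n' + F \<le> n"
        using body[OF less.prems] unfolding runs_def by blast
      then have "n' < n" by simp
      then obtain t' s'' where e': "exec (While b c) s' t' s''" "t' \<le> ?w * (n' + 1)" "Q s''"
        using less.IH e(4) unfolding runs_def by blast
      \<comment> \<open>As \<open>1 \<le> F\<close>, the test is paid for by its own share in the
        weight of the loop.\<close>
      have "1 + cond_cost b + t \<le> ?w * F"
      proof -
        have "1 + cond_cost b \<le> (1 + cond_cost b) * F"
          using mult_le_mono2[OF e(1), of "1 + cond_cost b"] by simp
        then show ?thesis using e(3) by (simp add: algebra_simps)
      qed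
      then have "1 + cond_cost b + t + t' \<le> ?w * (F + (n' + 1))"
        using e'(2) unfolding distrib_left by linarith
      also have "\<dots> \<le> ?w * (n + 1)" by (rule mult_le_mono2) (use e(5) in simp)
      finally show ?thesis
        unfolding runs_def using exec.WhileTrue[OF True e(2) e'(1)] e'(3) by blast
    next
      case False
      then show ?thesis
        unfolding runs_def using exec.WhileFalse[OF False] exit[OF less.prems False] by force
    qed
  qed
  then show ?thesis using time by (rule runs_mono)
qed

text \<open>The counterpart for a known number of rounds with a common bound; here the invariant has
  to decide the loop test in every round.\<close>

lemma runs_for:
  assumes init: "I 0 s"
    and body: "\<And>i s. i < N \<Longrightarrow> I i s \<Longrightarrow> holds s b \<and> runs c s F (I (Suc i))"
    and exit: "\<And>s. I N s \<Longrightarrow> \<not> holds s b \<and> Q s"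
    and F: "1 \<le> F" and time: "N * F + 1 \<le> F'"
  shows "runs (While b c) s F' Q"
proof -
  have "runs (While b c) s ((N - i) * F + 1) Q" if "I i s" "i \<le> N" for i s
    using that
  proof (induction "N - i" arbitrary: i s)
    case 0
    then have "i = N" by simp
    then have "\<not> holds s b" "Q s" using exit 0 by auto
    then show ?case unfolding runs_def using exec.WhileFalse[of s b c] by force
  next
    case (Suc n)
    let ?w = "weight (While b c)"
    have i: "i < N" using Suc by simp
    obtain t s' where e: "holds s b" "exec c s t s'" "t \<le> weight c * F" "I (Suc i) s'"
      using body[OF i Suc.prems(1)] unfolding runs_def by blast
    obtain t' s'' where e': "exec (While b c) s' t' s''" "t' \<le> ?w * ((N - Suc i) * F + 1)" "Q s''"
      using Suc.hyps(1)[of "Suc i" s'] Suc.hyps(2) e(4) i unfolding runs_def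
      by (metis Suc_leI Suc_inject Suc_diff_Suc)
    have "1 + cond_cost b \<le> (1 + cond_cost b) * F"
      using mult_le_mono2[OF F, of "1 + cond_cost b"] by simp
    then have "1 + cond_cost b + t \<le> ?w * F" using e(3) by (simp add: algebra_simps)
    then have "1 + cond_cost b + t + t' \<le> ?w * (F + ((N - Suc i) * F + 1))"
      using e'(2) unfolding distrib_left by linarith
    also have "F + ((N - Suc i) * F + 1) = (N - i) * F + 1"
    proof -
      have "N - i = Suc (N - Suc i)" using i by simp
      then show ?thesis by simp
    qed
    finally show ?case
      unfolding runs_def using exec.WhileTrue[OF e(1,2) e'(1)] e'(3) by blast
  qed
  from this[of 0 s] init have "runs (While b c) s (N * F + 1) Q" by simp
  then show ?thesis using time by (rule runs_mono)
qed

section \<open>Frame conditions and program notation\<close>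

lemma set_cell_apply [simp]: "set_cell v ix a s w = (if w = v then (s w)(ix := a) else s w)"
  by (simp add: set_cell_def)

definition frame :: "vname set \<Rightarrow> state \<Rightarrow> state \<Rightarrow> bool" where
  "frame V s s' \<longleftrightarrow> (\<forall>v. v \<notin> V \<longrightarrow> s' v = s v)"

lemma frameD: "frame V s s' \<Longrightarrow> v \<notin> V \<Longrightarrow> s' v = s v"
  by (simp add: frame_def)

lemma frame_refl [simp]: "frame V s s"
  by (simp add: frame_def)

lemma frame_trans:
  "frame V s s' \<Longrightarrow> frame W s' s'' \<Longrightarrow> V \<subseteq> U \<Longrightarrow> W \<subseteq> U \<Longrightarrow> frame U s s''"
  unfolding frame_def by (metis subsetD)

lemma frame_set_cell:
  "frame V s s' \<Longrightarrow> v \<in> V \<Longrightarrow> frame V s (set_cell v ix a s')"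
  by (auto simp: frame_def)

abbreviation Var :: "vname \<Rightarrow> exp" where "Var v \<equiv> Get v []"
abbreviation Assign :: "vname \<Rightarrow> exp \<Rightarrow> com" (infix "::=" 61) where "v ::= e \<equiv> Put v [] e"
abbreviation Inc :: "vname \<Rightarrow> com" where "Inc v \<equiv> v ::= Add (Var v) (Const 1)"
abbreviation Then :: "com \<Rightarrow> com \<Rightarrow> com" (infixr ";;" 60) where "c ;; d \<equiv> Seq c d"

definition LessEq :: "exp \<Rightarrow> exp \<Rightarrow> cond" where "LessEq d e = Not (Less e d)"
definition Equal :: "exp \<Rightarrow> exp \<Rightarrow> cond" where "Equal d e = And (LessEq d e) (LessEq e d)"

lemma holds_LessEq [simp]: "holds s (LessEq d e) \<longleftrightarrow> eval s d \<le> eval s e"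
  by (auto simp: LessEq_def)

lemma holds_Equal [simp]: "holds s (Equal d e) \<longleftrightarrow> eval s d = eval s e"
  by (auto simp: Equal_def)

section \<open>Running a program in a disjoint part of the memory\<close>

text \<open>
  The program computing \<open>g\<close> leaves its arrays in the shared memory; they get names starting with
  \<open>#\<close>, which are not used otherwise.
\<close>

fun ren_exp :: "exp \<Rightarrow> exp" where
  "ren_exp (Const n) = Const n"
| "ren_exp (Get v es) = Get (CHR ''#'' # v) (map ren_exp es)"
| "ren_exp (Add d e) = Add (ren_exp d) (ren_exp e)"
| "ren_exp (Sub d e) = Sub (ren_exp d) (ren_exp e)"
| "ren_exp (Mul d e) = Mul (ren_exp d) (ren_exp e)"
| "ren_exp (Div d e) = Div (ren_exp d) (ren_exp e)"

fun ren_cond :: "cond \<Rightarrow> cond" where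
  "ren_cond (Less d e) = Less (ren_exp d) (ren_exp e)"
| "ren_cond (Not b) = Not (ren_cond b)"
| "ren_cond (And b b') = And (ren_cond b) (ren_cond b')"

fun ren_com :: "com \<Rightarrow> com" where
  "ren_com Skip = Skip"
| "ren_com (Put v es e) = Put (CHR ''#'' # v) (map ren_exp es) (ren_exp e)"
| "ren_com (Seq c d) = Seq (ren_com c) (ren_com d)"
| "ren_com (If b c d) = If (ren_cond b) (ren_com c) (ren_com d)"
| "ren_com (While b c) = While (ren_cond b) (ren_com c)"

text \<open>\<open>s\<close> is the memory as the original program sees it; \<open>r\<close>
  supplies every array whose name does not start with \<open>#\<close> and stays fixed during the
  run.\<close>

definition overlay :: "state \<Rightarrow> state \<Rightarrow> state" where
  "overlay r s v = (case v of [] \<Rightarrow> r v | c # w \<Rightarrow> if c = CHR ''#'' then s w else r v)"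

lemma overlay_hash [simp]: "overlay r s (CHR ''#'' # v) = s v"
  by (simp add: overlay_def)

lemma eval_ren: "eval (overlay r s) (ren_exp e) = eval s e"
proof (induction s e rule: eval.induct)
  case (2 s v es)
  then have "map (eval (overlay r s) \<circ> ren_exp) es = map (eval s) es" by simp
  then show ?case by (simp del: map_eq_conv)
qed simp_all

lemma holds_ren: "holds (overlay r s) (ren_cond b) = holds s b"
  by (induction b) (simp_all add: eval_ren)

text \<open>Renaming preserves the shape of the program, so the run is simulated step by step. Its
  length \<open>u\<close> is left open because initialisation only has to terminate.\<close>

lemma exec_ren: "exec c s t s' \<Longrightarrow> \<exists>u. exec (ren_com c) (overlay r s) u (overlay r s')"
proof (induction rule: exec.induct)
  case (Put v es e s)
  have "set_cell (CHR ''#'' # v) ix a (overlay r s) = overlay r (set_cell v ix a s)" for ix a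
    by (auto simp: fun_eq_iff set_cell_def overlay_def split: list.split)
  moreover have "map (eval (overlay r s)) (map ren_exp es) = map (eval s) es"
    by (simp add: eval_ren)
  ultimately show ?case
    using exec.Put[of "CHR ''#'' # v" "map ren_exp es" "ren_exp e" "overlay r s"]
    unfolding eval_ren ren_com.simps by metis
next
  case (Skip s)
  then show ?case using exec.Skip by auto
next
  case (Seq c s t s' d t' s'')
  then show ?case using exec.Seq unfolding ren_com.simps by blast
next
  case (IfTrue s b c t s' d)
  then show ?case using exec.IfTrue holds_ren unfolding ren_com.simps by metis
next
  case (IfFalse s b d t s' c)
  then show ?case using exec.IfFalse holds_ren unfolding ren_com.simps by metis
next
  case (WhileFalse s b c)
  then show ?case using exec.WhileFalse holds_ren unfolding ren_com.simps by metis
next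
  case (WhileTrue s b c t s' t' s'')
  then show ?case using exec.WhileTrue holds_ren unfolding ren_com.simps by metis
qed

section \<open>Lines in the plane\<close>

text \<open>In the plane this is a hyperplane with normal vector \<open>(a, b)\<close>, hence of
  dimension \<open>2 - 1\<close>.\<close>

lemma is_line_line_of:
  assumes "a \<noteq> 0 \<or> b \<noteq> 0"
  shows "is_line (line_of a b c)"
proof -
  have eq: "line_of a b c = {p. (a, b) \<bullet> p = c}"
    by (auto simp: line_of_def inner_prod_def)
  have "(a, b) \<noteq> 0" using assms by (auto simp: zero_prod_def)
  then have "aff_dim {p. (a, b) \<bullet> p = c} = 1"
    using aff_dim_hyperplane[of "(a, b)" c] by simp
  then show ?thesis unfolding is_line_def eq by (simp add: affine_hyperplane)
qed

text \<open>By comparison of dimensions, either line is the affine hull of \<open>p\<close> and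
  \<open>q\<close>.\<close>

lemma lines_eqI:
  assumes "is_line l" "is_line l'" "p \<in> l" "q \<in> l" "p \<in> l'" "q \<in> l'" "p \<noteq> q"
  shows "l = l'"
proof -
  have "affine hull {p, q} = k" if "is_line k" "p \<in> k" "q \<in> k" for k
  proof (rule affine_dim_equal)
    show "affine hull {p, q} \<subseteq> k" using that by (simp add: hull_minimal is_line_def)
    show "aff_dim (affine hull {p, q}) = aff_dim k"
      using that assms(7) by (simp add: is_line_def aff_dim_2)
  qed (use that in \<open>auto simp: is_line_def\<close>)
  then show ?thesis using assms by blast
qed

text \<open>The normal vector is \<open>q - p\<close> turned by a right angle, and the constant
  makes the line pass through \<open>p\<close>. For \<open>p = q\<close> all coefficients vanish and
  the set is the whole plane.\<close>

definition thru :: "point \<Rightarrow> point \<Rightarrow> point set" where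
  "thru p q = line_of (snd p - snd q) (fst q - fst p)
     ((snd p - snd q) * fst p + (fst q - fst p) * snd p)"

lemma thru_contains: "p \<in> thru p q" "q \<in> thru p q"
  by (auto simp: thru_def line_of_def case_prod_beta algebra_simps)

lemma is_line_thru: "p \<noteq> q \<Longrightarrow> is_line (thru p q)"
  unfolding thru_def by (rule is_line_line_of) (auto simp: prod_eq_iff)

text \<open>
  As \<open>x / 0 = 0\<close>, the first component separates vertical directions from horizontal ones.
\<close>

definition direction :: "point \<Rightarrow> point \<Rightarrow> real list" where
  "direction p q =
    [(fst q - fst p) / (fst q - fst p), (snd q - snd p) / (fst q - fst p)]"

text \<open>Both sides say that the cross product of \<open>q - p\<close> and \<open>r - p\<close>
  vanishes. This turns collinearity with \<open>p\<close> into equality of a dictionary key, which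
  is what makes counting by direction possible.\<close>

lemma direction_eq_iff:
  assumes "q \<noteq> p" "r \<noteq> p"
  shows "direction p q = direction p r \<longleftrightarrow> r \<in> thru p q"
proof -
  obtain px py qx qy rx ry where pqr: "p = (px, py)" "q = (qx, qy)" "r = (rx, ry)"
    by (metis surj_pair)
  have "r \<in> thru p q \<longleftrightarrow> (qx - px) * (ry - py) = (qy - py) * (rx - px)"
    by (auto simp: pqr thru_def line_of_def algebra_simps)
  moreover have "direction p q = direction p r \<longleftrightarrow> (qx - px) * (ry - py) = (qy - py) * (rx - px)"
  proof (cases "qx = px \<or> rx = px")
    \<comment> \<open>If exactly one of the two directions is vertical, the first components are 0
      and 1, and one product is zero while the other is not. If both are, all denominators are 0 and
      both sides hold.\<close>
    case True
    then show ?thesis using assms by (auto simp: pqr direction_def)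
  next
    case False
    then have "qx - px \<noteq> 0" "rx - px \<noteq> 0" by auto
    then show ?thesis by (simp add: pqr direction_def frac_eq_eq mult.commute) (auto simp: mult.commute)
  qed
  ultimately show ?thesis by simp
qed

text \<open>A line other than \<open>l\<close> meets \<open>l\<close> in at most one point, so
  \<open>m\<close> such lines cover at most \<open>m\<close> points of it.\<close>

lemma heavy_line_in_cover:
  assumes cover: "line_cover m P Ls" and l: "is_line l" and heavy: "m < card (l \<inter> P)"
  shows "l \<in> Ls"
proof (rule ccontr)
  assume "l \<notin> Ls"
  then have le1: "finite (l \<inter> k) \<and> card (l \<inter> k) \<le> 1" if "k \<in> Ls" for k
  proof -
    have "p = q" if "p \<in> l \<inter> k" "q \<in> l \<inter> k" for p q
      using lines_eqI[of l k p q] that l cover \<open>k \<in> Ls\<close> \<open>l \<notin> Ls\<close> unfolding line_cover_def by blast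
    then have "l \<inter> k = {} \<or> (\<exists>p. l \<inter> k = {p})" by blast
    then show ?thesis by auto
  qed
  have fin: "finite Ls" using cover by (simp add: line_cover_def)
  have "l \<inter> P \<subseteq> (\<Union>k\<in>Ls. l \<inter> k)" using cover by (auto simp: line_cover_def)
  then have "card (l \<inter> P) \<le> card (\<Union>k\<in>Ls. l \<inter> k)"
    by (rule card_mono[rotated]) (use fin le1 in blast)
  also have "\<dots> \<le> (\<Sum>k\<in>Ls. card (l \<inter> k))" by (rule card_UN_le[OF fin])
  also have "\<dots> \<le> card Ls" using sum_mono[of Ls "\<lambda>k. card (l \<inter> k)" "\<lambda>_. 1"] le1 by simp
  also have "\<dots> \<le> m" using cover by (simp add: line_cover_def)
  finally show False using heavy by simp
qed

text \<open>Each of the at most \<open>m\<close> lines of a cover carries at most \<open>m\<close>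
  points of \<open>R\<close>.\<close>

lemma card_le_if_light:
  assumes "coverable m P" "R \<subseteq> P" "finite R" "\<And>l. is_line l \<Longrightarrow> card (l \<inter> R) \<le> m"
  shows "card R \<le> m * m"
proof -
  obtain Ls where Ls: "finite Ls" "card Ls \<le> m" "\<And>l. l \<in> Ls \<Longrightarrow> is_line l" "P \<subseteq> \<Union>Ls"
    using assms(1) unfolding coverable_def line_cover_def by blast
  have "R = (\<Union>l\<in>Ls. l \<inter> R)" using Ls assms(2) by blast
  then have "card R \<le> (\<Sum>l\<in>Ls. card (l \<inter> R))" using card_UN_le[OF Ls(1)] by metis
  also have "\<dots> \<le> card Ls * m"
    using sum_mono[of Ls "\<lambda>l. card (l \<inter> R)" "\<lambda>_. m"] assms(4) Ls(3) by simp
  also have "\<dots> \<le> m * m" using Ls(2) by simp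
  finally show ?thesis .
qed

lemma coverable_mono: "coverable m P \<Longrightarrow> Q \<subseteq> P \<Longrightarrow> m \<le> n \<Longrightarrow> coverable n Q"
  unfolding coverable_def line_cover_def by (meson le_trans subset_trans)

section \<open>Representation of the point set\<close>

text \<open>
  Slot \<open>0\<close> lists the loose points, slots \<open>1, \<dots>, m\<close> list the points stored with a heavy line each.
  \<open>W\<close> maps a point to the successor of its slot, \<open>pos\<close> to its position there.
\<close>

definition stores :: "nat \<Rightarrow> state \<Rightarrow> (nat \<Rightarrow> point list) \<Rightarrow> bool" where
  "stores m s L \<longleftrightarrow>
    (\<forall>i\<le>m. s ''n'' [real i] = real (length (L i))) \<and>
    (\<forall>i\<le>m. \<forall>j<length (L i).
      s ''X'' [real i, real j] = fst (L i ! j) \<and> s ''Y'' [real i, real j] = snd (L i ! j) \<and>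
      s ''W'' [fst (L i ! j), snd (L i ! j)] = real i + 1 \<and>
      s ''pos'' [fst (L i ! j), snd (L i ! j)] = real j) \<and>
    (\<forall>p. s ''W'' [fst p, snd p] \<noteq> 0 \<longrightarrow> (\<exists>i\<le>m. p \<in> set (L i)))"

abbreviation stored :: "nat \<Rightarrow> (nat \<Rightarrow> point list) \<Rightarrow> point set" where
  "stored m L \<equiv> \<Union>i\<le>m. set (L i)"

lemma storesD:
  assumes "stores m s L" "i \<le> m"
  shows "s ''n'' [real i] = real (length (L i))"
    and "j < length (L i) \<Longrightarrow> s ''X'' [real i, real j] = fst (L i ! j)"
    and "j < length (L i) \<Longrightarrow> s ''Y'' [real i, real j] = snd (L i ! j)"
    and "j < length (L i) \<Longrightarrow> s ''W'' [fst (L i ! j), snd (L i ! j)] = real i + 1"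
    and "j < length (L i) \<Longrightarrow> s ''pos'' [fst (L i ! j), snd (L i ! j)] = real j"
  using assms by (auto simp: stores_def)

lemma stores_W:
  assumes "stores m s L"
  shows "s ''W'' [fst p, snd p] \<noteq> 0 \<longleftrightarrow> p \<in> stored m L"
proof
  assume "p \<in> stored m L"
  then obtain i j where "i \<le> m" "j < length (L i)" "p = L i ! j"
    by (auto simp: in_set_conv_nth)
  then show "s ''W'' [fst p, snd p] \<noteq> 0" using storesD(4)[OF assms, of i j] by simp
next
  assume "s ''W'' [fst p, snd p] \<noteq> 0"
  then show "p \<in> stored m L" using assms unfolding stores_def by blast
qed

text \<open>\<open>W\<close> and \<open>pos\<close> are functions of the point, so a point can be
  recorded at one place only. Distinctness within a slot and disjointness of the slots therefore
  follow from \<open>stores\<close> without being part of it.\<close>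

lemma stores_unique:
  assumes "stores m s L" "i \<le> m" "i' \<le> m" "j < length (L i)" "j' < length (L i')"
    "L i ! j = L i' ! j'"
  shows "i = i' \<and> j = j'"
  using storesD(4,5)[OF assms(1,2,4)] storesD(4,5)[OF assms(1,3,5)] assms(6) by auto

lemma stores_distinct: "stores m s L \<Longrightarrow> i \<le> m \<Longrightarrow> distinct (L i)"
  unfolding distinct_conv_nth using stores_unique by blast

lemma stores_disjoint:
  assumes "stores m s L" "i \<le> m" "i' \<le> m" "p \<in> set (L i)" "p \<in> set (L i')"
  shows "i = i'"
  using stores_unique[OF assms(1-3)] assms(4,5) by (metis in_set_conv_nth)

lemma stores_cong:
  assumes "stores m s L" "s' ''n'' = s ''n''" "s' ''X'' = s ''X''" "s' ''Y'' = s ''Y''"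
    "s' ''W'' = s ''W''" "s' ''pos'' = s ''pos''"
  shows "stores m s' L"
  using assms by (simp add: stores_def)

section \<open>Appending a point to a slot and removing it\<close>

definition append_com :: com where
  "append_com =
    Put ''X'' [Var ''slot'', Get ''n'' [Var ''slot'']] (Var ''px'') ;;
    Put ''Y'' [Var ''slot'', Get ''n'' [Var ''slot'']] (Var ''py'') ;;
    Put ''W'' [Var ''px'', Var ''py''] (Add (Var ''slot'') (Const 1)) ;;
    Put ''pos'' [Var ''px'', Var ''py''] (Get ''n'' [Var ''slot'']) ;;
    Put ''n'' [Var ''slot''] (Add (Get ''n'' [Var ''slot'']) (Const 1))"

text \<open>The last entry of the slot fills the gap, which takes constant time. If the point is
  itself the last one, its \<open>pos\<close> is rewritten with the same value; membership is
  decided by \<open>W\<close> alone, so an outdated \<open>pos\<close> does no harm.\<close>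

definition remove_com :: com where
  "remove_com =
    ''from'' ::= Sub (Get ''W'' [Var ''px'', Var ''py'']) (Const 1) ;;
    ''gap'' ::= Get ''pos'' [Var ''px'', Var ''py''] ;;
    Put ''n'' [Var ''from''] (Sub (Get ''n'' [Var ''from'']) (Const 1)) ;;
    ''qx'' ::= Get ''X'' [Var ''from'', Get ''n'' [Var ''from'']] ;;
    ''qy'' ::= Get ''Y'' [Var ''from'', Get ''n'' [Var ''from'']] ;;
    Put ''X'' [Var ''from'', Var ''gap''] (Var ''qx'') ;;
    Put ''Y'' [Var ''from'', Var ''gap''] (Var ''qy'') ;;
    Put ''pos'' [Var ''qx'', Var ''qy''] (Var ''gap'') ;;
    Put ''W'' [Var ''px'', Var ''py''] (Const 0)"

abbreviation append_vars :: "vname set" where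
  "append_vars \<equiv> {''X'', ''Y'', ''W'', ''pos'', ''n''}"

abbreviation remove_vars :: "vname set" where
  "remove_vars \<equiv> append_vars \<union> {''from'', ''gap'', ''qx'', ''qy''}"

text \<open>Since \<open>p\<close> is new, writing its cells of \<open>W\<close> and
  \<open>pos\<close> affects no entry recorded before.\<close>

lemma stores_append:
  assumes st: "stores m s L" and i: "i \<le> m" and p: "p \<notin> stored m L"
    and n: "s' ''n'' = (s ''n'')([real i] := real (length (L i)) + 1)"
    and X: "s' ''X'' = (s ''X'')([real i, real (length (L i))] := fst p)"
    and Y: "s' ''Y'' = (s ''Y'')([real i, real (length (L i))] := snd p)"
    and W: "s' ''W'' = (s ''W'')([fst p, snd p] := real i + 1)"
    and pos: "s' ''pos'' = (s ''pos'')([fst p, snd p] := real (length (L i)))"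
  shows "stores m s' (L(i := L i @ [p]))"
  unfolding stores_def
proof (intro conjI allI impI)
  let ?L = "L(i := L i @ [p])"
  show "s' ''n'' [real k] = real (length (?L k))" if "k \<le> m" for k
    using storesD(1)[OF st that] n by simp
  fix k j assume k: "k \<le> m" and j: "j < length (?L k)"
  consider "k = i" "j = length (L i)" | "j < length (L k)" "?L k ! j = L k ! j"
    using j by (cases "k = i"; cases "j = length (L i)") (auto simp: nth_append)
  note cases = this
  have old: "L k ! j \<noteq> p" if "j < length (L k)"
    using p k that by (metis UN_I atMost_iff nth_mem)
  have other: "k = i \<Longrightarrow> j < length (L k) \<Longrightarrow> j \<noteq> length (L i)" by simp
  show "s' ''X'' [real k, real j] = fst (?L k ! j)"
    by (rule cases) (use storesD(2)[OF st k, of j] X other in auto)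
  show "s' ''Y'' [real k, real j] = snd (?L k ! j)"
    by (rule cases) (use storesD(3)[OF st k, of j] Y other in auto)
  show "s' ''W'' [fst (?L k ! j), snd (?L k ! j)] = real k + 1"
    by (rule cases) (use storesD(4)[OF st k, of j] W old in \<open>auto simp: prod_eq_iff\<close>)
  show "s' ''pos'' [fst (?L k ! j), snd (?L k ! j)] = real j"
    by (rule cases) (use storesD(5)[OF st k, of j] pos old in \<open>auto simp: prod_eq_iff\<close>)
next
  fix q assume q: "s' ''W'' [fst q, snd q] \<noteq> 0"
  show "\<exists>k\<le>m. q \<in> set ((L(i := L i @ [p])) k)"
  proof (cases "q = p")
    case True
    then show ?thesis using i by auto
  next
    case False
    then have "s ''W'' [fst q, snd q] \<noteq> 0" using q W by (auto simp: prod_eq_iff)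
    then obtain k where "k \<le> m" "q \<in> set (L k)" using stores_W[OF st] by auto
    then show ?thesis by (intro exI[of _ k]) auto
  qed
qed

lemma runs_append:
  assumes st: "stores m s L" and i: "i \<le> m" "s ''slot'' [] = real i"
    and p: "s ''px'' [] = fst p" "s ''py'' [] = snd p" "p \<notin> stored m L" and F: "1 \<le> F"
    and Q: "\<And>s'. stores m s' (L(i := L i @ [p])) \<Longrightarrow>
      frame append_vars s s' \<Longrightarrow> Q s'"
  shows "runs append_com s F Q"
  unfolding append_com_def
  apply (intro runs_Seq runs_Put F)
  apply (rule Q)
   apply (rule stores_append[OF st i(1) p(3)])
       apply (use i p storesD[OF st i(1)] in simp_all)[5]
  apply (intro frame_set_cell frame_refl; simp)
  done

definition remove_at :: "nat \<Rightarrow> 'a list \<Rightarrow> 'a list" where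
  "remove_at j xs = butlast (xs[j := last xs])"

lemma length_remove_at [simp]: "length (remove_at j xs) = length xs - 1"
  by (simp add: remove_at_def)

lemma nth_remove_at:
  "j < length xs \<Longrightarrow> k < length xs - 1 \<Longrightarrow>
    remove_at j xs ! k = (if k = j then xs ! (length xs - 1) else xs ! k)"
  by (cases "xs = []") (simp_all add: remove_at_def nth_butlast nth_list_update last_conv_nth)

lemma set_remove_at:
  assumes "distinct xs" "j < length xs"
  shows "set (remove_at j xs) = set xs - {xs ! j}"
proof (intro subset_antisym subsetI)
  fix y assume "y \<in> set (remove_at j xs)"
  then obtain k where k: "k < length xs - 1" "y = remove_at j xs ! k" by (auto simp: in_set_conv_nth)
  define k' where "k' = (if k = j then length xs - 1 else k)"
  have "y = xs ! k'" "k' < length xs" "k' \<noteq> j"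
    using k assms(2) by (auto simp: k'_def nth_remove_at)
  then show "y \<in> set xs - {xs ! j}" using assms by (auto simp: nth_eq_iff_index_eq)
next
  fix y assume "y \<in> set xs - {xs ! j}"
  then obtain k where k: "k < length xs" "y = xs ! k" "k \<noteq> j" by (auto simp: in_set_conv_nth)
  define k' where "k' = (if k = length xs - 1 then j else k)"
  have "k' < length xs - 1" "y = remove_at j xs ! k'"
    using k assms(2) by (auto simp: k'_def nth_remove_at)
  then show "y \<in> set (remove_at j xs)" by (metis length_remove_at nth_mem)
qed

lemma stores_remove:
  assumes st: "stores m s L" and i: "i \<le> m" and j: "j < length (L i)"
    and p: "p = L i ! j" and q: "q = L i ! (length (L i) - 1)"
    and n: "s' ''n'' = (s ''n'')([real i] := real (length (L i)) - 1)"
    and X: "s' ''X'' = (s ''X'')([real i, real j] := fst q)"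
    and Y: "s' ''Y'' = (s ''Y'')([real i, real j] := snd q)"
    and W: "s' ''W'' = (s ''W'')([fst p, snd p] := 0)"
    and pos: "s' ''pos'' = (s ''pos'')([fst q, snd q] := real j)"
  shows "stores m s' (L(i := remove_at j (L i)))"
  unfolding stores_def
proof (intro conjI allI impI)
  let ?L = "L(i := remove_at j (L i))"
  show "s' ''n'' [real k] = real (length (?L k))" if "k \<le> m" for k
    using storesD(1)[OF st that] n j by (auto simp: of_nat_diff)
  fix k l assume k: "k \<le> m" and l: "l < length (?L k)"
  \<comment> \<open>\<open>l'\<close> is the position before the removal of the entry that is now at
    \<open>l\<close>; the two differ only for the entry that has filled the gap.\<close>
  define l' where "l' = (if k = i \<and> l = j then length (L i) - 1 else l)"
  have l': "l' < length (L k)" "?L k ! l = L k ! l'"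
    using l j by (cases "k = i"; cases "l = j"; simp add: l'_def nth_remove_at)+
  have len: "k = i \<Longrightarrow> l < length (L i) - 1" using l by simp
  \<comment> \<open>Position \<open>j\<close> of slot \<open>i\<close> was the only place of
    \<open>p\<close>, so clearing \<open>W\<close> at \<open>p\<close> hits no remaining
    entry.\<close>
  have p': "L k ! l' \<noteq> p"
  proof
    assume "L k ! l' = p"
    then have "k = i \<and> l' = j" using stores_unique[OF st k i l'(1) j] p by simp
    then show False using len by (cases "l = j") (auto simp: l'_def)
  qed
  then have p'': "[fst (L k ! l'), snd (L k ! l')] \<noteq> [fst p, snd p]" by (simp add: prod_eq_iff)
  note old = storesD[OF st k]
  have "s' ''X'' [real k, real l] = fst (L k ! l') \<and> s' ''Y'' [real k, real l] = snd (L k ! l') \<and>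
    s' ''pos'' [fst (L k ! l'), snd (L k ! l')] = real l"
  proof (cases "k = i \<and> l = j")
    case True
    then show ?thesis using X Y pos q by (simp add: l'_def)
  next
    case False
    then have ll: "l' = l" by (auto simp: l'_def)
    have "L k ! l' \<noteq> q"
    proof
      assume "L k ! l' = q"
      then have "k = i \<and> l' = length (L i) - 1"
        using stores_unique[OF st k i l'(1), of "length (L i) - 1"] q j by simp
      then show False using len ll by simp
    qed
    then have "[fst (L k ! l'), snd (L k ! l')] \<noteq> [fst q, snd q]" by (simp add: prod_eq_iff)
    moreover have "[real k, real l] \<noteq> [real i, real j]" using False by simp
    ultimately show ?thesis
      using old(2,3,5)[OF l'(1)] unfolding X Y pos ll by (simp only: fun_upd_apply if_False)
  qed
  then show "s' ''X'' [real k, real l] = fst (?L k ! l)"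
    "s' ''Y'' [real k, real l] = snd (?L k ! l)"
    "s' ''pos'' [fst (?L k ! l), snd (?L k ! l)] = real l"
    unfolding l'(2) by blast+
  show "s' ''W'' [fst (?L k ! l), snd (?L k ! l)] = real k + 1"
    using old(4)[OF l'(1)] W p'' unfolding l'(2) by simp
next
  fix r assume r: "s' ''W'' [fst r, snd r] \<noteq> 0"
  have rp: "r \<noteq> p" using r unfolding W by auto
  have "s ''W'' [fst r, snd r] \<noteq> 0" using r unfolding W by (metis fun_upd_apply)
  then obtain k where k: "k \<le> m" "r \<in> set (L k)" using stores_W[OF st] by auto
  have "r \<in> set ((L(i := remove_at j (L i))) k)"
    using set_remove_at[OF stores_distinct[OF st i] j] p rp k(2) by auto
  then show "\<exists>k\<le>m. r \<in> set ((L(i := remove_at j (L i))) k)" using k(1) by blast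
qed

lemma runs_remove:
  assumes st: "stores m s L" and ij: "i \<le> m" "j < length (L i)" "p = L i ! j"
    and p: "s ''px'' [] = fst p" "s ''py'' [] = snd p" and F: "1 \<le> F"
    and Q: "\<And>s'. stores m s' (L(i := remove_at j (L i))) \<Longrightarrow>
      frame remove_vars s s' \<Longrightarrow> Q s'"
  shows "runs remove_com s F Q"
proof -
  define q where "q = L i ! (length (L i) - 1)"
  have last: "length (L i) - 1 < length (L i)" using ij by simp
  have 1: "real (length (L i)) - 1 = real (length (L i) - 1)" using ij by (simp add: of_nat_diff)
  have W: "s ''W'' [fst p, snd p] = real i + 1" and pos: "s ''pos'' [fst p, snd p] = real j"
    using storesD(4,5)[OF st ij(1,2)] ij(3) by auto
  have XY: "s ''X'' [real i, real (length (L i)) - 1] = fst q"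
      "s ''Y'' [real i, real (length (L i)) - 1] = snd q"
    using storesD(2,3)[OF st ij(1) last] unfolding 1 q_def by auto
  show ?thesis
    unfolding remove_com_def
    apply (rule runs_Put_Seq[OF _ F], simp add: p W pos storesD(1)[OF st ij(1)] XY)+
    apply (rule runs_Put[OF _ F], simp add: p)
    apply (rule Q)
     apply (rule stores_remove[OF st ij q_def])
         apply simp_all
    apply (intro frame_set_cell frame_refl; simp)
    done
qed

section \<open>Heavy lines\<close>

text \<open>\<open>l i\<close> is the line of slot \<open>i\<close>, arbitrary if the slot is empty.
  Loose points avoid the heavy lines so that a cover without its heavy lines still covers the loose
  points. Injectivity makes the number of used slots a lower bound for the size of a cover.\<close>

definition structured :: "nat \<Rightarrow> (nat \<Rightarrow> point list) \<Rightarrow> (nat \<Rightarrow> point set) \<Rightarrow> bool" where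
  "structured m L l \<longleftrightarrow>
    (\<forall>i\<in>{1..m}. L i \<noteq> [] \<longrightarrow> m < length (L i) \<and> is_line (l i) \<and> set (L i) \<subseteq> l i \<and> set (L 0) \<inter> l i = {}) \<and>
    inj_on l {i\<in>{1..m}. L i \<noteq> []} \<and>
    (\<forall>k. is_line k \<longrightarrow> card (k \<inter> set (L 0)) \<le> m)"

text \<open>Losing points cannot make a line heavy. A class may stay above \<open>m\<close> or
  vanish altogether, which frees its slot; for the loose points, in slot 0, any loss is
  harmless.\<close>

lemma structured_shrink:
  assumes st: "structured m L l" and sub: "set xs \<subseteq> set (L i)"
    and len: "1 \<le> i \<Longrightarrow> xs = [] \<or> m < length xs"
  shows "structured m (L(i := xs)) l"
proof -
  have "card (k \<inter> set ((L(i := xs)) 0)) \<le> card (k \<inter> set (L 0))" for k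
    by (rule card_mono) (use sub in auto)
  then have "card (k \<inter> set ((L(i := xs)) 0)) \<le> m" if "is_line k" for k
    using st that unfolding structured_def by (meson le_trans)
  moreover have "inj_on l {j\<in>{1..m}. (L(i := xs)) j \<noteq> []}"
    using st sub unfolding structured_def by (auto elim!: inj_on_subset)
  moreover have "m < length ((L(i := xs)) j) \<and> is_line (l j) \<and> set ((L(i := xs)) j) \<subseteq> l j \<and>
      set ((L(i := xs)) 0) \<inter> l j = {}" if j: "j \<in> {1..m}" "(L(i := xs)) j \<noteq> []" for j
  proof -
    have "L j \<noteq> []" using j(2) sub by (auto split: if_splits)
    then have *: "m < length (L j)" "is_line (l j)" "set (L j) \<subseteq> l j" "set (L 0) \<inter> l j = {}"
      using st j(1) unfolding structured_def by blast+
    have "m < length ((L(i := xs)) j)" using * len j by auto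
    moreover have "set ((L(i := xs)) j) \<subseteq> set (L j)" "set ((L(i := xs)) 0) \<subseteq> set (L 0)"
      using sub by auto
    ultimately show ?thesis using * by blast
  qed
  ultimately show ?thesis unfolding structured_def by blast
qed

lemma structured_grow_heavy:
  assumes "structured m L l" "k \<in> {1..m}" "L k \<noteq> []" "p \<in> l k"
  shows "structured m (L(k := L k @ [p])) l"
proof -
  have "{i\<in>{1..m}. (L(k := L k @ [p])) i \<noteq> []} = {i\<in>{1..m}. L i \<noteq> []}"
    using assms(3) by auto
  moreover have "k \<noteq> 0" using assms(2) by simp
  ultimately show ?thesis
    using assms unfolding structured_def by (auto simp: less_Suc_eq)
qed

text \<open>A line through \<open>p\<close> and a loose point \<open>r\<close> is
  \<open>thru p r\<close>, so counting on these lines suffices; strictness leaves room for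
  \<open>p\<close> itself. A line that contains no loose point besides \<open>p\<close> is light
  because \<open>1 \<le> m\<close>.\<close>

lemma structured_grow_loose:
  assumes st: "structured m L l" and m: "1 \<le> m"
    and off: "\<And>i. i \<in> {1..m} \<Longrightarrow> L i \<noteq> [] \<Longrightarrow> p \<notin> l i" and p: "p \<notin> set (L 0)"
    and light: "\<And>r. r \<in> set (L 0) \<Longrightarrow> card (set (L 0) \<inter> thru p r) < m"
  shows "structured m (L(0 := L 0 @ [p])) l"
proof -
  have "card (k \<inter> insert p (set (L 0))) \<le> m" if k: "is_line k" for k
  proof (cases "p \<in> k \<and> k \<inter> set (L 0) \<noteq> {}")
    case True
    then obtain r where r: "r \<in> k" "r \<in> set (L 0)" by blast
    then have "p \<noteq> r" using p by blast
    then have "k = thru p r"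
      using lines_eqI[OF k is_line_thru, of p r p r] True r thru_contains(1)[of p r]
        thru_contains(2)[of r p] by blast
    then have "card (k \<inter> set (L 0)) < m" using light[OF r(2)] by (simp add: Int_commute)
    moreover have "k \<inter> insert p (set (L 0)) = insert p (k \<inter> set (L 0))" using True by blast
    ultimately show ?thesis using p by simp
  next
    case False
    show ?thesis
    proof (cases "p \<in> k")
      case True
      then have "k \<inter> insert p (set (L 0)) = {p}" using False by blast
      then show ?thesis using m by simp
    next
      case False
      then have "k \<inter> insert p (set (L 0)) = k \<inter> set (L 0)" by blast
      then show ?thesis using st k unfolding structured_def by simp
    qed
  qed
  moreover have "{i\<in>{1..m}. (L(0 := L 0 @ [p])) i \<noteq> []} = {i\<in>{1..m}. L i \<noteq> []}" by auto
  ultimately show ?thesis using st off unfolding structured_def by auto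
qed

text \<open>The at least \<open>m\<close> loose points on \<open>thru p r\<close> together with
  \<open>p\<close> are more than \<open>m\<close>. Injectivity survives because \<open>p\<close>
  lies on the new line and on none of the old ones.\<close>

lemma structured_new_line:
  assumes st: "structured m L l"
    and off: "\<And>i. i \<in> {1..m} \<Longrightarrow> L i \<noteq> [] \<Longrightarrow> p \<notin> l i" and p: "p \<notin> set (L 0)"
    and heavy: "r \<in> set (L 0)" "m \<le> card (set (L 0) \<inter> thru p r)"
    and k: "k \<in> {1..m}"
    and L': "set (L' 0) = insert p (set (L 0)) - thru p r"
      "set (L' k) = insert p (set (L 0)) \<inter> thru p r" "distinct (L' k)"
      "\<And>i. i \<in> {1..m} \<Longrightarrow> i \<noteq> k \<Longrightarrow> L' i = L i"
    and l': "l' k = thru p r" "\<And>i. i \<noteq> k \<Longrightarrow> l' i = l i"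
  shows "structured m L' l'"
proof -
  have pr: "p \<noteq> r" using p heavy(1) by blast
  have "set (L' k) = insert p (set (L 0) \<inter> thru p r)" using L'(2) thru_contains(1)[of p r] by auto
  then have "card (set (L' k)) = Suc (card (set (L 0) \<inter> thru p r))" using p by simp
  then have len: "m < length (L' k)" using heavy(2) L'(3) by (simp add: distinct_card)
  have sub: "set (L' 0) \<subseteq> set (L 0)" using L'(1) thru_contains(1)[of p r] by auto
  have "card (j \<inter> set (L' 0)) \<le> m" if "is_line j" for j
  proof -
    have "card (j \<inter> set (L' 0)) \<le> card (j \<inter> set (L 0))"
      by (rule card_mono) (use sub in auto)
    then show ?thesis using st that unfolding structured_def by (meson le_trans)
  qed
  moreover have "m < length (L' i) \<and> is_line (l' i) \<and> set (L' i) \<subseteq> l' i \<and> set (L' 0) \<inter> l' i = {}"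
    if i: "i \<in> {1..m}" "L' i \<noteq> []" for i
  proof (cases "i = k")
    case True
    then show ?thesis using len L' l' is_line_thru[OF pr] by auto
  next
    case False
    then show ?thesis using st i L'(4) l' sub unfolding structured_def by fastforce
  qed
  moreover have "inj_on l' {i\<in>{1..m}. L' i \<noteq> []}"
  proof (rule inj_onI)
    fix i j assume ij: "i \<in> {i\<in>{1..m}. L' i \<noteq> []}" "j \<in> {i\<in>{1..m}. L' i \<noteq> []}" "l' i = l' j"
    have *: "a = k" if "a \<in> {1..m}" "L' a \<noteq> []" "l' a = thru p r" for a
      using off[of a] that L'(4)[of a] l'(2)[of a] thru_contains(1)[of p r] by (cases "a = k") auto
    show "i = j"
    proof (cases "i = k \<or> j = k")
      case True
      then show ?thesis using ij * l'(1) by auto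
    next
      case False
      then show ?thesis using ij st L'(4) l' unfolding structured_def inj_on_def by auto
    qed
  qed
  ultimately show ?thesis unfolding structured_def by blast
qed

text \<open>The size \<open>n\<close> of the cover may be below the threshold \<open>m\<close>: this
  form serves both the count of the slots, with \<open>n = m\<close>, and queries for fewer
  lines.\<close>

lemma heavy_lines_in_cover:
  assumes st: "structured m L l" and dist: "\<And>i. i \<le> m \<Longrightarrow> distinct (L i)"
    and sub: "stored m L \<subseteq> P" and fin: "finite P" and cover: "line_cover n P Ls" and n: "n \<le> m"
    and i: "i \<in> {1..m}" "L i \<noteq> []"
  shows "l i \<in> Ls"
proof -
  have 1: "m < length (L i)" "is_line (l i)" "set (L i) \<subseteq> l i" using st i unfolding structured_def by blast+
  have "set (L i) \<subseteq> P" using sub i(1) by auto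
  then have "card (set (L i)) \<le> card (l i \<inter> P)" using 1 fin by (intro card_mono) auto
  moreover have "card (set (L i)) = length (L i)" using dist[of i] i(1) by (simp add: distinct_card)
  ultimately show ?thesis using heavy_line_in_cover[OF cover 1(2)] 1(1) n by simp
qed

text \<open>Were all \<open>m\<close> slots in use, their lines and \<open>thru p r\<close> would be
  \<open>m + 1\<close> different lines in a cover by \<open>m\<close> lines. Here an insertion
  relies on the promise for the enlarged point set.\<close>

lemma free_slot:
  assumes st: "structured m L l" and dist: "\<And>i. i \<le> m \<Longrightarrow> distinct (L i)"
    and cov: "coverable m (insert p (stored m L))"
    and off: "\<And>i. i \<in> {1..m} \<Longrightarrow> L i \<noteq> [] \<Longrightarrow> p \<notin> l i" and p: "p \<notin> stored m L"
    and heavy: "r \<in> set (L 0)" "m \<le> card (set (L 0) \<inter> thru p r)"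
  shows "\<exists>k\<in>{1..m}. L k = []"
proof (rule ccontr)
  assume full: "\<not> ?thesis"
  let ?P = "insert p (stored m L)"
  have finP: "finite ?P" by simp
  obtain Ls where Ls: "line_cover m ?P Ls" using cov unfolding coverable_def by blast
  have "l ` {1..m} \<subseteq> Ls"
    using heavy_lines_in_cover[OF st dist _ finP Ls] full by blast
  moreover have "thru p r \<in> Ls"
  proof (rule heavy_line_in_cover[OF Ls])
    have p0: "p \<notin> set (L 0)" using p by auto
    then show "is_line (thru p r)" using heavy(1) by (intro is_line_thru) auto
    have "set (L 0) \<subseteq> stored m L" by auto
    then have "insert p (set (L 0) \<inter> thru p r) \<subseteq> thru p r \<inter> ?P"
      using thru_contains(1)[of p r] by blast
    then have "card (insert p (set (L 0) \<inter> thru p r)) \<le> card (thru p r \<inter> ?P)"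
      by (intro card_mono) auto
    then show "m < card (thru p r \<inter> ?P)" using heavy(2) p0 by simp
  qed
  ultimately have sub: "insert (thru p r) (l ` {1..m}) \<subseteq> Ls" by blast
  have "thru p r \<notin> l ` {1..m}" using off full thru_contains(1)[of p r] by auto
  moreover have "card (l ` {1..m}) = m"
  proof -
    have "{i\<in>{1..m}. L i \<noteq> []} = {1..m}" using full by auto
    then have "inj_on l {1..m}" using st unfolding structured_def by simp
    then show ?thesis by (simp add: card_image)
  qed
  ultimately have "card (insert (thru p r) (l ` {1..m})) = Suc m" by simp
  moreover have "card (insert (thru p r) (l ` {1..m})) \<le> m"
    using card_mono[OF _ sub] Ls unfolding line_cover_def by (meson le_trans)
  ultimately show False by simp
qed

section \<open>Insertion\<close>

definition on_line :: "exp \<Rightarrow> exp \<Rightarrow> exp \<Rightarrow> cond" where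
  "on_line e x y = Equal (Add (Mul (Get ''A'' [e]) x) (Mul (Get ''B'' [e]) y)) (Get ''C'' [e])"

definition slot_line :: "state \<Rightarrow> nat \<Rightarrow> point set" where
  "slot_line s i = line_of (s ''A'' [real i]) (s ''B'' [real i]) (s ''C'' [real i])"

lemma holds_on_line:
  "eval s e = real i \<Longrightarrow> holds s (on_line e x y) \<longleftrightarrow> (eval s x, eval s y) \<in> slot_line s i"
  by (simp add: on_line_def slot_line_def line_of_def)

lemma slot_line_cong:
  "s' ''A'' = s ''A'' \<Longrightarrow> s' ''B'' = s ''B'' \<Longrightarrow> s' ''C'' = s ''C'' \<Longrightarrow> slot_line s' = slot_line s"
  by (simp add: slot_line_def fun_eq_iff)

abbreviation find_test :: cond where
  "find_test \<equiv> And (Less (Const 0) (Get ''n'' [Var ''i''])) (on_line (Var ''i'') (Var ''x'') (Var ''y''))"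

text \<open>The value 0 of \<open>slot\<close> says that no heavy line contains the point and at the
  same time names the slot of the loose points. If several heavy lines contain it, the last one
  found is kept; any of them would do.\<close>

definition find_com :: com where
  "find_com =
    ''slot'' ::= Const 0 ;; ''i'' ::= Const 1 ;;
    While (LessEq (Var ''i'') (Var ''m''))
      (If find_test
         (''slot'' ::= Var ''i'') Skip ;;
       Inc ''i'')"

lemma runs_find:
  assumes st: "stores m s L" and m: "s ''m'' [] = real m" and F: "m + 1 \<le> F"
    and p: "s ''x'' [] = fst p" "s ''y'' [] = snd p"
    and Q: "\<And>s' k. k \<le> m \<Longrightarrow> s' ''slot'' [] = real k \<Longrightarrow>
      (if k = 0 then \<forall>i\<in>{1..m}. L i \<noteq> [] \<longrightarrow> p \<notin> slot_line s i
       else L k \<noteq> [] \<and> p \<in> slot_line s k) \<Longrightarrow>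
      frame {''slot'', ''i''} s s' \<Longrightarrow> Q s'"
  shows "runs find_com s F Q"
proof -
  let ?b = "LessEq (Var ''i'') (Var ''m'')"
  let ?step = "If find_test (''slot'' ::= Var ''i'') Skip"
  let ?inc = "Inc ''i''"
  define I where "I c s' \<longleftrightarrow> frame {''slot'', ''i''} s s' \<and> s' ''i'' [] = real (Suc c) \<and>
     (\<exists>k\<le>m. s' ''slot'' [] = real k \<and>
      (if k = 0 then \<forall>i\<in>{1..c}. L i \<noteq> [] \<longrightarrow> p \<notin> slot_line s i
       else L k \<noteq> [] \<and> p \<in> slot_line s k))" for c s'
  have F1: "1 \<le> F" using F by simp
  have body: "holds s' ?b \<and> runs (?step ;; ?inc) s' 1 (I (Suc c))"
    if c: "c < m" and I: "I c s'" for c s'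
  proof
    have same: "frame {''slot'', ''i''} s s'" and i: "s' ''i'' [] = real (Suc c)"
      using I by (auto simp: I_def)
    note s = frameD[OF same]
    obtain k where k: "k \<le> m" "s' ''slot'' [] = real k"
      "if k = 0 then \<forall>i\<in>{1..c}. L i \<noteq> [] \<longrightarrow> p \<notin> slot_line s i else L k \<noteq> [] \<and> p \<in> slot_line s k"
      using I by (auto simp: I_def)
    show "holds s' ?b" using c i m s by simp
    have sl: "slot_line s' = slot_line s" by (rule slot_line_cong) (simp_all add: s)
    have n: "s' ''n'' [real (Suc c)] = real (length (L (Suc c)))"
      using storesD(1)[OF st, of "Suc c"] c s by simp
    have test: "holds s' find_test
       \<longleftrightarrow> L (Suc c) \<noteq> [] \<and> p \<in> slot_line s (Suc c)"
      using holds_on_line[of s' "Var ''i''" "Suc c" "Var ''x''" "Var ''y''"] n i p s sl by simp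
    show "runs (?step ;; ?inc) s' 1 (I (Suc c))"
    proof (rule runs_Seq, rule runs_If)
      assume "holds s' find_test"
      then have hit: "L (Suc c) \<noteq> []" "p \<in> slot_line s (Suc c)" using test by blast+
      show "runs (''slot'' ::= Var ''i'') s' 1 (\<lambda>s'. runs ?inc s' 1 (I (Suc c)))"
        by (intro runs_Put) (use hit c i same in
          \<open>auto simp: I_def intro!: frame_set_cell exI[of _ "Suc c"]\<close>)
    next
      assume "\<not> holds s' find_test"
      then have miss: "L (Suc c) \<noteq> [] \<longrightarrow> p \<notin> slot_line s (Suc c)" using test by blast
      have "{1..Suc c} = insert (Suc c) {1..c}" by auto
      then show "runs Skip s' 1 (\<lambda>s'. runs ?inc s' 1 (I (Suc c)))"
        by (intro runs_Skip runs_Put) (use miss k c i same in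
          \<open>auto simp: I_def intro!: frame_set_cell exI[of _ k]\<close>)
    qed simp
  qed
  show ?thesis
    unfolding find_com_def
    apply (rule runs_Put_Seq[OF _ F1], rule runs_Put_Seq[OF _ F1])
    apply (rule runs_for[where N = m and F = 1 and I = I, OF _ body])
        apply (auto simp: I_def intro!: frame_set_cell)[1]
       apply assumption+
    subgoal for s' using Q[of _ s'] frameD[of _ s s'] m by (auto simp: I_def)
    using F by auto
qed

section \<open>Counting loose points by direction\<close>

definition dir_exps :: "exp list" where
  "dir_exps =
    [Div (Sub (Get ''X'' [Const 0, Var ''j'']) (Var ''x'')) (Sub (Get ''X'' [Const 0, Var ''j'']) (Var ''x'')),
     Div (Sub (Get ''Y'' [Const 0, Var ''j'']) (Var ''y'')) (Sub (Get ''X'' [Const 0, Var ''j'']) (Var ''x''))]"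

text \<open>The first pass clears the counters of just those directions that will be used, as
  \<open>D\<close> may hold values of earlier insertions and cannot be reset as a whole.
  \<open>f\<close> is the index of a loose point whose direction has reached \<open>m\<close>,
  shifted by one so that 0 can mean that there is none.\<close>

definition count_com :: com where
  "count_com =
    ''j'' ::= Const 0 ;;
    While (Less (Var ''j'') (Get ''n'' [Const 0]))
      (Put ''D'' dir_exps (Const 0) ;;
       Inc ''j'') ;;
    ''j'' ::= Const 0 ;;
    While (Less (Var ''j'') (Get ''n'' [Const 0]))
      (Put ''D'' dir_exps (Add (Get ''D'' dir_exps) (Const 1)) ;;
       If (LessEq (Var ''m'') (Get ''D'' dir_exps)) (''f'' ::= Add (Var ''j'') (Const 1)) Skip ;;
       Inc ''j'')"

lemma card_indices:
  assumes "distinct xs"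
  shows "card {i. i < length xs \<and> P (xs ! i)} = card {x \<in> set xs. P x}"
proof -
  have "bij_betw (\<lambda>i. xs ! i) {i. i < length xs \<and> P (xs ! i)} {x \<in> set xs. P x}"
    using assms by (auto simp: bij_betw_def inj_on_def nth_eq_iff_index_eq in_set_conv_nth)
  then show ?thesis by (rule bij_betw_same_card)
qed

lemma card_less_Suc_filter:
  "card {i. i < Suc c \<and> P i} = card {i. i < c \<and> P i} + (if P c then 1 else 0)"
proof -
  have "{i. i < Suc c \<and> P i} = (if P c then insert c {i. i < c \<and> P i} else {i. i < c \<and> P i})"
    by (auto simp: less_Suc_eq)
  then show ?thesis by simp
qed

lemma runs_count:
  assumes st: "stores m s L" and m: "s ''m'' [] = real m" and F: "length (L 0) + 1 \<le> F"
    and p: "s ''x'' [] = fst p" "s ''y'' [] = snd p" "p \<notin> set (L 0)" and f0: "s ''f'' [] = 0"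
    and light: "\<And>s'. frame {''j'', ''f'', ''D''} s s' \<Longrightarrow> s' ''f'' [] = 0 \<Longrightarrow>
      (\<And>r. r \<in> set (L 0) \<Longrightarrow> card (set (L 0) \<inter> thru p r) < m) \<Longrightarrow> Q s'"
    and heavy: "\<And>s' j. frame {''j'', ''f'', ''D''} s s' \<Longrightarrow> s' ''f'' [] = real (Suc j) \<Longrightarrow>
      j < length (L 0) \<Longrightarrow> m \<le> card (set (L 0) \<inter> thru p (L 0 ! j)) \<Longrightarrow> Q s'"
  shows "runs count_com s F Q"
proof -
  let ?V = "{''j'', ''f'', ''D''}"
  let ?b = "Less (Var ''j'') (Get ''n'' [Const 0])"
  let ?inc = "Inc ''j''"
  let ?clear = "Put ''D'' dir_exps (Const 0) ;; ?inc"
  let ?test = "LessEq (Var ''m'') (Get ''D'' dir_exps)"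
  let ?step = "If ?test (''f'' ::= Add (Var ''j'') (Const 1)) Skip"
  let ?tally = "Put ''D'' dir_exps (Add (Get ''D'' dir_exps) (Const 1)) ;; ?step ;; ?inc"
  let ?second = "''j'' ::= Const 0 ;; While ?b ?tally"
  define N where "N = length (L 0)"
  define d where "d j = direction p (L 0 ! j)" for j
  \<comment> \<open>The value expected in the counter of direction \<open>d j\<close> after the
    first \<open>c\<close> loose points; indices with equal directions share the counter.\<close>
  define cnt where "cnt c j = card {i. i < c \<and> d i = d j}" for c j
  have F1: "1 \<le> F" using F by simp
  have eval_dir: "map (eval s') dir_exps = d j"
    if "frame ?V s s'" "s' ''j'' [] = real j" "j < N" for s' j
    using that storesD(2,3)[OF st, of 0 j] p frameD[OF that(1)]
    by (simp add: dir_exps_def direction_def d_def N_def)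
  have n: "s ''n'' [0] = real N" using storesD(1)[OF st, of 0] by (simp add: N_def)
  have cnt_Suc: "cnt (Suc c) j = cnt c j + (if d c = d j then 1 else 0)" for c j
    unfolding cnt_def by (rule card_less_Suc_filter)
  have cnt_cong: "d i = d j \<Longrightarrow> cnt c i = cnt c j" for i j c by (simp add: cnt_def)
  have cnt_mono: "c \<le> N \<Longrightarrow> cnt c j \<le> cnt N j" for c j
    unfolding cnt_def by (intro card_mono) auto
  have cnt: "cnt N j = card (set (L 0) \<inter> thru p (L 0 ! j))" if "j < N" for j
  proof -
    have "cnt N j = card {r \<in> set (L 0). direction p r = d j}"
      using card_indices[OF stores_distinct[OF st], of 0 "\<lambda>r. direction p r = d j"]
      by (simp add: cnt_def d_def N_def)
    also have "{r \<in> set (L 0). direction p r = d j} = set (L 0) \<inter> thru p (L 0 ! j)"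
    proof -
      have "direction p r = d j \<longleftrightarrow> r \<in> thru p (L 0 ! j)" if r: "r \<in> set (L 0)" for r
      proof -
        have "r \<noteq> p" "L 0 ! j \<noteq> p" using p(3) r \<open>j < N\<close> by (auto simp: N_def)
        then have "d j = direction p r \<longleftrightarrow> r \<in> thru p (L 0 ! j)"
          unfolding d_def by (intro direction_eq_iff)
        then show ?thesis by auto
      qed
      then show ?thesis by blast
    qed
    finally show ?thesis .
  qed
  define I where "I c s' \<longleftrightarrow> frame ?V s s' \<and> s' ''j'' [] = real c \<and>
    s' ''f'' [] = 0 \<and> (\<forall>j<c. s' ''D'' (d j) = 0)" for c s'
  \<comment> \<open>Lightness is claimed only for the points and counts reached so far, whereas a
    mark in \<open>f\<close> refers to the final count \<open>cnt N j\<close>. The mark remains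
    correct because counts only grow.\<close>
  define J where "J c s' \<longleftrightarrow> frame ?V s s' \<and> s' ''j'' [] = real c \<and>
    (\<forall>j<N. s' ''D'' (d j) = real (cnt c j)) \<and>
    (s' ''f'' [] = 0 \<and> (\<forall>j<c. cnt c j < m) \<or>
     (\<exists>j<N. s' ''f'' [] = real (Suc j) \<and> m \<le> cnt N j))" for c s'
  have clear: "holds s' ?b \<and>
     runs ?clear s' 1 (I (Suc c))"
    if c: "c < N" and I: "I c s'" for c s'
  proof
    have same: "frame ?V s s'" and j: "s' ''j'' [] = real c"
      "s' ''f'' [] = 0" "\<forall>j<c. s' ''D'' (d j) = 0"
      using I by (auto simp: I_def)
    note s = frameD[OF same]
    show "holds s' ?b" using c j n s by simp
    show "runs ?clear s' 1 (I (Suc c))"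
      unfolding I_def
      by (intro runs_Seq runs_Put) (use eval_dir[OF same j(1) c] j same in
        \<open>auto simp: less_Suc_eq intro!: frame_set_cell\<close>)
  qed
  have tally: "holds s' ?b \<and>
     runs ?tally s' 1 (J (Suc c))"
    if c: "c < N" and J: "J c s'" for c s'
  proof
    have same: "frame ?V s s'" and j: "s' ''j'' [] = real c"
      and D: "\<forall>j<N. s' ''D'' (d j) = real (cnt c j)"
      and f: "s' ''f'' [] = 0 \<and> (\<forall>j<c. cnt c j < m) \<or> (\<exists>j<N. s' ''f'' [] = real (Suc j) \<and> m \<le> cnt N j)"
      using J by (auto simp: J_def)
    note s = frameD[OF same]
    show "holds s' ?b" using c j n s by simp
    define s1 where "s1 = set_cell ''D'' (d c) (real (cnt c c) + 1) s'"
    have same1: "frame ?V s s1"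
      using same by (simp add: s1_def frame_set_cell)
    note s1 = frameD[OF same1]
    have j1: "s1 ''j'' [] = real c" using j by (simp add: s1_def)
    have f1: "s1 ''f'' = s' ''f''" by (simp add: s1_def)
    have D1: "\<forall>j<N. s1 ''D'' (d j) = real (cnt (Suc c) j)"
    proof (intro allI impI)
      fix j assume "j < N"
      then show "s1 ''D'' (d j) = real (cnt (Suc c) j)"
        using D cnt_cong[of c j c] by (cases "d c = d j") (simp_all add: s1_def cnt_Suc)
    qed
    have "runs (?step ;; ?inc) s1 1 (J (Suc c))"
    proof (rule runs_Seq, rule runs_If)
      assume "holds s1 ?test"
      then have "m \<le> cnt (Suc c) c" using eval_dir[OF same1 j1 c] D1 c m s1 by simp
      then have "m \<le> cnt N c" using cnt_mono[of "Suc c" c] c by simp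
      then show "runs (''f'' ::= Add (Var ''j'') (Const 1)) s1 1
         (\<lambda>s'. runs ?inc s' 1 (J (Suc c)))"
        by (intro runs_Put) (use D1 c j1 same1 in
          \<open>auto simp: J_def intro!: frame_set_cell exI[of _ c]\<close>)
    next
      assume "\<not> holds s1 ?test"
      then have less: "cnt (Suc c) c < m" using eval_dir[OF same1 j1 c] D1 c m s1 by simp
      \<comment> \<open>Only the direction of the point just counted has changed its count, and that
        one has just been tested.\<close>
      have "cnt (Suc c) j < m" if "\<forall>j<c. cnt c j < m" "j < Suc c" for j
      proof (cases "d c = d j")
        case True
        then show ?thesis using less cnt_cong by metis
      next
        case False
        then have "j < c" using that(2) by (metis less_Suc_eq)
        then show ?thesis using that(1) False by (simp add: cnt_Suc)
      qed
      then have "s1 ''f'' [] = 0 \<and> (\<forall>j<Suc c. cnt (Suc c) j < m) \<or>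
         (\<exists>j<N. s1 ''f'' [] = real (Suc j) \<and> m \<le> cnt N j)"
        using f unfolding f1 by blast
      then show "runs Skip s1 1
         (\<lambda>s'. runs ?inc s' 1 (J (Suc c)))"
        using D1 j1 same1 unfolding J_def
        by (intro runs_Skip runs_Put) (simp_all add: frame_set_cell)
    qed simp
    then show "runs ?tally s' 1 (J (Suc c))"
      using eval_dir[OF same j c] D c by (intro runs_Put_Seq) (simp_all add: s1_def)
  qed
  have time: "N * 1 + 1 \<le> F" using F by (simp add: N_def)
  have second: "runs ?second s' F Q" if I: "I N s'" for s'
  proof (rule runs_Put_Seq[OF _ F1], rule runs_for[where N = N and F = 1 and I = J, OF _ tally _ _ time])
    show "J 0 (set_cell ''j'' (map (eval s') []) (eval s' (Const 0)) s')"
      using I by (auto simp: J_def I_def cnt_def intro!: frame_set_cell)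
    fix t assume J: "J N t"
    then have same: "frame ?V s t" and j: "t ''j'' [] = real N"
      and f: "t ''f'' [] = 0 \<and> (\<forall>j<N. cnt N j < m) \<or> (\<exists>j<N. t ''f'' [] = real (Suc j) \<and> m \<le> cnt N j)"
      by (auto simp: J_def)
    have "\<not> holds t ?b" using j n frameD[OF same] by simp
    moreover have "Q t"
      using f
    proof
      assume f: "t ''f'' [] = 0 \<and> (\<forall>j<N. cnt N j < m)"
      then show "Q t" using cnt by (intro light[OF same]) (auto simp: in_set_conv_nth N_def)
    next
      assume "\<exists>j<N. t ''f'' [] = real (Suc j) \<and> m \<le> cnt N j"
      then obtain j where "j < N" "t ''f'' [] = real (Suc j)" "m \<le> cnt N j" by blast
      then show "Q t" using cnt[of j] by (intro heavy[OF same, of j]) (auto simp: N_def)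
    qed
    ultimately show "\<not> holds t ?b \<and> Q t" ..
  qed simp_all
  show ?thesis
    unfolding count_com_def
  proof (rule runs_Put_Seq[OF _ F1], rule runs_Seq,
      rule runs_for[where N = N and F = 1 and I = I, OF _ clear _ _ time])
    show "I 0 (set_cell ''j'' (map (eval s) []) (eval s (Const 0)) s)"
      using f0 by (auto simp: I_def intro!: frame_set_cell)
    fix t assume I: "I N t"
    then have "\<not> holds t ?b"
      using n frameD[of "?V" s t "''n''"] by (simp add: I_def)
    then show "\<not> holds t ?b \<and>
       runs ?second t F Q"
      using second[OF I] by blast
  qed simp_all
qed

section \<open>Moving the points of a new heavy line\<close>

definition free_com :: com where
  "free_com =
    ''i'' ::= Const 1 ;;
    While (LessEq (Var ''i'') (Var ''m''))
      (If (Equal (Get ''n'' [Var ''i'']) (Const 0)) (''fs'' ::= Var ''i'') Skip ;;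
       Inc ''i'')"

lemma runs_free:
  assumes st: "stores m s L" and m: "s ''m'' [] = real m" and F: "m + 1 \<le> F"
    and free: "\<exists>k\<in>{1..m}. L k = []"
    and Q: "\<And>s' k. k \<in> {1..m} \<Longrightarrow> L k = [] \<Longrightarrow> s' ''fs'' [] = real k \<Longrightarrow>
      frame {''fs'', ''i''} s s' \<Longrightarrow> Q s'"
  shows "runs free_com s F Q"
proof -
  let ?b = "LessEq (Var ''i'') (Var ''m'')"
  let ?test = "Equal (Get ''n'' [Var ''i'']) (Const 0)"
  let ?step = "If ?test (''fs'' ::= Var ''i'') Skip"
  let ?inc = "Inc ''i''"
  define I where "I c s' \<longleftrightarrow> frame {''fs'', ''i''} s s' \<and> s' ''i'' [] = real (Suc c) \<and>
     ((\<exists>k\<in>{1..c}. L k = []) \<longrightarrow> (\<exists>k\<in>{1..c}. L k = [] \<and> s' ''fs'' [] = real k))" for c s'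
  have F1: "1 \<le> F" using F by simp
  have body: "holds s' ?b \<and> runs (?step ;; ?inc) s' 1 (I (Suc c))"
    if c: "c < m" and I: "I c s'" for c s'
  proof
    have same: "frame {''fs'', ''i''} s s'" and i: "s' ''i'' [] = real (Suc c)"
      using I by (auto simp: I_def)
    note s = frameD[OF same]
    show "holds s' ?b" using c i m s by simp
    have test: "holds s' ?test \<longleftrightarrow> L (Suc c) = []"
      using storesD(1)[OF st, of "Suc c"] c s i by simp
    show "runs (?step ;; ?inc) s' 1 (I (Suc c))"
    proof (rule runs_Seq, rule runs_If)
      assume "holds s' ?test"
      then have "L (Suc c) = []" using test by simp
      then show "runs (''fs'' ::= Var ''i'') s' 1 (\<lambda>s'. runs ?inc s' 1 (I (Suc c)))"
        by (intro runs_Put) (use c i same in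
          \<open>auto simp: I_def intro!: frame_set_cell bexI[of _ "Suc c"]\<close>)
    next
      assume "\<not> holds s' ?test"
      then have no: "L (Suc c) \<noteq> []" using test by simp
      have eq: "{1..Suc c} = insert (Suc c) {1..c}" by auto
      have "(\<exists>k\<in>{1..Suc c}. L k = []) \<longrightarrow> (\<exists>k\<in>{1..Suc c}. L k = [] \<and> s' ''fs'' [] = real k)"
        using I no unfolding I_def eq by blast
      then show "runs Skip s' 1 (\<lambda>s'. runs ?inc s' 1 (I (Suc c)))"
        unfolding I_def
        by (intro runs_Skip runs_Put) (use i same in \<open>simp_all add: frame_set_cell\<close>)
    qed simp
  qed
  show ?thesis
    unfolding free_com_def
  proof (rule runs_Put_Seq[OF _ F1], rule runs_for[where N = m and F = 1 and I = I, OF _ body])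
    show "I 0 (set_cell ''i'' (map (eval s) []) (eval s (Const 1)) s)"
      by (auto simp: I_def intro!: frame_set_cell)
    fix t assume I: "I m t"
    then have same: "frame {''fs'', ''i''} s t" by (simp add: I_def)
    obtain k where "k \<in> {1..m}" "L k = []" "t ''fs'' [] = real k"
      using I free by (auto simp: I_def)
    then show "\<not> holds t ?b \<and> Q t"
      using Q same I m frameD[OF same, of "''m''"] by (simp add: I_def)
  qed (use F in auto)
qed

abbreviation move_step :: com where
  "move_step \<equiv> ''j'' ::= Sub (Var ''j'') (Const 1) ;;
       ''px'' ::= Get ''X'' [Const 0, Var ''j''] ;;
       ''py'' ::= Get ''Y'' [Const 0, Var ''j''] ;;
       If (on_line (Var ''fs'') (Var ''px'') (Var ''py''))
         (remove_com ;; ''slot'' ::= Var ''fs'' ;; append_com) Skip"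

text \<open>The loose slot is traversed from the back. A removal fills the gap with the last entry,
  which has been examined already and is off the new line, so no point is skipped. A forward
  traversal would have to examine the same position again.\<close>

definition move_com :: com where
  "move_com =
    ''j'' ::= Get ''n'' [Const 0] ;;
    While (Less (Const 0) (Var ''j''))
      move_step"

abbreviation move_vars :: "vname set" where
  "move_vars \<equiv> remove_vars \<union> {''slot'', ''j'', ''px'', ''py''}"

lemma runs_move:
  assumes st: "stores m s L" and F: "length (L 0) + 1 \<le> F"
    and fs: "s ''fs'' [] = real k" "k \<in> {1..m}" "L k = []"
    and Q: "\<And>s' L'. frame move_vars s s' \<Longrightarrow> stores m s' L' \<Longrightarrow>
      set (L' 0) = set (L 0) - slot_line s k \<Longrightarrow> set (L' k) = set (L 0) \<inter> slot_line s k \<Longrightarrow>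
      (\<And>i. i \<noteq> 0 \<Longrightarrow> i \<noteq> k \<Longrightarrow> L' i = L i) \<Longrightarrow> Q s'"
  shows "runs move_com s F Q"
proof -
  define N where "N = length (L 0)"
  define l where "l = slot_line s k"
  have F1: "1 \<le> F" using F by simp
  have k0: "k \<noteq> 0" and km: "k \<le> m" using fs(2) by auto
  \<comment> \<open>\<open>N - c\<close> is the index reached: the entries from there on have been
    examined and lie off the line.\<close>
  define I where "I c s' \<longleftrightarrow> frame move_vars s s' \<and> s' ''j'' [] = real (N - c) \<and>
    (\<exists>L'. stores m s' L' \<and> set (L' 0) \<union> set (L' k) = set (L 0) \<and> set (L' k) \<subseteq> l \<and>
      (\<forall>i. i \<noteq> 0 \<longrightarrow> i \<noteq> k \<longrightarrow> L' i = L i) \<and> N - c \<le> length (L' 0) \<and>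
      (\<forall>t. N - c \<le> t \<longrightarrow> t < length (L' 0) \<longrightarrow> L' 0 ! t \<notin> l))" for c s'
  have n: "s ''n'' [0] = real N" using storesD(1)[OF st, of 0] by (simp add: N_def)
  have body: "holds s' (Less (Const 0) (Var ''j'')) \<and> runs move_step s' 1 (I (Suc c))"
    if c: "c < N" and I: "I c s'" for c s'
  proof
    obtain L' where same: "frame move_vars s s'" and j: "s' ''j'' [] = real (N - c)"
      and st': "stores m s' L'" and un: "set (L' 0) \<union> set (L' k) = set (L 0)" and sub: "set (L' k) \<subseteq> l"
      and other: "\<And>i. i \<noteq> 0 \<Longrightarrow> i \<noteq> k \<Longrightarrow> L' i = L i" and len: "N - c \<le> length (L' 0)"
      and checked: "\<And>t. N - c \<le> t \<Longrightarrow> t < length (L' 0) \<Longrightarrow> L' 0 ! t \<notin> l"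
      using I unfolding I_def by blast
    define t where "t = N - Suc c"
    have t: "N - c = Suc t" "real (N - c) - 1 = real t" using c by (simp_all add: t_def of_nat_diff)
    have tl: "t < length (L' 0)" using len t by simp
    define q where "q = L' 0 ! t"
    show "holds s' (Less (Const 0) (Var ''j''))" using j t by simp
    define s1 where "s1 = set_cell ''py'' [] (snd q) (set_cell ''px'' [] (fst q) (set_cell ''j'' [] (real t) s'))"
    have same1: "frame move_vars s s1"
      unfolding s1_def by (intro frame_set_cell same) simp_all
    note s1 = frameD[OF same1]
    have st1: "stores m s1 L'" using st' by (rule stores_cong) (simp_all add: s1_def)
    have v1: "s1 ''px'' [] = fst q" "s1 ''py'' [] = snd q" "s1 ''j'' [] = real t"
      by (simp_all add: s1_def)
    have sl: "slot_line s1 = slot_line s" by (rule slot_line_cong) (simp_all add: s1)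
    have test: "holds s1 (on_line (Var ''fs'') (Var ''px'') (Var ''py'')) \<longleftrightarrow> q \<in> l"
      using holds_on_line[of s1 "Var ''fs''" k] fs s1 v1 sl by (simp add: l_def)
    have "runs (If (on_line (Var ''fs'') (Var ''px'') (Var ''py''))
         (remove_com ;; ''slot'' ::= Var ''fs'' ;; append_com) Skip) s1 1 (I (Suc c))"
    proof (rule runs_If)
      assume "holds s1 (on_line (Var ''fs'') (Var ''px'') (Var ''py''))"
      then have ql: "q \<in> l" using test by simp
      show "runs (remove_com ;; ''slot'' ::= Var ''fs'' ;; append_com) s1 1 (I (Suc c))"
      proof (intro runs_Seq, rule runs_remove[OF st1 _ tl q_def v1(1,2)])
        define L2 where "L2 = L'(0 := remove_at t (L' 0))"
        fix s2 assume st2: "stores m s2 (L'(0 := remove_at t (L' 0)))" and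
          same2: "frame remove_vars s1 s2"
        have set2: "set (L2 0) = set (L' 0) - {q}"
          using set_remove_at[OF stores_distinct[OF st1] tl] by (simp add: L2_def q_def)
        have q2: "q \<notin> stored m L2"
        proof
          assume "q \<in> stored m L2"
          then obtain i where i: "i \<le> m" "q \<in> set (L2 i)" by auto
          show False
          proof (cases "i = 0")
            case True
            then show False using i set2 by simp
          next
            case False
            then have "q \<in> set (L' i)" using i by (simp add: L2_def)
            moreover have "q \<in> set (L' 0)" using tl by (simp add: q_def)
            ultimately show False using stores_disjoint[OF st1 i(1), of 0 q] False by simp
          qed
        qed
        define s3 where "s3 = set_cell ''slot'' [] (real k) s2"
        have st3: "stores m s3 L2"
          unfolding s3_def L2_def by (rule stores_cong[OF st2]) simp_all
        have same3: "frame move_vars s s3"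
          unfolding s3_def by (intro frame_set_cell frame_trans[OF same1 same2]) auto
        have v3: "s3 ''px'' [] = fst q" "s3 ''py'' [] = snd q" "s3 ''j'' [] = real t" "s3 ''slot'' [] = real k"
          using v1 frameD[OF same2] by (simp_all add: s3_def)
        have "runs append_com s3 1 (I (Suc c))"
        proof (rule runs_append[OF st3 km v3(4,1,2) q2])
          fix s4 assume st4: "stores m s4 (L2(k := L2 k @ [q]))"
            and same4: "frame append_vars s3 s4"
          let ?L = "L2(k := L2 k @ [q])"
          have "frame move_vars s s4" by (rule frame_trans[OF same3 same4]) auto
          moreover have "s4 ''j'' [] = real t" using v3 frameD[OF same4] by simp
          moreover have "set (?L 0) \<union> set (?L k) = set (L 0)"
          proof -
            have "q \<in> set (L' 0)" using tl by (simp add: q_def)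
            moreover have "?L 0 = L2 0" "set (?L k) = insert q (set (L' k))" using k0 by (auto simp: L2_def)
            ultimately show ?thesis using set2 un by auto
          qed
          moreover have "set (?L k) \<subseteq> l" using sub ql k0 by (simp add: L2_def)
          moreover have "\<forall>i. i \<noteq> 0 \<longrightarrow> i \<noteq> k \<longrightarrow> ?L i = L i" using other by (simp add: L2_def)
          moreover have "t \<le> length (?L 0)" using tl k0 by (simp add: L2_def)
          moreover have "\<forall>u. t \<le> u \<longrightarrow> u < length (?L 0) \<longrightarrow> ?L 0 ! u \<notin> l"
          proof (intro allI impI)
            fix u assume u: "t \<le> u" "u < length (?L 0)"
            then have u': "u < length (L' 0) - 1" using k0 by (simp add: L2_def)
            have "?L 0 ! u = (if u = t then L' 0 ! (length (L' 0) - 1) else L' 0 ! u)"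
              using nth_remove_at[OF tl u'] k0 by (simp add: L2_def)
            then show "?L 0 ! u \<notin> l" using u u' checked t by (auto split: if_splits)
          qed
          ultimately show "I (Suc c) s4" using st4 unfolding I_def t_def by blast
        qed simp
        then show "runs (''slot'' ::= Var ''fs'' ;; append_com) s2 1 (I (Suc c))"
          using fs(1) frameD[OF same2, of "''fs''"] s1[of "''fs''"]
          by (intro runs_Put_Seq) (simp_all add: s3_def)
      qed simp_all
    next
      assume "\<not> holds s1 (on_line (Var ''fs'') (Var ''px'') (Var ''py''))"
      then have ql: "q \<notin> l" using test by simp
      have "L' 0 ! u \<notin> l" if "t \<le> u" "u < length (L' 0)" for u
        using checked[of u] that ql t(1) by (cases "u = t") (auto simp: q_def)
      then have "\<forall>u. t \<le> u \<longrightarrow> u < length (L' 0) \<longrightarrow> L' 0 ! u \<notin> l" by blast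
      moreover have "t \<le> length (L' 0)" using tl by simp
      ultimately have "I (Suc c) s1" unfolding I_def t_def[symmetric]
        using same1 v1(3) st1 un sub other by blast
      then show "runs Skip s1 1 (I (Suc c))" by (intro runs_Skip) simp_all
    qed simp
    moreover have "s' ''j'' [] = real t + 1" using j t(1) by simp
    ultimately show "runs move_step s' 1 (I (Suc c))"
      using storesD(2,3)[OF st' _ tl] by (intro runs_Put_Seq) (simp_all add: s1_def q_def)
  qed
  show ?thesis
    unfolding move_com_def
  proof (rule runs_Put_Seq[OF _ F1], rule runs_for[where N = N and F = 1 and I = I, OF _ body])
    define s1 where "s1 = set_cell ''j'' [] (real N) s"
    have "stores m s1 L" using st by (rule stores_cong) (simp_all add: s1_def)
    moreover have "frame move_vars s s1"
      unfolding s1_def by (intro frame_set_cell) simp_all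
    ultimately have "I 0 s1" unfolding I_def using fs(3) by (auto simp: N_def s1_def intro!: exI[of _ L])
    then show "I 0 (set_cell ''j'' (map (eval s) []) (eval s (Get ''n'' [Const 0])) s)"
      using n by (simp add: s1_def)
    fix t assume I: "I N t"
    then obtain L' where same: "frame move_vars s t" and j: "t ''j'' [] = 0"
      and st': "stores m t L'" and un: "set (L' 0) \<union> set (L' k) = set (L 0)" and sub: "set (L' k) \<subseteq> l"
      and other: "\<And>i. i \<noteq> 0 \<Longrightarrow> i \<noteq> k \<Longrightarrow> L' i = L i"
      and checked: "\<And>t. t < length (L' 0) \<Longrightarrow> L' 0 ! t \<notin> l"
      unfolding I_def by auto
    have "set (L' 0) \<inter> l = {}" using checked by (metis disjoint_iff in_set_conv_nth)
    then have "set (L' 0) = set (L 0) - slot_line s k" "set (L' k) = set (L 0) \<inter> slot_line s k"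
      using un sub unfolding l_def by blast+
    then have "Q t" using Q[OF same st'] other by blast
    then show "\<not> holds t (Less (Const 0) (Var ''j'')) \<and> Q t" using j by simp
  qed (use F in \<open>auto simp: N_def\<close>)
qed

section \<open>The complete insertion\<close>

definition new_line_com :: com where
  "new_line_com =
    ''qx'' ::= Get ''X'' [Const 0, Sub (Var ''f'') (Const 1)] ;;
    ''qy'' ::= Get ''Y'' [Const 0, Sub (Var ''f'') (Const 1)] ;;
    Put ''A'' [Var ''fs''] (Sub (Var ''y'') (Var ''qy'')) ;;
    Put ''B'' [Var ''fs''] (Sub (Var ''qx'') (Var ''x'')) ;;
    Put ''C'' [Var ''fs''] (Add (Mul (Get ''A'' [Var ''fs'']) (Var ''x'')) (Mul (Get ''B'' [Var ''fs'']) (Var ''y'')))"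

text \<open>When a line becomes heavy, the new point first joins the loose ones and is then moved
  together with them. Being appended at the end, it leaves the index \<open>f - 1\<close> of the
  other point on that line valid. If the point lies on a known heavy line, the count is skipped and
  \<open>f\<close> stays 0.\<close>

definition ins_com :: com where
  "ins_com =
    ''px'' ::= Var ''x'' ;; ''py'' ::= Var ''y'' ;;
    find_com ;;
    ''f'' ::= Const 0 ;;
    If (Equal (Var ''slot'') (Const 0)) count_com Skip ;;
    append_com ;;
    If (Less (Const 0) (Var ''f'')) (free_com ;; new_line_com ;; move_com) Skip"

lemma runs_new_line:
  assumes st: "stores m s L" and F: "1 \<le> F"
    and p: "s ''x'' [] = fst p" "s ''y'' [] = snd p" and fs: "s ''fs'' [] = real k"
    and j: "s ''f'' [] = real (Suc j)" "j < length (L 0)"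
    and Q: "\<And>s'. slot_line s' k = thru p (L 0 ! j) \<Longrightarrow>
      (\<And>i. i \<noteq> k \<Longrightarrow> slot_line s' i = slot_line s i) \<Longrightarrow>
      frame {''A'', ''B'', ''C'', ''qx'', ''qy''} s s' \<Longrightarrow> Q s'"
  shows "runs new_line_com s F Q"
  unfolding new_line_com_def
  using storesD(2,3)[OF st _ j(2)]
  apply -
  apply (rule runs_Put_Seq[OF _ F], simp add: p fs j)+
  apply (rule runs_Put[OF _ F], simp add: p fs)
  apply (rule Q)
    apply (simp add: slot_line_def thru_def)
   apply (simp add: slot_line_def)
  apply (intro frame_set_cell frame_refl; simp)
  done

text \<open>\<open>q\<close> is the number of lines that a query looks for; the initialisation sets
  it to \<open>min k m\<close>.\<close>

definition valid :: "nat \<Rightarrow> nat \<Rightarrow> state \<Rightarrow> point set \<Rightarrow> bool" where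
  "valid m q s P \<longleftrightarrow> s ''m'' [] = real m \<and> s ''kk'' [] = real q \<and>
    (\<exists>L. stores m s L \<and> structured m L (slot_line s) \<and> P = stored m L)"

abbreviation ins_vars :: "vname set" where
  "ins_vars \<equiv> move_vars \<union> {''i'', ''f'', ''fs'', ''D'', ''A'', ''B'', ''C''}"

lemma loose_le:
  assumes "structured m L l" "coverable m (stored m L)" "distinct (L 0)"
  shows "length (L 0) \<le> m * m"
proof -
  have "card (set (L 0)) \<le> m * m"
    using assms(1,2) by (intro card_le_if_light[of m "stored m L"]) (auto simp: structured_def)
  then show ?thesis using assms(3) by (simp add: distinct_card)
qed

lemma stored_append: "k \<le> m \<Longrightarrow> stored m (L(k := L k @ [p])) = insert p (stored m L)"
  by (auto split: if_splits)

text \<open>Every loop ranges over the \<open>m\<close> slots or over at most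
  \<open>m * m + 1\<close> loose points, the new one included, so a single factor serves all parts
  of the program.\<close>

lemma runs_ins:
  assumes valid: "valid m q s P" and p: "s ''x'' [] = fst p" "s ''y'' [] = snd p" "p \<notin> P"
    and cov: "coverable m (insert p P)" and m1: "1 \<le> m" and F: "4 * m ^ 2 \<le> F"
    and Q: "\<And>s'. valid m q s' (insert p P) \<Longrightarrow> frame ins_vars s s' \<Longrightarrow> Q s'"
  shows "runs ins_com s F Q"
proof -
  let ?new = "If (Less (Const 0) (Var ''f'')) (free_com ;; new_line_com ;; move_com) Skip"
  let ?loose = "Equal (Var ''slot'') (Const 0)"
  obtain L where m: "s ''m'' [] = real m" and q: "s ''kk'' [] = real q" and st: "stores m s L"
    and str: "structured m L (slot_line s)" and P: "P = stored m L"
    using valid unfolding valid_def by blast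
  note dist = stores_distinct[OF st]
  have "coverable m (stored m L)" using cov P coverable_mono by (metis order_refl subset_insertI)
  then have len: "length (L 0) \<le> m * m" using loose_le[OF str] dist by simp
  have mm: "m \<le> m * m" "1 \<le> m * m" using m1 by auto
  \<comment> \<open>The \<open>+ 2\<close> accounts for the new point, appended before the loose
    slot is traversed again, and for the final loop test.\<close>
  have F1: "1 \<le> F" and Fm: "m + 1 \<le> F" and Fl: "length (L 0) + 2 \<le> F"
    using F len mm unfolding power2_eq_square by linarith+
  have p0: "p \<notin> set (L 0)" using p(3) P by auto
  define rest where "rest = append_com ;;
    ?new"
  \<comment> \<open>The case in which no line becomes heavy: \<open>p\<close> stays in slot
    \<open>k\<close>, which is either the slot of its heavy line or that of the loose
    points.\<close>
  have known: "runs rest t F Q"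
    if same: "frame ins_vars s t" and st': "stores m t L" and sl: "slot_line t = slot_line s"
      and v: "t ''px'' [] = fst p" "t ''py'' [] = snd p" "t ''f'' [] = 0" "t ''slot'' [] = real k"
      and k: "k \<le> m" and str': "structured m (L(k := L k @ [p])) (slot_line s)" for t k
    unfolding rest_def
  proof (rule runs_Seq, rule runs_append[OF st' k v(4,1,2) _ F1])
    show "p \<notin> stored m L" using p(3) P by simp
    fix s' assume s': "stores m s' (L(k := L k @ [p]))"
      and same': "frame append_vars t s'"
    have same2: "frame ins_vars s s'" by (rule frame_trans[OF same same']) auto
    have sl': "slot_line s' = slot_line s"
      unfolding sl[symmetric] by (rule slot_line_cong) (simp_all add: frameD[OF same'])
    have "valid m q s' (insert p P)"
      unfolding valid_def using s' str' m q frameD[OF same2] stored_append[OF k, of L p]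
      unfolding sl' P by (intro conjI exI[of _ "L(k := L k @ [p])"]) simp_all
    then have "Q s'" using Q same2 by blast
    moreover have "\<not> holds s' (Less (Const 0) (Var ''f''))" using v frameD[OF same'] by simp
    ultimately show "runs ?new s' F Q"
      by (intro runs_If runs_Skip F1) simp_all
  qed
  \<comment> \<open>The case in which \<open>thru p (L 0 ! j)\<close> becomes heavy: a free slot
    takes over its points.\<close>
  have new: "runs rest t F Q"
    if same: "frame ins_vars s t" and st': "stores m t L" and sl: "slot_line t = slot_line s"
      and v: "t ''px'' [] = fst p" "t ''py'' [] = snd p" "t ''f'' [] = real (Suc j)" "t ''slot'' [] = real 0"
        "t ''x'' [] = fst p" "t ''y'' [] = snd p"
      and j: "j < length (L 0)" and heavy: "m \<le> card (set (L 0) \<inter> thru p (L 0 ! j))"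
      and off: "\<forall>i\<in>{1..m}. L i \<noteq> [] \<longrightarrow> p \<notin> slot_line s i" for t j
    unfolding rest_def
  proof (rule runs_Seq, rule runs_append[OF st' _ v(4,1,2) _ F1])
    show "p \<notin> stored m L" using p(3) P by simp
    define r where "r = L 0 ! j"
    define L1 where "L1 = L(0 := L 0 @ [p])"
    have r: "r \<in> set (L 0)" using j by (simp add: r_def)
    fix s1 assume "stores m s1 (L(0 := L 0 @ [p]))"
      and same1: "frame append_vars t s1"
    then have st1: "stores m s1 L1" by (simp add: L1_def)
    have free: "\<exists>k\<in>{1..m}. L1 k = []"
    proof -
      have "\<exists>k\<in>{1..m}. L k = []"
        by (rule free_slot[OF str dist _ _ _ r]) (use cov P off p(3) heavy in \<open>auto simp: r_def\<close>)
      then show ?thesis by (auto simp: L1_def)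
    qed
    have m1': "s1 ''m'' [] = real m" using frameD[OF same] frameD[OF same1] m by simp
    have "runs (free_com ;; new_line_com ;; move_com) s1 F Q"
    proof (rule runs_Seq, rule runs_free[OF st1 m1' Fm free])
      fix s2 k assume k: "k \<in> {1..m}" and "L1 k = []" and fs: "s2 ''fs'' [] = real k"
        and same2: "frame {''fs'', ''i''} s1 s2"
      then have k0: "k \<noteq> 0" and L1k: "L1 k = []" by auto
      have st2: "stores m s2 L1"
        by (rule stores_cong[OF st1]) (simp_all add: frameD[OF same2])
      have sl2: "slot_line s2 = slot_line s"
        unfolding sl[symmetric]
        by (rule slot_line_cong) (simp_all add: frameD[OF same2] frameD[OF same1])
      have v2: "s2 ''x'' [] = fst p" "s2 ''y'' [] = snd p" "s2 ''f'' [] = real (Suc j)"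
        using v frameD[OF same2] frameD[OF same1] by simp_all
      have j2: "j < length (L1 0)" "L1 0 ! j = r" using j by (simp_all add: L1_def r_def nth_append)
      show "runs (new_line_com ;; move_com) s2 F Q"
      proof (rule runs_Seq, rule runs_new_line[OF st2 F1 v2(1,2) fs v2(3) j2(1)])
        fix s3 assume "slot_line s3 k = thru p (L1 0 ! j)"
          and sl3': "\<And>i. i \<noteq> k \<Longrightarrow> slot_line s3 i = slot_line s2 i"
          and same3: "frame {''A'', ''B'', ''C'', ''qx'', ''qy''} s2 s3"
        then have sl3: "slot_line s3 k = thru p r" using j2 by simp
        have st3: "stores m s3 L1"
          by (rule stores_cong[OF st2]) (simp_all add: frameD[OF same3])
        have fs3: "s3 ''fs'' [] = real k" using fs frameD[OF same3] by simp
        have F3: "length (L1 0) + 1 \<le> F" using Fl by (simp add: L1_def)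
        have setL1: "set (L1 0) = insert p (set (L 0))" by (simp add: L1_def)
        show "runs move_com s3 F Q"
        proof (rule runs_move[OF st3 F3 fs3 k L1k])
          fix s4 L4 assume same4: "frame move_vars s3 s4" and st4: "stores m s4 L4"
            and set0: "set (L4 0) = set (L1 0) - slot_line s3 k"
            and setk: "set (L4 k) = set (L1 0) \<inter> slot_line s3 k"
            and other: "\<And>i. i \<noteq> 0 \<Longrightarrow> i \<noteq> k \<Longrightarrow> L4 i = L1 i"
          have sl4: "slot_line s4 = slot_line s3"
            by (rule slot_line_cong) (simp_all add: frameD[OF same4])
          have km: "k \<le> m" using k by simp
          have str4: "structured m L4 (slot_line s4)"
          proof (rule structured_new_line[OF str _ p0 r _ k])
            show "p \<notin> slot_line s i" if "i \<in> {1..m}" "L i \<noteq> []" for i using off that by blast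
            show "m \<le> card (set (L 0) \<inter> thru p r)" using heavy by (simp add: r_def)
            show "set (L4 0) = insert p (set (L 0)) - thru p r"
              using set0 unfolding setL1 sl3 .
            show "set (L4 k) = insert p (set (L 0)) \<inter> thru p r"
              using setk unfolding setL1 sl3 .
            show "distinct (L4 k)" using stores_distinct[OF st4 km] .
            show "L4 i = L i" if "i \<in> {1..m}" "i \<noteq> k" for i using other[of i] that by (simp add: L1_def)
            show "slot_line s4 k = thru p r" unfolding sl4 by (rule sl3)
            show "slot_line s4 i = slot_line s i" if "i \<noteq> k" for i
              using sl3'[OF that] unfolding sl4 sl2 .
          qed
          have stored4: "stored m L4 = insert p P"
          proof -
            have "stored m L4 = (\<Union>i\<in>{..m}-{0,k}. set (L4 i)) \<union> (set (L4 0) \<union> set (L4 k))"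
              using km by auto
            also have "(\<Union>i\<in>{..m}-{0,k}. set (L4 i)) = (\<Union>i\<in>{..m}-{0,k}. set (L1 i))"
              using other by simp
            also have "set (L4 0) \<union> set (L4 k) = set (L1 0) \<union> set (L1 k)"
              unfolding set0 setk L1k by auto
            also have "(\<Union>i\<in>{..m}-{0,k}. set (L1 i)) \<union> (set (L1 0) \<union> set (L1 k)) = stored m L1"
              using km by auto
            finally show ?thesis using stored_append[of 0 m L p] P by (simp add: L1_def)
          qed
          have "frame ins_vars s s1" by (rule frame_trans[OF same same1]) auto
          then have "frame ins_vars s s2" by (rule frame_trans[OF _ same2]) auto
          then have "frame ins_vars s s3" by (rule frame_trans[OF _ same3]) auto
          then have same': "frame ins_vars s s4" by (rule frame_trans[OF _ same4]) auto
          have "valid m q s4 (insert p P)"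
            unfolding valid_def stored4[symmetric] using st4 str4 m q frameD[OF same']
            by (intro conjI exI[of _ L4]) simp_all
          then show "Q s4" using Q same' by blast
        qed
      qed
    qed
    moreover have "holds s1 (Less (Const 0) (Var ''f''))" using v frameD[OF same1] by simp
    ultimately show "runs ?new s1 F Q"
      by (intro runs_If F1) simp_all
  qed simp
  let ?tail = "''f'' ::= Const 0 ;; If ?loose count_com Skip ;; rest"
  have "runs (''px'' ::= Var ''x'' ;; ''py'' ::= Var ''y'' ;; find_com ;; ?tail) s F Q"
  proof -
    define s1 where "s1 = set_cell ''py'' [] (snd p) (set_cell ''px'' [] (fst p) s)"
    have same1: "frame ins_vars s s1"
      unfolding s1_def by (intro frame_set_cell) simp_all
    have st1: "stores m s1 L" by (rule stores_cong[OF st]) (simp_all add: s1_def)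
    have sl1: "slot_line s1 = slot_line s" by (rule slot_line_cong) (simp_all add: s1_def)
    have v1: "s1 ''m'' [] = real m" "s1 ''x'' [] = fst p" "s1 ''y'' [] = snd p"
      using m p by (simp_all add: s1_def)
    have "runs (find_com ;; ?tail) s1 F Q"
    proof (rule runs_Seq, rule runs_find[OF st1 v1(1) Fm v1(2,3)])
      fix s2 k assume k: "k \<le> m" and slot: "s2 ''slot'' [] = real k"
        and found: "if k = 0 then \<forall>i\<in>{1..m}. L i \<noteq> [] \<longrightarrow> p \<notin> slot_line s1 i
           else L k \<noteq> [] \<and> p \<in> slot_line s1 k"
        and same2: "frame {''slot'', ''i''} s1 s2"
      define s3 where "s3 = set_cell ''f'' [] 0 s2"
      have same12: "frame ins_vars s s2" by (rule frame_trans[OF same1 same2]) auto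
      then have same3: "frame ins_vars s s3"
        unfolding s3_def by (rule frame_set_cell) simp
      have st3: "stores m s3 L"
        by (rule stores_cong[OF st1]) (simp_all add: s3_def frameD[OF same2])
      have sl3: "slot_line s3 = slot_line s"
        unfolding sl1[symmetric] by (rule slot_line_cong) (simp_all add: s3_def frameD[OF same2])
      have v3: "s3 ''m'' [] = real m" "s3 ''x'' [] = fst p" "s3 ''y'' [] = snd p"
          "s3 ''px'' [] = fst p" "s3 ''py'' [] = snd p" "s3 ''f'' [] = 0" "s3 ''slot'' [] = real k"
        using m p slot by (simp_all add: s3_def frameD[OF same2] s1_def)
      have "runs (If ?loose count_com Skip ;; rest) s3 F Q"
      proof (rule runs_Seq, rule runs_If)
        assume "holds s3 ?loose"
        then have k0: "k = 0" using v3 by simp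
        then have off: "\<forall>i\<in>{1..m}. L i \<noteq> [] \<longrightarrow> p \<notin> slot_line s i" using found sl1 by simp
        have F3: "length (L 0) + 1 \<le> F" using Fl by simp
        show "runs count_com s3 F (\<lambda>s'. runs rest s' F Q)"
        proof (rule runs_count[OF st3 v3(1) F3 v3(2,3) p0 v3(6)])
          fix s4 assume same4: "frame {''j'', ''f'', ''D''} s3 s4" and f4: "s4 ''f'' [] = 0"
            and light: "\<And>r. r \<in> set (L 0) \<Longrightarrow> card (set (L 0) \<inter> thru p r) < m"
          have same': "frame ins_vars s s4" by (rule frame_trans[OF same3 same4]) auto
          show "runs rest s4 F Q"
          proof (rule known[OF same' _ _ _ _ f4])
            show "stores m s4 L" by (rule stores_cong[OF st3]) (simp_all add: frameD[OF same4])
            show "slot_line s4 = slot_line s"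
              unfolding sl3[symmetric] by (rule slot_line_cong) (simp_all add: frameD[OF same4])
            show "structured m (L(0 := L 0 @ [p])) (slot_line s)"
              by (rule structured_grow_loose[OF str m1 _ p0 light]) (use off in auto)
          qed (use v3 k0 frameD[OF same4] in simp_all)
        next
          fix s4 j assume same4: "frame {''j'', ''f'', ''D''} s3 s4"
            and f4: "s4 ''f'' [] = real (Suc j)"
            and j: "j < length (L 0)" "m \<le> card (set (L 0) \<inter> thru p (L 0 ! j))"
          have same': "frame ins_vars s s4" by (rule frame_trans[OF same3 same4]) auto
          show "runs rest s4 F Q"
          proof (rule new[OF same' _ _ _ _ f4 _ _ _ j off])
            show "stores m s4 L" by (rule stores_cong[OF st3]) (simp_all add: frameD[OF same4])
            show "slot_line s4 = slot_line s"
              unfolding sl3[symmetric] by (rule slot_line_cong) (simp_all add: frameD[OF same4])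
          qed (use v3 k0 frameD[OF same4] in simp_all)
        qed
      next
        assume "\<not> holds s3 ?loose"
        then have k0: "k \<noteq> 0" using v3 by simp
        have "structured m (L(k := L k @ [p])) (slot_line s)"
          by (rule structured_grow_heavy[OF str]) (use k k0 found sl1 in auto)
        then show "runs Skip s3 F (\<lambda>s'. runs rest s' F Q)"
          using known[OF same3 st3 sl3 v3(4-7) k] F1 by (intro runs_Skip)
      qed (rule F1)
      then show "runs ?tail s2 F Q" by (intro runs_Put_Seq F1) (simp add: s3_def)
    qed
    then show ?thesis using p F1 by (intro runs_Put_Seq) (simp_all add: s1_def)
  qed
  then show ?thesis unfolding ins_com_def rest_def .
qed

definition insert_prog :: com where
  "insert_prog = If (Equal (Get ''W'' [Var ''x'', Var ''y'']) (Const 0)) ins_com Skip"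

lemma valid_W: "valid m q s P \<Longrightarrow> s ''W'' [fst p, snd p] \<noteq> 0 \<longleftrightarrow> p \<in> P"
  unfolding valid_def using stores_W by blast

lemma runs_insert:
  assumes valid: "valid m q s P" and p: "s ''x'' [] = fst p" "s ''y'' [] = snd p"
    and cov: "coverable m (insert p P)" and m1: "1 \<le> m"
  shows "runs insert_prog s (4 * m ^ 2) (\<lambda>s'. valid m q s' (insert p P))"
  unfolding insert_prog_def
proof (rule runs_If)
  assume "holds s (Equal (Get ''W'' [Var ''x'', Var ''y'']) (Const 0))"
  then have "p \<notin> P" using valid_W[OF valid, of p] p by simp
  then show "runs ins_com s (4 * m ^ 2) (\<lambda>s'. valid m q s' (insert p P))"
    by (rule runs_ins[OF valid p _ cov m1 order_refl])
next
  assume "\<not> holds s (Equal (Get ''W'' [Var ''x'', Var ''y'']) (Const 0))"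
  then have "insert p P = P" using valid_W[OF valid, of p] p by auto
  then show "runs Skip s (4 * m ^ 2) (\<lambda>s'. valid m q s' (insert p P))"
    using valid m1 by (intro runs_Skip) simp_all
qed (use m1 in simp)

section \<open>Deletion\<close>

abbreviation unload_step :: com where
  "unload_step \<equiv> ''px'' ::= Get ''X'' [Var ''di'', Sub (Get ''n'' [Var ''di'']) (Const 1)] ;;
       ''py'' ::= Get ''Y'' [Var ''di'', Sub (Get ''n'' [Var ''di'']) (Const 1)] ;;
       Put ''TX'' [Var ''tn''] (Var ''px'') ;;
       Put ''TY'' [Var ''tn''] (Var ''py'') ;;
       Inc ''tn'' ;;
       remove_com"

definition unload_com :: com where
  "unload_com =
    ''tn'' ::= Const 0 ;;
    While (Less (Const 0) (Get ''n'' [Var ''di'']))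
      unload_step"

abbreviation reload_step :: com where
  "reload_step \<equiv> ''tn'' ::= Sub (Var ''tn'') (Const 1) ;;
       ''x'' ::= Get ''TX'' [Var ''tn''] ;;
       ''y'' ::= Get ''TY'' [Var ''tn''] ;;
       ins_com"

definition reload_com :: com where
  "reload_com =
    While (Less (Const 0) (Var ''tn''))
      reload_step"

text \<open>\<open>di\<close> keeps the slot, because the removal erases its record in
  \<open>W\<close>. A class reduced to \<open>m\<close> points no longer forces its line into a
  cover. It is emptied completely into a temporary list before the first reinsertion, so that every
  insertion starts from a valid structure. The loose slot has no lower bound and needs no
  repair.\<close>

definition delete_prog :: com where
  "delete_prog =
    ''px'' ::= Var ''x'' ;; ''py'' ::= Var ''y'' ;;
    If (Equal (Get ''W'' [Var ''px'', Var ''py'']) (Const 0)) Skip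
      (''di'' ::= Sub (Get ''W'' [Var ''px'', Var ''py'']) (Const 1) ;;
       remove_com ;;
       If (And (Less (Const 0) (Var ''di'')) (LessEq (Get ''n'' [Var ''di'']) (Var ''m'')))
         (unload_com ;; reload_com) Skip)"

abbreviation unload_vars :: "vname set" where
  "unload_vars \<equiv> remove_vars \<union> {''px'', ''py'', ''tn'', ''TX'', ''TY''}"

lemma remove_at_last: "length xs = Suc t \<Longrightarrow> remove_at t xs = butlast xs"
  by (metis diff_Suc_1 last_conv_nth length_0_conv list_update_id nat.distinct(1) remove_at_def)

lemma runs_unload:
  assumes st: "stores m s L" and F: "length (L k) + 1 \<le> F"
    and di: "s ''di'' [] = real k" "k \<le> m"
    and Q: "\<And>s'. frame unload_vars s s' \<Longrightarrow> stores m s' (L(k := [])) \<Longrightarrow>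
      s' ''tn'' [] = real (length (L k)) \<Longrightarrow>
      (\<And>t. t < length (L k) \<Longrightarrow> (s' ''TX'' [real t], s' ''TY'' [real t]) = rev (L k) ! t) \<Longrightarrow> Q s'"
  shows "runs unload_com s F Q"
proof -
  define N where "N = length (L k)"
  have F1: "1 \<le> F" using F by simp
  define I where "I c s' \<longleftrightarrow> frame unload_vars s s' \<and> stores m s' (L(k := take (N - c) (L k))) \<and>
    s' ''tn'' [] = real c \<and> (\<forall>t<c. (s' ''TX'' [real t], s' ''TY'' [real t]) = rev (L k) ! t)" for c s'
  have body: "holds s' (Less (Const 0) (Get ''n'' [Var ''di''])) \<and> runs unload_step s' 1 (I (Suc c))"
    if c: "c < N" and I: "I c s'" for c s'
  proof
    have same: "frame unload_vars s s'" and st': "stores m s' (L(k := take (N - c) (L k)))"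
      and tn: "s' ''tn'' [] = real c" and T: "\<forall>t<c. (s' ''TX'' [real t], s' ''TY'' [real t]) = rev (L k) ! t"
      using I by (auto simp: I_def)
    define t where "t = N - Suc c"
    have t: "N - c = Suc t" using c by (simp add: t_def)
    have tN: "t < N" using c by (simp add: t_def)
    let ?L = "L(k := take (N - c) (L k))"
    define q where "q = ?L k ! t"
    have lenk: "length (?L k) = Suc t" using t by (simp add: N_def)
    have n: "s' ''n'' [real k] = real t + 1" using storesD(1)[OF st' di(2)] lenk by simp
    have di': "s' ''di'' [] = real k" using frameD[OF same] di by simp
    show "holds s' (Less (Const 0) (Get ''n'' [Var ''di'']))" using n di' by simp
    have XY: "s' ''X'' [real k, real t] = fst q" "s' ''Y'' [real k, real t] = snd q"
      using storesD(2,3)[OF st' di(2), of t] tN t by (simp_all add: q_def N_def)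
    have qrev: "q = rev (L k) ! c"
      using c t tN by (simp add: q_def t_def N_def rev_nth)
    define s1 where "s1 = set_cell ''tn'' [] (real c + 1) (set_cell ''TY'' [real c] (snd q)
      (set_cell ''TX'' [real c] (fst q) (set_cell ''py'' [] (snd q) (set_cell ''px'' [] (fst q) s'))))"
    have same1: "frame unload_vars s s1"
      unfolding s1_def by (intro frame_set_cell same) simp_all
    have st1: "stores m s1 ?L" by (rule stores_cong[OF st']) (simp_all add: s1_def)
    have "runs remove_com s1 1 (I (Suc c))"
    proof (rule runs_remove[OF st1 di(2) _ q_def])
      fix s2 assume st2: "stores m s2 (?L(k := remove_at t (?L k)))" and
        same2: "frame remove_vars s1 s2"
      have "?L(k := remove_at t (?L k)) = L(k := take (N - Suc c) (L k))"
        using remove_at_last[OF lenk] t by (simp add: butlast_take N_def t_def)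
      then have "stores m s2 (L(k := take (N - Suc c) (L k)))" using st2 by simp
      moreover have "frame unload_vars s s2" by (rule frame_trans[OF same1 same2]) auto
      moreover have "s2 ''tn'' [] = real (Suc c)" using frameD[OF same2] by (simp add: s1_def)
      moreover have "\<forall>t<Suc c. (s2 ''TX'' [real t], s2 ''TY'' [real t]) = rev (L k) ! t"
        using frameD[OF same2] T qrev by (auto simp: s1_def less_Suc_eq)
      ultimately show "I (Suc c) s2" unfolding I_def by blast
    qed (use lenk in \<open>simp_all add: s1_def\<close>)
    then show "runs unload_step s' 1 (I (Suc c))"
      using n di' tn XY by (intro runs_Put_Seq) (simp_all add: s1_def)
  qed
  show ?thesis
    unfolding unload_com_def
  proof (rule runs_Put_Seq[OF _ F1], rule runs_for[where N = N and F = 1 and I = I, OF _ body])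
    define s1 where "s1 = set_cell ''tn'' [] 0 s"
    have "stores m s1 L" using st by (rule stores_cong) (simp_all add: s1_def)
    moreover have "frame unload_vars s s1"
      unfolding s1_def by (intro frame_set_cell) simp_all
    ultimately have "I 0 s1" unfolding I_def by (simp add: N_def s1_def)
    then show "I 0 (set_cell ''tn'' (map (eval s) []) (eval s (Const 0)) s)"
      by (simp add: s1_def)
    fix s' assume I: "I N s'"
    then have same: "frame unload_vars s s'" and st': "stores m s' (L(k := []))"
      by (auto simp: I_def)
    have "Q s'" using I by (intro Q[OF same st']) (auto simp: I_def N_def)
    moreover have "s' ''n'' [real k] = 0" using storesD(1)[OF st' di(2)] by simp
    ultimately show "\<not> holds s' (Less (Const 0) (Get ''n'' [Var ''di''])) \<and> Q s'"
      using frameD[OF same] di by simp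
  qed (use F in \<open>auto simp: N_def\<close>)
qed

text \<open>All intermediate point sets are subsets of the final one, so coverability of the latter
  justifies every single insertion.\<close>

lemma runs_reload:
  assumes valid: "valid m q s P" and tn: "s ''tn'' [] = real (length T)"
    and T: "\<And>t. t < length T \<Longrightarrow> (s ''TX'' [real t], s ''TY'' [real t]) = T ! t"
    and dist: "distinct T" "set T \<inter> P = {}" and cov: "coverable m (P \<union> set T)" and m1: "1 \<le> m"
    and F: "length T * (4 * m ^ 2) + 1 \<le> F"
    and Q: "\<And>s'. valid m q s' (P \<union> set T) \<Longrightarrow> Q s'"
  shows "runs reload_com s F Q"
proof -
  define N where "N = length T"
  let ?V = "ins_vars \<union> {''tn'', ''x'', ''y''}"
  define I where "I c s' \<longleftrightarrow> frame ?V s s' \<and> s' ''tn'' [] = real (N - c) \<and>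
    valid m q s' (P \<union> set (drop (N - c) T))" for c s'
  have G1: "1 \<le> 4 * m ^ 2" using m1 by simp
  have body: "holds s' (Less (Const 0) (Var ''tn'')) \<and> runs reload_step s' (4 * m ^ 2) (I (Suc c))"
    if c: "c < N" and I: "I c s'" for c s'
  proof
    have same: "frame ?V s s'" and tn': "s' ''tn'' [] = real (N - c)"
      and valid': "valid m q s' (P \<union> set (drop (N - c) T))"
      using I by (auto simp: I_def)
    define t where "t = N - Suc c"
    have t: "N - c = Suc t" using c by (simp add: t_def)
    have tN: "t < length T" using c by (simp add: t_def N_def)
    have tn'': "s' ''tn'' [] = real t + 1" using tn' t by simp
    show "holds s' (Less (Const 0) (Var ''tn''))" using tn'' by simp
    have XY: "s' ''TX'' [real t] = fst (T ! t)" "s' ''TY'' [real t] = snd (T ! t)"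
      using T[OF tN] frameD[OF same, of "''TX''"] frameD[OF same, of "''TY''"]
      by (simp_all add: prod_eq_iff)
    define s1 where "s1 = set_cell ''y'' [] (snd (T ! t)) (set_cell ''x'' [] (fst (T ! t)) (set_cell ''tn'' [] (real t) s'))"
    have same1: "frame ?V s s1"
      unfolding s1_def by (intro frame_set_cell same) simp_all
    obtain L where L: "stores m s' L" "structured m L (slot_line s')" "P \<union> set (drop (N - c) T) = stored m L"
      using valid' unfolding valid_def by blast
    have st1: "stores m s1 L" by (rule stores_cong[OF L(1)]) (simp_all add: s1_def)
    have sl1: "slot_line s1 = slot_line s'" by (rule slot_line_cong) (simp_all add: s1_def)
    have valid1: "valid m q s1 (P \<union> set (drop (N - c) T))"
      unfolding valid_def sl1 using valid' L st1 by (auto simp: valid_def s1_def)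
    have drop: "drop t T = T ! t # drop (N - c) T"
      using Cons_nth_drop_Suc[OF tN] t by simp
    have ins: "insert (T ! t) (P \<union> set (drop (N - c) T)) = P \<union> set (drop t T)"
      unfolding drop by simp
    have new: "T ! t \<notin> P \<union> set (drop (N - c) T)"
    proof -
      have "distinct (drop t T)" using dist(1) by simp
      then have "T ! t \<notin> set (drop (N - c) T)" unfolding drop by simp
      then show ?thesis using dist(2) tN by (auto dest: nth_mem)
    qed
    have cov1: "coverable m (P \<union> set (drop t T))"
      using coverable_mono[OF cov] set_drop_subset[of t T] by blast
    have "runs ins_com s1 (4 * m ^ 2) (I (Suc c))"
    proof (rule runs_ins[OF valid1 _ _ new _ m1 order_refl], goal_cases)
      case (4 s2)
      have "frame ?V s s2" by (rule frame_trans[OF same1 4(2)]) auto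
      then show ?case
        using 4 frameD[OF 4(2), of "''tn''"] unfolding I_def ins t_def[symmetric]
        by (simp add: s1_def)
    qed (use cov1 ins in \<open>simp_all add: s1_def\<close>)
    then show "runs reload_step s' (4 * m ^ 2) (I (Suc c))"
      using tn'' XY G1 by (intro runs_Put_Seq) (simp_all add: s1_def)
  qed
  show ?thesis
    unfolding reload_com_def
  proof (rule runs_for[where N = N and F = "4 * m ^ 2" and I = I, OF _ body _ G1])
    show "I 0 s" using tn valid by (simp add: I_def N_def)
    show "\<not> holds s' (Less (Const 0) (Var ''tn'')) \<and> Q s'" if "I N s'" for s'
      using that Q by (simp add: I_def)
  qed (use F in \<open>auto simp: N_def\<close>)
qed

lemma runs_delete:
  assumes valid: "valid m q s P" and p: "s ''x'' [] = fst p" "s ''y'' [] = snd p"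
    and cov: "coverable m P" and m1: "1 \<le> m"
  shows "runs delete_prog s (5 * m ^ 3) (\<lambda>s'. valid m q s' (P - {p}))"
proof -
  let ?small = "And (Less (Const 0) (Var ''di'')) (LessEq (Get ''n'' [Var ''di'']) (Var ''m''))"
  let ?absent = "Equal (Get ''W'' [Var ''px'', Var ''py'']) (Const 0)"
  obtain L where m: "s ''m'' [] = real m" and q: "s ''kk'' [] = real q" and st: "stores m s L"
    and str: "structured m L (slot_line s)" and P: "P = stored m L"
    using valid unfolding valid_def by blast
  define F where "F = 5 * m ^ 3"
  define Q where "Q s' = valid m q s' (P - {p})" for s'
  have m3: "m ^ 3 \<ge> 1" "m ^ 3 \<ge> m" using m1 self_le_power[of m 3] by auto
  have F1: "1 \<le> F" and Fm: "m + 1 \<le> F" using m3 unfolding F_def by linarith+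
  \<comment> \<open>At most \<open>m\<close> reinsertions at \<open>4 * m ^ 2\<close> each make
    \<open>4 * m ^ 3\<close>; the fifth \<open>m ^ 3\<close> pays for the final loop test.\<close>
  have FT: "n * (4 * m ^ 2) + 1 \<le> F" if "n \<le> m" for n
  proof -
    have "n * (4 * m ^ 2) \<le> m * (4 * m ^ 2)" using that by (rule mult_le_mono1)
    also have "\<dots> = 4 * m ^ 3" by (simp add: power2_eq_square power3_eq_cube)
    finally show ?thesis using m3 unfolding F_def by linarith
  qed
  define s1 where "s1 = set_cell ''py'' [] (snd p) (set_cell ''px'' [] (fst p) s)"
  have st1: "stores m s1 L" by (rule stores_cong[OF st]) (simp_all add: s1_def)
  have sl1: "slot_line s1 = slot_line s" by (rule slot_line_cong) (simp_all add: s1_def)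
  have v1: "s1 ''px'' [] = fst p" "s1 ''py'' [] = snd p" "s1 ''m'' [] = real m" "s1 ''kk'' [] = real q"
    using m q by (simp_all add: s1_def)
  have valid1: "valid m q s1 P" unfolding valid_def sl1 using v1 st1 str P by blast
  let ?rest = "If ?small
         (unload_com ;; reload_com) Skip"
  have "runs (If ?absent Skip
      (''di'' ::= Sub (Get ''W'' [Var ''px'', Var ''py'']) (Const 1) ;; remove_com ;; ?rest)) s1 F Q"
  proof (rule runs_If)
    assume "holds s1 ?absent"
    then have "p \<notin> P" using valid_W[OF valid1, of p] v1 by simp
    then show "runs Skip s1 F Q" using valid1 F1 by (intro runs_Skip) (simp_all add: Q_def)
  next
    assume "\<not> holds s1 ?absent"
    then have "p \<in> P" using valid_W[OF valid1, of p] v1 by simp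
    then obtain i j where ij: "i \<le> m" "j < length (L i)" "p = L i ! j"
      using P by (auto simp: in_set_conv_nth)
    define s2 where "s2 = set_cell ''di'' [] (real i) s1"
    have st2: "stores m s2 L" by (rule stores_cong[OF st1]) (simp_all add: s2_def)
    have v2: "s2 ''px'' [] = fst p" "s2 ''py'' [] = snd p" using v1 by (simp_all add: s2_def)
    have "runs (remove_com ;; ?rest) s2 F Q"
    proof (rule runs_Seq, rule runs_remove[OF st2 ij v2 F1])
      define L1 where "L1 = L(i := remove_at j (L i))"
      fix s3 assume "stores m s3 (L(i := remove_at j (L i)))"
        and same3: "frame remove_vars s2 s3"
      then have st3: "stores m s3 L1" by (simp add: L1_def)
      have v3: "s3 ''m'' [] = real m" "s3 ''kk'' [] = real q" "s3 ''di'' [] = real i"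
        using frameD[OF same3] v1 by (simp_all add: s2_def)
      have sl3: "slot_line s3 = slot_line s"
        unfolding sl1[symmetric] by (rule slot_line_cong) (simp_all add: frameD[OF same3] s2_def)
      have set_i: "set (L1 i) = set (L i) - {p}"
        using set_remove_at[OF stores_distinct[OF st ij(1)] ij(2)] ij(3) by (simp add: L1_def)
      have stored1: "stored m L1 = P - {p}"
      proof -
        have "set (L1 k) = set (L k) - {p}" if "k \<le> m" for k
        proof (cases "k = i")
          case False
          have "p \<in> set (L i)" using ij by simp
          then have "p \<notin> set (L k)" using stores_disjoint[OF st that ij(1)] False by blast
          then show ?thesis using False by (simp add: L1_def)
        qed (use set_i in simp)
        then have "stored m L1 = (\<Union>k\<le>m. set (L k) - {p})" by simp
        then show ?thesis using P by blast
      qed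
      have n3: "s3 ''n'' [real i] = real (length (L1 i))" by (rule storesD(1)[OF st3 ij(1)])
      show "runs ?rest s3 F Q"
      proof (rule runs_If)
        assume "holds s3 ?small"
        then have i1: "1 \<le> i" and small: "length (L1 i) \<le> m" using v3 n3 by auto
        have Fu: "length (L1 i) + 1 \<le> F" using small Fm by simp
        show "runs (unload_com ;; reload_com) s3 F Q"
        proof (rule runs_Seq, rule runs_unload[OF st3 Fu v3(3) ij(1)])
          fix s4 assume same4: "frame unload_vars s3 s4" and st4: "stores m s4 (L1(i := []))"
            and tn: "s4 ''tn'' [] = real (length (L1 i))"
            and T: "\<And>t. t < length (L1 i) \<Longrightarrow> (s4 ''TX'' [real t], s4 ''TY'' [real t]) = rev (L1 i) ! t"
          \<comment> \<open>With its class at size \<open>m\<close> or below, \<open>L1\<close> need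
            not be structured, unless the class is empty. Emptying the slot leads to the same
            assignment as emptying it before the removal, where \<open>structured_shrink\<close>
            applies.\<close>
          have L1i: "L1(i := []) = L(i := [])" by (simp add: L1_def)
          have sl4: "slot_line s4 = slot_line s"
            unfolding sl3[symmetric] by (rule slot_line_cong) (simp_all add: frameD[OF same4])
          have "structured m (L(i := [])) (slot_line s)" by (rule structured_shrink[OF str]) simp_all
          then have valid4: "valid m q s4 (stored m (L1(i := [])))"
            unfolding valid_def sl4 L1i using st4 v3 frameD[OF same4] unfolding L1i
            by (intro conjI exI[of _ "L(i := [])"]) simp_all
          have un: "stored m (L1(i := [])) \<union> set (rev (L1 i)) = P - {p}"
            unfolding stored1[symmetric] using ij(1) by (auto split: if_splits)
          have disj: "set (rev (L1 i)) \<inter> stored m (L1(i := [])) = {}"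
            using stores_disjoint[OF st3 _ ij(1)] by (auto split: if_splits)
          have dist: "distinct (rev (L1 i))" using stores_distinct[OF st3 ij(1)] by simp
          have cov4: "coverable m (stored m (L1(i := [])) \<union> set (rev (L1 i)))"
            unfolding un using coverable_mono[OF cov] by blast
          show "runs reload_com s4 F Q"
            by (rule runs_reload[OF valid4 _ _ dist disj cov4 m1])
              (use tn T FT[OF small] un in \<open>simp_all add: Q_def\<close>)
        qed
      next
        assume "\<not> holds s3 ?small"
        then have big: "1 \<le> i \<Longrightarrow> m < length (L1 i)" using v3 n3 by auto
        have "structured m L1 (slot_line s)"
          unfolding L1_def
          by (rule structured_shrink[OF str]) (use big set_i in \<open>auto simp: L1_def\<close>)
        then have "valid m q s3 (P - {p})"
          unfolding valid_def sl3 using v3 st3 stored1 by blast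
        then show "runs Skip s3 F Q" using F1 by (intro runs_Skip) (simp_all add: Q_def)
      qed (rule F1)
    qed
    moreover have "s1 ''W'' [fst p, snd p] = real i + 1"
      using storesD(4)[OF st1 ij(1,2)] ij(3) by simp
    ultimately show "runs (''di'' ::= Sub (Get ''W'' [Var ''px'', Var ''py'']) (Const 1) ;;
        remove_com ;; ?rest) s1 F Q"
      using v1 F1 by (intro runs_Put_Seq) (simp_all add: s2_def)
  qed (rule F1)
  then have "runs delete_prog s F Q"
    unfolding delete_prog_def using p F1 by (intro runs_Put_Seq) (simp_all add: s1_def)
  then show ?thesis unfolding F_def Q_def .
qed

section \<open>Branching on pairs of points\<close>

text \<open>A node of the search tree: coefficients of the lines chosen so far, and the points still
  to be covered.\<close>

type_synonym node = "(real \<times> real \<times> real) list \<times> point list"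

definition tline :: "real \<times> real \<times> real \<Rightarrow> point set" where
  "tline = (\<lambda>(a, b, c). line_of a b c)"

text \<open>Pairs of equal indices occur among the children of a node, so coinciding points have to
  yield a genuine line, which the coefficients of \<open>thru\<close> would not.\<close>

definition join_b :: "point \<Rightarrow> point \<Rightarrow> real" where
  "join_b p q = (if snd p = snd q \<and> fst q = fst p then 1 else fst q - fst p)"

text \<open>For equal points this is a horizontal line.\<close>

definition join :: "point \<Rightarrow> point \<Rightarrow> real \<times> real \<times> real" where
  "join p q = (snd p - snd q, join_b p q, (snd p - snd q) * fst p + join_b p q * snd p)"

definition kid :: "node \<Rightarrow> nat \<Rightarrow> nat \<Rightarrow> node" where
  "kid nd i j = (let l = join (snd nd ! i) (snd nd ! j)
     in (fst nd @ [l], filter (\<lambda>r. r \<notin> tline l) (snd nd)))"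

lemma is_line_join: "is_line (tline (join p q))"
  unfolding tline_def join_def by (simp add: join_b_def) (intro conjI impI is_line_line_of, auto)

lemma join_contains: "p \<in> tline (join p q)" "q \<in> tline (join p q)"
  by (auto simp: tline_def join_def join_b_def line_of_def case_prod_beta algebra_simps)

text \<open>The soundness half of the search: once no points remain, the chosen lines cover
  \<open>P\<close>. The length bounds limit the cost of copying a node.\<close>

definition partial_cover :: "nat \<Rightarrow> point set \<Rightarrow> node \<Rightarrow> bool" where
  "partial_cover m P nd \<longleftrightarrow> length (fst nd) \<le> m \<and> length (snd nd) \<le> m * m \<and> distinct (snd nd) \<and>
    (\<forall>l\<in>set (fst nd). is_line (tline l)) \<and> P \<subseteq> \<Union>(tline ` set (fst nd)) \<union> set (snd nd)"

text \<open>The completeness half of the search. The first conjunct is essential because the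
  subtraction is truncated: a node with too many lines and no remaining points would otherwise count
  as extendable.\<close>

definition extendable :: "nat \<Rightarrow> node \<Rightarrow> bool" where
  "extendable q nd \<longleftrightarrow> length (fst nd) \<le> q \<and> coverable (q - length (fst nd)) (set (snd nd))"

lemma partial_cover_kid:
  assumes "partial_cover m P nd" "length (fst nd) < m"
  shows "partial_cover m P (kid nd i j)"
proof -
  have "length (filter (\<lambda>r. r \<notin> l) (snd nd)) \<le> length (snd nd)" for l by (rule length_filter_le)
  then have "length (filter (\<lambda>r. r \<notin> l) (snd nd)) \<le> m * m" for l
    using assms(1) unfolding partial_cover_def by (meson le_trans)
  then show ?thesis
    using assms is_line_join unfolding partial_cover_def kid_def Let_def by auto
qed

text \<open>
  Among \<open>m + 1\<close> points covered by fewer lines, two lie on the same line; fewer points may be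
  covered one by one.
\<close>

lemma extendable_kid:
  assumes nd: "partial_cover m P nd" and ext: "extendable q nd" and q: "q \<le> m"
    and us: "snd nd \<noteq> []"
  defines "K \<equiv> min (length (snd nd)) (m + 1)"
  shows "length (fst nd) < q" "\<exists>i<K. \<exists>j<K. extendable q (kid nd i j)"
proof -
  let ?us = "snd nd"
  define r where "r = q - length (fst nd)"
  obtain Ls where Ls: "finite Ls" "card Ls \<le> r" "\<And>l. l \<in> Ls \<Longrightarrow> is_line l" "set ?us \<subseteq> \<Union>Ls"
    using ext unfolding extendable_def coverable_def line_cover_def r_def by blast
  have dist: "distinct ?us" using nd by (simp add: partial_cover_def)
  have "Ls \<noteq> {}" using Ls(4) us by auto
  then have "1 \<le> card Ls" using Ls(1) by (simp add: Suc_le_eq card_gt_0_iff)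
  then have r1: "1 \<le> r" using Ls(2) by linarith
  then show less: "length (fst nd) < q" by (simp add: r_def)
  have K: "0 < K" "K \<le> length ?us" using us by (auto simp: K_def)
  \<comment> \<open>It suffices that the join takes over what one line \<open>l\<close> of the cover
    contributes to the remaining points; the join itself may lie outside the cover.\<close>
  have fin: "extendable q (kid nd i j)"
    if "l \<in> Ls" and rest: "set ?us - tline (join (?us ! i) (?us ! j)) \<subseteq> \<Union>(Ls - {l})" for i j l
  proof -
    have "card (Ls - {l}) \<le> q - Suc (length (fst nd))" using that(1) Ls(1,2) by (simp add: r_def)
    then have "line_cover (q - Suc (length (fst nd))) (set (snd (kid nd i j))) (Ls - {l})"
      using Ls(1,3) rest unfolding line_cover_def kid_def Let_def by auto
    then show ?thesis using less unfolding extendable_def coverable_def by (auto simp: kid_def Let_def)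
  qed
  define f where "f i = (SOME l. l \<in> Ls \<and> ?us ! i \<in> l)" for i
  have f: "f i \<in> Ls \<and> ?us ! i \<in> f i" if "i < K" for i
  proof -
    have "?us ! i \<in> \<Union>Ls" using Ls(4) K that by (meson nth_mem order_less_le_trans subsetD)
    then have "\<exists>l. l \<in> Ls \<and> ?us ! i \<in> l" by blast
    then show ?thesis unfolding f_def by (rule someI_ex)
  qed
  show "\<exists>i<K. \<exists>j<K. extendable q (kid nd i j)"
  proof (cases "\<exists>i<K. \<exists>j<K. \<exists>l\<in>Ls. i \<noteq> j \<and> ?us ! i \<in> l \<and> ?us ! j \<in> l")
    case True
    then obtain i j l where *: "i < K" "j < K" "l \<in> Ls" "i \<noteq> j" "?us ! i \<in> l" "?us ! j \<in> l" by blast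
    have "?us ! i \<noteq> ?us ! j" using * dist K by (simp add: nth_eq_iff_index_eq)
    then have "tline (join (?us ! i) (?us ! j)) = l"
      using lines_eqI[OF is_line_join Ls(3)[OF *(3)] join_contains *(5,6)] by blast
    then have "extendable q (kid nd i j)" using Ls(4) by (intro fin[OF *(3)]) auto
    then show ?thesis using * by blast
  next
    case False
    then have apart: "i = j" if "i < K" "j < K" "l \<in> Ls" "?us ! i \<in> l" "?us ! j \<in> l" for i j l
      using that by blast
    have "inj_on f {..<K}" by (rule inj_onI) (use apart f in \<open>metis lessThan_iff\<close>)
    then have "card {..<K} \<le> card Ls" using f by (intro card_inj_on_le[OF _ _ Ls(1)]) auto
    \<comment> \<open>\<open>f\<close> sends the first \<open>K\<close> points to different lines of
      a cover by at most \<open>q \<le> m\<close> lines. So the cap \<open>m + 1\<close> is not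
      attained, and \<open>K\<close> counts all remaining points.\<close>
    then have "K \<le> m" using Ls(2) q by (simp add: r_def)
    then have Kl: "K = length ?us" unfolding K_def by simp
    \<comment> \<open>Now \<open>f 0\<close> may be exchanged for the horizontal line through the
      first point: every other remaining point lies on some line of the cover different from
      \<open>f 0\<close>.\<close>
    have "set ?us - tline (join (?us ! 0) (?us ! 0)) \<subseteq> \<Union>(Ls - {f 0})"
    proof
      fix x assume x: "x \<in> set ?us - tline (join (?us ! 0) (?us ! 0))"
      then obtain j where j: "j < K" "x = ?us ! j" using Kl by (metis DiffD1 in_set_conv_nth)
      have "j \<noteq> 0"
      proof
        assume "j = 0"
        then show False using x j join_contains(1)[of "?us ! 0" "?us ! 0"] by simp
      qed
      then have "f j \<noteq> f 0" using apart[of j 0 "f 0"] f[OF j(1)] f[OF K(1)] j(1) K(1) by auto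
      then show "x \<in> \<Union>(Ls - {f 0})" using f[OF j(1)] j(2) by blast
    qed
    then have "extendable q (kid nd 0 0)" using f[OF K(1)] by (intro fin) auto
    then show ?thesis using K(1) by blast
  qed
qed

section \<open>Queries\<close>

abbreviation line_cells :: "state \<Rightarrow> real \<Rightarrow> real \<Rightarrow> real \<times> real \<times> real" where
  "line_cells s r t \<equiv> (s ''LA'' [r, t], s ''LB'' [r, t], s ''LC'' [r, t])"

abbreviation point_cells :: "state \<Rightarrow> real \<Rightarrow> real \<Rightarrow> point" where
  "point_cells s r t \<equiv> (s ''UX'' [r, t], s ''UY'' [r, t])"

definition node_at :: "state \<Rightarrow> nat \<Rightarrow> node \<Rightarrow> bool" where
  "node_at s r nd \<longleftrightarrow>
    s ''ln'' [real r] = real (length (fst nd)) \<and>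
    (\<forall>t<length (fst nd). line_cells s (real r) (real t) = fst nd ! t) \<and>
    s ''un'' [real r] = real (length (snd nd)) \<and>
    (\<forall>t<length (snd nd). point_cells s (real r) (real t) = snd nd ! t)"

lemma node_atD:
  assumes "node_at s r nd"
  shows "s ''ln'' [real r] = real (length (fst nd))" "s ''un'' [real r] = real (length (snd nd))"
    "t < length (fst nd) \<Longrightarrow> s ''LA'' [real r, real t] = fst (fst nd ! t)"
    "t < length (fst nd) \<Longrightarrow> s ''LB'' [real r, real t] = fst (snd (fst nd ! t))"
    "t < length (fst nd) \<Longrightarrow> s ''LC'' [real r, real t] = snd (snd (fst nd ! t))"
    "t < length (snd nd) \<Longrightarrow> s ''UX'' [real r, real t] = fst (snd nd ! t)"
    "t < length (snd nd) \<Longrightarrow> s ''UY'' [real r, real t] = snd (snd nd ! t)"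
  using assms unfolding node_at_def by (metis fst_conv snd_conv)+

text \<open>Nothing is said about rows behind the end or cells beyond the recorded lengths, which
  may hold remains of earlier queries. A new row can therefore be written in place without touching
  the nodes before it.\<close>

definition queue :: "state \<Rightarrow> node list \<Rightarrow> bool" where
  "queue s ns \<longleftrightarrow> (\<forall>r<length ns. node_at s r (ns ! r))"

lemma queue_set_scalar [simp]: "queue (set_cell v [] a s) ns = queue s ns"
  by (simp add: queue_def node_at_def)

lemma queue_set_row:
  "length ns \<le> r \<Longrightarrow> queue (set_cell v (real r # ix) a s) ns = queue s ns"
  by (simp add: queue_def node_at_def)

section \<open>Writing one child of a node\<close>

abbreviation copy_step :: com where
  "copy_step \<equiv> Put ''LA'' [Var ''tail'', Var ''t''] (Get ''LA'' [Var ''head'', Var ''t'']) ;;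
       Put ''LB'' [Var ''tail'', Var ''t''] (Get ''LB'' [Var ''head'', Var ''t'']) ;;
       Put ''LC'' [Var ''tail'', Var ''t''] (Get ''LC'' [Var ''head'', Var ''t'']) ;;
       Inc ''t''"

definition copy_com :: com where
  "copy_com =
    ''t'' ::= Const 0 ;;
    While (Less (Var ''t'') (Get ''ln'' [Var ''head'']))
      copy_step ;;
    Put ''LA'' [Var ''tail'', Var ''t''] (Var ''la'') ;;
    Put ''LB'' [Var ''tail'', Var ''t''] (Var ''lb'') ;;
    Put ''LC'' [Var ''tail'', Var ''t''] (Var ''lc'') ;;
    Put ''ln'' [Var ''tail''] (Add (Var ''t'') (Const 1))"

abbreviation filter_test :: cond where
  "filter_test \<equiv> Equal (Add (Mul (Var ''la'') (Get ''UX'' [Var ''head'', Var ''t'']))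
                      (Mul (Var ''lb'') (Get ''UY'' [Var ''head'', Var ''t'']))) (Var ''lc'')"

abbreviation filter_keep :: com where
  "filter_keep \<equiv> Put ''UX'' [Var ''tail'', Get ''un'' [Var ''tail'']] (Get ''UX'' [Var ''head'', Var ''t'']) ;;
          Put ''UY'' [Var ''tail'', Get ''un'' [Var ''tail'']] (Get ''UY'' [Var ''head'', Var ''t'']) ;;
          Put ''un'' [Var ''tail''] (Add (Get ''un'' [Var ''tail'']) (Const 1))"

definition filter_com :: com where
  "filter_com =
    Put ''un'' [Var ''tail''] (Const 0) ;;
    ''t'' ::= Const 0 ;;
    While (Less (Var ''t'') (Get ''un'' [Var ''head'']))
      (If filter_test
         Skip
         filter_keep ;;
       Inc ''t'')"

definition child_com :: com where
  "child_com =
    ''la'' ::= Sub (Get ''UY'' [Var ''head'', Var ''i'']) (Get ''UY'' [Var ''head'', Var ''j'']) ;;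
    ''lb'' ::= Sub (Get ''UX'' [Var ''head'', Var ''j'']) (Get ''UX'' [Var ''head'', Var ''i'']) ;;
    If (And (Equal (Var ''la'') (Const 0)) (Equal (Var ''lb'') (Const 0))) (''lb'' ::= Const 1) Skip ;;
    ''lc'' ::= Add (Mul (Var ''la'') (Get ''UX'' [Var ''head'', Var ''i'']))
                   (Mul (Var ''lb'') (Get ''UY'' [Var ''head'', Var ''i''])) ;;
    copy_com ;;
    filter_com ;;
    Inc ''tail''"

abbreviation child_vars :: "vname set" where
  "child_vars \<equiv> {''la'', ''lb'', ''lc'', ''t'', ''LA'', ''LB'', ''LC'', ''ln'', ''UX'', ''UY'', ''un'', ''tail''}"

lemma runs_copy:
  assumes queue: "queue s ns" and h: "s ''head'' [] = real h" "h < length ns" "ns ! h = nd"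
    and tail: "s ''tail'' [] = real (length ns)"
    and l: "l = (s ''la'' [], s ''lb'' [], s ''lc'' [])"
    and F: "length (fst nd) + 1 \<le> F"
    and Q: "\<And>s'. frame {''t'', ''LA'', ''LB'', ''LC'', ''ln''} s s' \<Longrightarrow> queue s' ns \<Longrightarrow>
      s' ''ln'' [real (length ns)] = real (Suc (length (fst nd))) \<Longrightarrow>
      (\<And>t. t < Suc (length (fst nd)) \<Longrightarrow>
        line_cells s' (real (length ns)) (real t) = (fst nd @ [l]) ! t) \<Longrightarrow> Q s'"
  shows "runs copy_com s F Q"
proof -
  define N where "N = length (fst nd)"
  define T where "T = length ns"
  let ?V = "{''t'', ''LA'', ''LB'', ''LC'', ''ln''}"
  have F1: "1 \<le> F" using F by simp
  define I where "I c s' \<longleftrightarrow> frame ?V s s' \<and> queue s' ns \<and> s' ''t'' [] = real c \<and>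
    (\<forall>t<c. line_cells s' (real T) (real t) = fst nd ! t)" for c s'
  have body: "holds s' (Less (Var ''t'') (Get ''ln'' [Var ''head''])) \<and> runs copy_step s' 1 (I (Suc c))"
    if c: "c < N" and I: "I c s'" for c s'
  proof
    have same: "frame ?V s s'" and queue': "queue s' ns" and t: "s' ''t'' [] = real c"
      and copied: "\<forall>t<c. line_cells s' (real T) (real t) = fst nd ! t"
      using I by (auto simp: I_def)
    note v = frameD[OF same]
    have nd: "node_at s' h nd" using queue' h by (auto simp: queue_def)
    have hT: "h \<noteq> T" using h by (simp add: T_def)
    show "holds s' (Less (Var ''t'') (Get ''ln'' [Var ''head'']))"
      using node_atD(1)[OF nd] t c h v by (simp add: N_def)
    define s1 where "s1 = set_cell ''t'' [] (real c + 1)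
      (set_cell ''LC'' [real T, real c] (snd (snd (fst nd ! c)))
      (set_cell ''LB'' [real T, real c] (fst (snd (fst nd ! c)))
      (set_cell ''LA'' [real T, real c] (fst (fst nd ! c)) s')))"
    have "frame ?V s s1"
      unfolding s1_def by (intro frame_set_cell same) simp_all
    moreover have "queue s1 ns" using queue' by (simp add: s1_def queue_set_row T_def)
    moreover have "\<forall>t<Suc c. line_cells s1 (real T) (real t) = fst nd ! t"
      using copied by (auto simp: s1_def less_Suc_eq)
    ultimately have "I (Suc c) s1" by (simp add: I_def s1_def)
    then show "runs copy_step s' 1 (I (Suc c))"
      using node_atD(3-5)[OF nd, of c] t c h(1) tail v hT
      by (intro runs_Put_Seq runs_Put) (simp_all add: s1_def N_def T_def)
  qed
  show ?thesis
    unfolding copy_com_def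
  proof (rule runs_Put_Seq[OF _ F1], rule runs_Seq, rule runs_for[where N = N and F = 1 and I = I, OF _ body])
    show "I 0 (set_cell ''t'' (map (eval s) []) (eval s (Const 0)) s)"
      using queue by (auto simp: I_def intro!: frame_set_cell)
    fix s' assume I: "I N s'"
    then have same: "frame ?V s s'" and queue': "queue s' ns" and t: "s' ''t'' [] = real N"
      and copied: "\<forall>t<N. line_cells s' (real T) (real t) = fst nd ! t"
      by (auto simp: I_def)
    note v = frameD[OF same]
    have nd: "node_at s' h nd" using queue' h by (auto simp: queue_def)
    have exit: "\<not> holds s' (Less (Var ''t'') (Get ''ln'' [Var ''head'']))"
      using node_atD(1)[OF nd] t h v by (simp add: N_def)
    define s1 where "s1 = set_cell ''ln'' [real T] (real N + 1)
      (set_cell ''LC'' [real T, real N] (snd (snd l)) (set_cell ''LB'' [real T, real N] (fst (snd l))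
      (set_cell ''LA'' [real T, real N] (fst l) s')))"
    have "Q s1"
    proof (rule Q)
      show "frame ?V s s1"
        unfolding s1_def by (intro frame_set_cell same) simp_all
      show "queue s1 ns" using queue' by (simp add: s1_def queue_set_row T_def)
      show "line_cells s1 (real (length ns)) (real t) = (fst nd @ [l]) ! t"
        if "t < Suc (length (fst nd))" for t
        using copied that by (cases "t = N") (auto simp: s1_def T_def[symmetric] N_def nth_append)
    qed (simp add: s1_def T_def N_def)
    then show "\<not> holds s' (Less (Var ''t'') (Get ''ln'' [Var ''head''])) \<and>
      runs (Put ''LA'' [Var ''tail'', Var ''t''] (Var ''la'') ;;
        Put ''LB'' [Var ''tail'', Var ''t''] (Var ''lb'') ;;
        Put ''LC'' [Var ''tail'', Var ''t''] (Var ''lc'') ;;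
        Put ''ln'' [Var ''tail''] (Add (Var ''t'') (Const 1))) s' F Q"
      using exit t tail v l F1 by (intro conjI runs_Put_Seq runs_Put) (simp_all add: s1_def T_def)
  qed (use F in \<open>auto simp: N_def\<close>)
qed

lemma runs_filter:
  assumes queue: "queue s ns" and h: "s ''head'' [] = real h" "h < length ns" "ns ! h = nd"
    and tail: "s ''tail'' [] = real (length ns)"
    and l: "l = (s ''la'' [], s ''lb'' [], s ''lc'' [])"
    and F: "length (snd nd) + 1 \<le> F"
  defines "us \<equiv> filter (\<lambda>r. r \<notin> tline l) (snd nd)"
  assumes Q: "\<And>s'. frame {''t'', ''UX'', ''UY'', ''un''} s s' \<Longrightarrow> queue s' ns \<Longrightarrow>
      s' ''un'' [real (length ns)] = real (length us) \<Longrightarrow>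
      (\<And>t. t < length us \<Longrightarrow>
        point_cells s' (real (length ns)) (real t) = us ! t) \<Longrightarrow> Q s'"
  shows "runs filter_com s F Q"
proof -
  define N where "N = length (snd nd)"
  define T where "T = length ns"
  let ?V = "{''t'', ''UX'', ''UY'', ''un''}"
  have F1: "1 \<le> F" using F by simp
  define part where "part c = filter (\<lambda>r. r \<notin> tline l) (take c (snd nd))" for c
  define I where "I c s' \<longleftrightarrow> frame ?V s s' \<and> queue s' ns \<and> s' ''t'' [] = real c \<and>
    s' ''un'' [real T] = real (length (part c)) \<and>
    (\<forall>t<length (part c). point_cells s' (real T) (real t) = part c ! t)" for c s'
  let ?inc = "Inc ''t''"
  have body: "holds s' (Less (Var ''t'') (Get ''un'' [Var ''head''])) \<and>
      runs (If filter_test Skip filter_keep ;; ?inc) s' 1 (I (Suc c))"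
    if c: "c < N" and I: "I c s'" for c s'
  proof
    have same: "frame ?V s s'" and queue': "queue s' ns" and t: "s' ''t'' [] = real c"
      and un: "s' ''un'' [real T] = real (length (part c))"
      and pts: "\<forall>t<length (part c). point_cells s' (real T) (real t) = part c ! t"
      using I by (auto simp: I_def)
    note v = frameD[OF same]
    have nd: "node_at s' h nd" using queue' h by (auto simp: queue_def)
    have hT: "h \<noteq> T" using h by (simp add: T_def)
    define x where "x = snd nd ! c"
    have part_Suc: "part (Suc c) = (if x \<in> tline l then part c else part c @ [x])"
      using c by (simp add: part_def N_def take_Suc_conv_app_nth x_def)
    have xy: "s' ''UX'' [real h, real c] = fst x" "s' ''UY'' [real h, real c] = snd x"
      using node_atD(6,7)[OF nd, of c] c by (simp_all add: N_def x_def)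
    show "holds s' (Less (Var ''t'') (Get ''un'' [Var ''head'']))"
      using node_atD(2)[OF nd] t c h v by (simp add: N_def)
    have test: "holds s' filter_test \<longleftrightarrow> x \<in> tline l"
      using xy t h(1) v l by (simp add: tline_def line_of_def case_prod_beta)
    show "runs (If filter_test Skip filter_keep ;; ?inc) s' 1 (I (Suc c))"
    proof (rule runs_Seq, rule runs_If)
      assume "holds s' filter_test"
      then have "part (Suc c) = part c" using test part_Suc by simp
      then show "runs Skip s' 1 (\<lambda>s'. runs ?inc s' 1 (I (Suc c)))"
        using same queue' t un pts
        by (intro runs_Skip runs_Put) (simp_all add: I_def frame_set_cell)
    next
      assume "\<not> holds s' filter_test"
      then have p: "part (Suc c) = part c @ [x]" using test part_Suc by simp
      define s1 where "s1 = set_cell ''un'' [real T] (real (length (part c)) + 1)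
        (set_cell ''UY'' [real T, real (length (part c))] (snd x)
        (set_cell ''UX'' [real T, real (length (part c))] (fst x) s'))"
      have "I (Suc c) (set_cell ''t'' [] (real c + 1) s1)"
        unfolding I_def
      proof (intro conjI allI impI)
        show "frame ?V s (set_cell ''t'' [] (real c + 1) s1)"
          unfolding s1_def by (intro frame_set_cell same) simp_all
        show "queue (set_cell ''t'' [] (real c + 1) s1) ns"
          using queue' by (simp add: s1_def queue_set_row T_def)
        fix u assume "u < length (part (Suc c))"
        then show "(set_cell ''t'' [] (real c + 1) s1 ''UX'' [real T, real u],
            set_cell ''t'' [] (real c + 1) s1 ''UY'' [real T, real u]) = part (Suc c) ! u"
          using pts unfolding p by (cases "u = length (part c)") (auto simp: s1_def nth_append)
      qed (simp_all add: s1_def p)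
      then show "runs filter_keep s' 1 (\<lambda>s'. runs ?inc s' 1 (I (Suc c)))"
        using t un tail v h(1) xy hT
        by (intro runs_Put_Seq runs_Put) (simp_all add: s1_def T_def)
    qed simp
  qed
  have hT: "h \<noteq> T" using h by (simp add: T_def)
  define s1 where "s1 = set_cell ''t'' [] 0 (set_cell ''un'' [real T] 0 s)"
  have "runs (While (Less (Var ''t'') (Get ''un'' [Var ''head''])) (If filter_test Skip filter_keep ;; ?inc)) s1 F Q"
  proof (rule runs_for[where N = N and F = 1 and I = I, OF _ body])
    show "I 0 s1"
      unfolding I_def s1_def using queue
      by (simp add: part_def queue_set_row T_def frame_set_cell)
    fix s' assume I: "I N s'"
    then have same: "frame ?V s s'" and queue': "queue s' ns" and t: "s' ''t'' [] = real N"
      by (auto simp: I_def)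
    have nd: "node_at s' h nd" using queue' h by (auto simp: queue_def)
    have exit: "\<not> holds s' (Less (Var ''t'') (Get ''un'' [Var ''head'']))"
      using node_atD(2)[OF nd] t h frameD[OF same] by (simp add: N_def)
    have "part N = us" by (simp add: part_def us_def N_def)
    then have "Q s'" using I by (intro Q[OF same queue']) (auto simp: I_def T_def)
    then show "\<not> holds s' (Less (Var ''t'') (Get ''un'' [Var ''head''])) \<and> Q s'" using exit by simp
  qed (use F in \<open>auto simp: N_def\<close>)
  then show ?thesis
    unfolding filter_com_def using tail F1 by (intro runs_Put_Seq) (simp_all add: s1_def T_def)
qed

lemma runs_child:
  assumes queue: "queue s ns" and h: "s ''head'' [] = real h" "h < length ns" "ns ! h = nd"
    and tail: "s ''tail'' [] = real (length ns)"
    and i: "s ''i'' [] = real i" "i < length (snd nd)" and j: "s ''j'' [] = real j" "j < length (snd nd)"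
    and F: "length (fst nd) + 1 \<le> F" "length (snd nd) + 1 \<le> F"
    and Q: "\<And>s'. frame child_vars s s' \<Longrightarrow> queue s' (ns @ [kid nd i j]) \<Longrightarrow>
      s' ''tail'' [] = real (length ns) + 1 \<Longrightarrow> Q s'"
  shows "runs child_com s F Q"
proof -
  let ?test = "And (Equal (Var ''la'') (Const 0)) (Equal (Var ''lb'') (Const 0))"
  let ?vert = "If ?test (''lb'' ::= Const 1) Skip"
  let ?rest = "copy_com ;; filter_com ;; Inc ''tail''"
  define p where "p = snd nd ! i"
  define q where "q = snd nd ! j"
  define l where "l = join p q"
  have F1: "1 \<le> F" using F by simp
  have nd: "node_at s h nd" using queue h by (auto simp: queue_def)
  have xy: "s ''UX'' [real h, real i] = fst p" "s ''UY'' [real h, real i] = snd p"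
    "s ''UX'' [real h, real j] = fst q" "s ''UY'' [real h, real j] = snd q"
    using node_atD(6,7)[OF nd] i j by (simp_all add: p_def q_def)
  define s1 where "s1 = set_cell ''lb'' [] (fst q - fst p) (set_cell ''la'' [] (snd p - snd q) s)"
  let ?fin = "Inc ''tail''"
  let ?lc = "''lc'' ::= Add (Mul (Var ''la'') (Get ''UX'' [Var ''head'', Var ''i'']))
                   (Mul (Var ''lb'') (Get ''UY'' [Var ''head'', Var ''i'']))"
  have main: "runs ?rest s2 F Q"
    if same2: "frame child_vars s s2" and queue2: "queue s2 ns"
      and l2: "l = (s2 ''la'' [], s2 ''lb'' [], s2 ''lc'' [])" and tail2: "s2 ''tail'' [] = real (length ns)" for s2
  proof -
    have h2: "s2 ''head'' [] = real h" using h frameD[OF same2] by simp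
    show ?thesis
    proof (rule runs_Seq, rule runs_copy[OF queue2 h2 h(2,3) tail2 l2 F(1)])
      fix s3 assume same3: "frame {''t'', ''LA'', ''LB'', ''LC'', ''ln''} s2 s3"
        and queue3: "queue s3 ns"
        and ln: "s3 ''ln'' [real (length ns)] = real (Suc (length (fst nd)))"
        and ls: "\<And>t. t < Suc (length (fst nd)) \<Longrightarrow>
          line_cells s3 (real (length ns)) (real t) = (fst nd @ [l]) ! t"
      have v3: "s3 ''head'' [] = real h" "s3 ''tail'' [] = real (length ns)"
          "l = (s3 ''la'' [], s3 ''lb'' [], s3 ''lc'' [])"
        using h2 tail2 l2 frameD[OF same3] by simp_all
      show "runs (filter_com ;; ?fin) s3 F Q"
      proof (rule runs_Seq, rule runs_filter[OF queue3 v3(1) h(2,3) v3(2,3) F(2)])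
        let ?us = "filter (\<lambda>r. r \<notin> tline l) (snd nd)"
        fix s4 assume same4: "frame {''t'', ''UX'', ''UY'', ''un''} s3 s4"
          and queue4: "queue s4 ns" and un: "s4 ''un'' [real (length ns)] = real (length ?us)"
          and us: "\<And>t. t < length ?us \<Longrightarrow>
            point_cells s4 (real (length ns)) (real t) = ?us ! t"
        have tail4: "s4 ''tail'' [] = real (length ns)" using v3 frameD[OF same4] by simp
        have "node_at s4 (length ns) (kid nd i j)"
          using ln ls un us frameD[OF same4]
          by (simp add: node_at_def kid_def Let_def l_def p_def q_def)
        then have q4: "queue s4 (ns @ [kid nd i j])"
          using queue4 by (auto simp: queue_def nth_append less_Suc_eq)
        define s5 where "s5 = set_cell ''tail'' [] (real (length ns) + 1) s4"
        have "frame child_vars s s3" by (rule frame_trans[OF same2 same3]) auto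
        then have "frame child_vars s s4" by (rule frame_trans[OF _ same4]) auto
        then have "frame child_vars s s5" unfolding s5_def by (rule frame_set_cell) simp
        then have "Q s5" using q4 by (intro Q) (simp_all add: s5_def)
        then show "runs ?fin s4 F Q" using tail4 F1 by (intro runs_Put) (simp_all add: s5_def)
      qed
    qed
  qed
  have "runs (?vert ;;
      ?lc ;; ?rest) s1 F Q"
  proof (rule runs_Seq)
    define s2 where "s2 = set_cell ''lb'' [] (join_b p q) s1"
    define s3 where "s3 = set_cell ''lc'' [] (snd (snd l)) s2"
    have "frame child_vars s s3"
      unfolding s3_def s2_def s1_def by (intro frame_set_cell) simp_all
    then have "runs ?rest s3 F Q"
      using queue tail by (intro main) (simp_all add: s3_def s2_def s1_def l_def join_def)
    then have cont: "runs (?lc ;; ?rest) s2 F Q"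
      using xy h(1) i(1) F1 by (intro runs_Put_Seq) (simp_all add: s3_def s2_def s1_def l_def join_def)
    show "runs ?vert s1 F
      (\<lambda>s. runs (?lc ;; ?rest) s F Q)"
    proof (rule runs_If)
      assume "holds s1 ?test"
      then have "join_b p q = 1" by (simp add: s1_def join_b_def)
      then show "runs (''lb'' ::= Const 1) s1 F (\<lambda>s. runs (?lc ;; ?rest) s F Q)"
        using cont F1 by (intro runs_Put) (simp_all add: s2_def)
    next
      assume "\<not> holds s1 ?test"
      then have "join_b p q = s1 ''lb'' []" by (auto simp: s1_def join_b_def)
      then have "s2 = s1" by (simp add: s2_def set_cell_def fun_eq_iff)
      then show "runs Skip s1 F (\<lambda>s. runs (?lc ;; ?rest) s F Q)"
        using cont F1 by (intro runs_Skip) simp_all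
    qed (rule F1)
  qed
  then show ?thesis
    unfolding child_com_def using xy h(1) i(1) j(1) F1
    by (intro runs_Put_Seq) (simp_all add: s1_def)
qed

section \<open>All children of a node\<close>

definition branching :: "nat \<Rightarrow> node \<Rightarrow> nat" where
  "branching m nd = min (length (snd nd)) (m + 1)"

definition kids :: "nat \<Rightarrow> node \<Rightarrow> node list" where
  "kids m nd = concat (map (\<lambda>i. map (kid nd i) [0..<branching m nd]) [0..<branching m nd])"

definition row_com :: com where
  "row_com =
    ''j'' ::= Const 0 ;;
    While (And (Less (Var ''j'') (Get ''un'' [Var ''head''])) (LessEq (Var ''j'') (Var ''m'')))
      (child_com ;; Inc ''j'')"

definition expand_com :: com where
  "expand_com =
    ''i'' ::= Const 0 ;;
    While (And (Less (Var ''i'') (Get ''un'' [Var ''head''])) (LessEq (Var ''i'') (Var ''m'')))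
      (row_com ;; Inc ''i'')"

text \<open>The node being expanded stays readable in its row while its children are appended behind
  it.\<close>

lemma queue_append_at:
  "queue s (ns @ ms) \<Longrightarrow> h < length ns \<Longrightarrow> ns ! h = nd \<Longrightarrow> node_at s h nd"
  unfolding queue_def by (drule spec[of _ h]) (simp add: nth_append)

lemma runs_row:
  assumes queue: "queue s ns" and h: "s ''head'' [] = real h" "h < length ns" "ns ! h = nd"
    and tail: "s ''tail'' [] = real (length ns)" and m: "s ''m'' [] = real m"
    and i: "s ''i'' [] = real i" "i < branching m nd"
    and G: "length (fst nd) + 1 \<le> G" "length (snd nd) + 1 \<le> G"
    and F: "branching m nd * G + 1 \<le> F"
    and Q: "\<And>s'. frame (insert ''j'' child_vars) s s' \<Longrightarrow>
      queue s' (ns @ map (kid nd i) [0..<branching m nd]) \<Longrightarrow>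
      s' ''tail'' [] = real (length ns) + real (branching m nd) \<Longrightarrow> Q s'"
  shows "runs row_com s F Q"
proof -
  define K where "K = branching m nd"
  have F1: "1 \<le> F" and G1: "1 \<le> G" using F G by auto
  have iK: "i < length (snd nd)" using i(2) by (simp add: branching_def)
  define I where "I c s' \<longleftrightarrow> frame (insert ''j'' child_vars) s s' \<and>
    queue s' (ns @ map (kid nd i) [0..<c]) \<and> s' ''tail'' [] = real (length ns) + real c \<and>
    s' ''j'' [] = real c" for c s'
  let ?b = "And (Less (Var ''j'') (Get ''un'' [Var ''head''])) (LessEq (Var ''j'') (Var ''m''))"
  let ?body = "child_com ;; Inc ''j''"
  have test: "holds s' ?b \<longleftrightarrow> c < K" if "I c s'" for c s'
  proof -
    have queue': "queue s' (ns @ map (kid nd i) [0..<c])" and same: "frame (insert ''j'' child_vars) s s'"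
      using that by (auto simp: I_def)
    have "s' ''j'' [] = real c" using that by (simp add: I_def)
    moreover have "s' ''un'' [real h] = real (length (snd nd))"
      by (rule node_atD(2)[OF queue_append_at[OF queue' h(2,3)]])
    moreover have "s' ''head'' [] = real h" "s' ''m'' [] = real m"
      using h m frameD[OF same] by simp_all
    ultimately show ?thesis by (simp add: K_def branching_def less_Suc_eq_le)
  qed
  have body: "holds s' ?b \<and> runs ?body s' G (I (Suc c))" if c: "c < K" and I: "I c s'" for c s'
  proof
    show "holds s' ?b" using test I c by blast
    have same: "frame (insert ''j'' child_vars) s s'" and queue': "queue s' (ns @ map (kid nd i) [0..<c])"
      and tail': "s' ''tail'' [] = real (length ns) + real c" and j: "s' ''j'' [] = real c"
      using I by (auto simp: I_def)
    have c': "c < length (snd nd)" using c by (simp add: K_def branching_def)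
    have v: "s' ''head'' [] = real h" "s' ''i'' [] = real i" using h i frameD[OF same] by simp_all
    have hd: "h < length (ns @ map (kid nd i) [0..<c])" "(ns @ map (kid nd i) [0..<c]) ! h = nd"
      using h by (simp_all add: nth_append)
    have tl: "s' ''tail'' [] = real (length (ns @ map (kid nd i) [0..<c]))" using tail' by simp
    show "runs ?body s' G (I (Suc c))"
    proof (rule runs_Seq, rule runs_child[OF queue' v(1) hd tl v(2) iK j c' G])
      fix t assume same1: "frame child_vars s' t"
        and q1: "queue t ((ns @ map (kid nd i) [0..<c]) @ [kid nd i c])"
        and t1: "t ''tail'' [] = real (length (ns @ map (kid nd i) [0..<c])) + 1"
      have "frame (insert ''j'' child_vars) s t" by (rule frame_trans[OF same same1]) auto
      moreover have "t ''j'' [] = real c" using j frameD[OF same1] by simp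
      ultimately show "runs (Inc ''j'') t G (I (Suc c))"
        using q1 t1 G1 by (intro runs_Put) (simp_all add: I_def frame_set_cell)
    qed
  qed
  show ?thesis
    unfolding row_com_def
  proof (rule runs_Put_Seq[OF _ F1], rule runs_for[where N = K and F = G and I = I, OF _ body _ G1])
    show "I 0 (set_cell ''j'' (map (eval s) []) (eval s (Const 0)) s)"
      using queue tail by (simp add: I_def frame_set_cell)
    show "\<not> holds s' ?b \<and> Q s'" if "I K s'" for s'
      using that test[OF that] Q by (simp add: I_def K_def)
  qed (use F in \<open>auto simp: K_def\<close>)
qed

lemma runs_expand:
  assumes queue: "queue s ns" and h: "s ''head'' [] = real h" "h < length ns" "ns ! h = nd"
    and tail: "s ''tail'' [] = real (length ns)" and m: "s ''m'' [] = real m"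
    and G: "length (fst nd) + 1 \<le> G" "length (snd nd) + 1 \<le> G"
    and F: "branching m nd * (branching m nd * G + 1) + 1 \<le> F"
    and Q: "\<And>s'. frame ({''i'', ''j''} \<union> child_vars) s s' \<Longrightarrow> queue s' (ns @ kids m nd) \<Longrightarrow>
      s' ''tail'' [] = real (length (ns @ kids m nd)) \<Longrightarrow> Q s'"
  shows "runs expand_com s F Q"
proof -
  define K where "K = branching m nd"
  define H where "H = K * G + 1"
  define ks where "ks c = concat (map (\<lambda>i. map (kid nd i) [0..<K]) [0..<c])" for c
  have F1: "1 \<le> F" and H1: "1 \<le> H" using F by (auto simp: H_def)
  define I where "I c s' \<longleftrightarrow> frame ({''i'', ''j''} \<union> child_vars) s s' \<and>
    queue s' (ns @ ks c) \<and> s' ''tail'' [] = real (length (ns @ ks c)) \<and> s' ''i'' [] = real c" for c s'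
  let ?b = "And (Less (Var ''i'') (Get ''un'' [Var ''head''])) (LessEq (Var ''i'') (Var ''m''))"
  let ?body = "row_com ;; Inc ''i''"
  have test: "holds s' ?b \<longleftrightarrow> c < K" if "I c s'" for c s'
  proof -
    have queue': "queue s' (ns @ ks c)" and same: "frame ({''i'', ''j''} \<union> child_vars) s s'"
      using that by (auto simp: I_def)
    have "s' ''i'' [] = real c" using that by (simp add: I_def)
    moreover have "s' ''un'' [real h] = real (length (snd nd))"
      by (rule node_atD(2)[OF queue_append_at[OF queue' h(2,3)]])
    moreover have "s' ''head'' [] = real h" "s' ''m'' [] = real m"
      using h m frameD[OF same] by simp_all
    ultimately show ?thesis by (simp add: K_def branching_def less_Suc_eq_le)
  qed
  have body: "holds s' ?b \<and> runs ?body s' H (I (Suc c))" if c: "c < K" and I: "I c s'" for c s'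
  proof
    show "holds s' ?b" using test I c by blast
    have same: "frame ({''i'', ''j''} \<union> child_vars) s s'" and queue': "queue s' (ns @ ks c)"
      and tail': "s' ''tail'' [] = real (length (ns @ ks c))" and i: "s' ''i'' [] = real c"
      using I by (auto simp: I_def)
    have c': "c < branching m nd" using c by (simp add: K_def)
    have v: "s' ''head'' [] = real h" "s' ''m'' [] = real m" using h m frameD[OF same] by simp_all
    have hd: "h < length (ns @ ks c)" "(ns @ ks c) ! h = nd"
      using h by (simp_all add: nth_append)
    have HF: "branching m nd * G + 1 \<le> H" by (simp add: H_def K_def)
    show "runs ?body s' H (I (Suc c))"
    proof (rule runs_Seq, rule runs_row[OF queue' v(1) hd tail' v(2) i c' G HF])
      fix t assume same1: "frame (insert ''j'' child_vars) s' t"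
        and q1: "queue t ((ns @ ks c) @ map (kid nd c) [0..<branching m nd])"
        and t1: "t ''tail'' [] = real (length (ns @ ks c)) + real (branching m nd)"
      have "frame ({''i'', ''j''} \<union> child_vars) s t" by (rule frame_trans[OF same same1]) auto
      moreover have "t ''i'' [] = real c" using i frameD[OF same1] by simp
      moreover have "ks (Suc c) = ks c @ map (kid nd c) [0..<branching m nd]" by (simp add: ks_def K_def)
      ultimately show "runs (Inc ''i'') t H (I (Suc c))"
        using q1 t1 H1 by (intro runs_Put) (simp_all add: I_def frame_set_cell)
    qed
  qed
  show ?thesis
    unfolding expand_com_def
  proof (rule runs_Put_Seq[OF _ F1], rule runs_for[where N = K and F = H and I = I, OF _ body _ H1])
    show "I 0 (set_cell ''i'' (map (eval s) []) (eval s (Const 0)) s)"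
      using queue tail by (simp add: I_def frame_set_cell ks_def)
    show "\<not> holds s' ?b \<and> Q s'" if "I K s'" for s'
      using that test[OF that] Q by (simp add: I_def K_def kids_def ks_def)
  qed (use F in \<open>auto simp: K_def H_def\<close>)
qed

section \<open>The root of the search tree\<close>

abbreviation lines_put :: com where
  "lines_put \<equiv> Put ''LA'' [Const 0, Var ''h''] (Get ''A'' [Var ''i'']) ;;
         Put ''LB'' [Const 0, Var ''h''] (Get ''B'' [Var ''i'']) ;;
         Put ''LC'' [Const 0, Var ''h''] (Get ''C'' [Var ''i'']) ;;
         Inc ''h''"

definition lines_com :: com where
  "lines_com =
    ''h'' ::= Const 0 ;; ''i'' ::= Const 1 ;;
    While (LessEq (Var ''i'') (Var ''m''))
      (If (Less (Const 0) (Get ''n'' [Var ''i'']))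
        lines_put Skip ;;
       Inc ''i'') ;;
    Put ''ln'' [Const 0] (Var ''h'')"

abbreviation loose_step :: com where
  "loose_step \<equiv> Put ''UX'' [Const 0, Var ''j''] (Get ''X'' [Const 0, Var ''j'']) ;;
       Put ''UY'' [Const 0, Var ''j''] (Get ''Y'' [Const 0, Var ''j'']) ;;
       Inc ''j''"

definition loose_com :: com where
  "loose_com =
    ''j'' ::= Const 0 ;;
    While (Less (Var ''j'') (Get ''n'' [Const 0]))
      loose_step ;;
    Put ''un'' [Const 0] (Var ''j'')"

definition coefficients :: "state \<Rightarrow> nat \<Rightarrow> real \<times> real \<times> real" where
  "coefficients s i = (s ''A'' [real i], s ''B'' [real i], s ''C'' [real i])"

definition heavy_slots :: "nat \<Rightarrow> (nat \<Rightarrow> point list) \<Rightarrow> nat list" where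
  "heavy_slots m L = filter (\<lambda>i. L i \<noteq> []) [1..<Suc m]"

definition root :: "nat \<Rightarrow> state \<Rightarrow> (nat \<Rightarrow> point list) \<Rightarrow> node" where
  "root m s L = (map (coefficients s) (heavy_slots m L), L 0)"

lemma runs_lines:
  assumes st: "stores m s L" and m: "s ''m'' [] = real m" and F: "m + 1 \<le> F"
    and Q: "\<And>s'. frame {''h'', ''i'', ''LA'', ''LB'', ''LC'', ''ln''} s s' \<Longrightarrow>
      s' ''ln'' [0] = real (length (heavy_slots m L)) \<Longrightarrow>
      (\<And>t. t < length (heavy_slots m L) \<Longrightarrow>
        line_cells s' 0 (real t) =
        map (coefficients s) (heavy_slots m L) ! t) \<Longrightarrow> Q s'"
  shows "runs lines_com s F Q"
proof -
  let ?V = "{''h'', ''i'', ''LA'', ''LB'', ''LC'', ''ln''}"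
  have F1: "1 \<le> F" using F by simp
  define hs where "hs c = map (coefficients s) (heavy_slots c L)" for c
  define I where "I c s' \<longleftrightarrow> frame ?V s s' \<and> s' ''i'' [] = real (Suc c) \<and>
    s' ''h'' [] = real (length (hs c)) \<and>
    (\<forall>t<length (hs c). line_cells s' 0 (real t) = hs c ! t)"
    for c s'
  let ?b = "LessEq (Var ''i'') (Var ''m'')"
  let ?test = "Less (Const 0) (Get ''n'' [Var ''i''])"
  let ?inc = "Inc ''i''"
  have body: "holds s' ?b \<and> runs (If ?test lines_put Skip ;; ?inc) s' 1 (I (Suc c))"
    if c: "c < m" and I: "I c s'" for c s'
  proof
    have same: "frame ?V s s'" and i: "s' ''i'' [] = real (Suc c)" and h: "s' ''h'' [] = real (length (hs c))"
      and row: "\<forall>t<length (hs c). line_cells s' 0 (real t) = hs c ! t"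
      using I by (auto simp: I_def)
    note v = frameD[OF same]
    show "holds s' ?b" using c i m v by simp
    have test: "holds s' ?test \<longleftrightarrow> L (Suc c) \<noteq> []"
      using storesD(1)[OF st, of "Suc c"] c v i by simp
    have hs_Suc: "hs (Suc c) = (if L (Suc c) \<noteq> [] then hs c @ [coefficients s (Suc c)] else hs c)"
      by (simp add: hs_def heavy_slots_def)
    show "runs (If ?test lines_put Skip ;; ?inc) s' 1 (I (Suc c))"
    proof (rule runs_Seq, rule runs_If)
      assume "holds s' ?test"
      then have hs': "hs (Suc c) = hs c @ [coefficients s (Suc c)]" using test hs_Suc by simp
      define s1 where "s1 = set_cell ''h'' [] (real (length (hs c)) + 1)
        (set_cell ''LC'' [0, real (length (hs c))] (s ''C'' [real (Suc c)])
        (set_cell ''LB'' [0, real (length (hs c))] (s ''B'' [real (Suc c)])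
        (set_cell ''LA'' [0, real (length (hs c))] (s ''A'' [real (Suc c)]) s')))"
      have "I (Suc c) (set_cell ''i'' [] (real (Suc c) + 1) s1)"
        unfolding I_def
      proof (intro conjI allI impI)
        show "frame ?V s (set_cell ''i'' [] (real (Suc c) + 1) s1)"
          unfolding s1_def by (intro frame_set_cell same) simp_all
        fix t assume "t < length (hs (Suc c))"
        then show "(set_cell ''i'' [] (real (Suc c) + 1) s1 ''LA'' [0, real t],
            set_cell ''i'' [] (real (Suc c) + 1) s1 ''LB'' [0, real t],
            set_cell ''i'' [] (real (Suc c) + 1) s1 ''LC'' [0, real t]) = hs (Suc c) ! t"
          using row unfolding hs'
          by (cases "t = length (hs c)") (auto simp: s1_def nth_append coefficients_def)
      qed (simp_all add: s1_def hs')
      then show "runs lines_put s' 1 (\<lambda>s'. runs ?inc s' 1 (I (Suc c)))"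
        using i h v by (intro runs_Put_Seq runs_Put) (simp_all add: s1_def)
    next
      assume "\<not> holds s' ?test"
      then have "hs (Suc c) = hs c" using test hs_Suc by simp
      then show "runs Skip s' 1 (\<lambda>s'. runs ?inc s' 1 (I (Suc c)))"
        using same i h row by (intro runs_Skip runs_Put) (simp_all add: I_def frame_set_cell)
    qed simp
  qed
  define s1 where "s1 = set_cell ''i'' [] 1 (set_cell ''h'' [] 0 s)"
  have "runs (While ?b (If ?test lines_put Skip ;; ?inc) ;; Put ''ln'' [Const 0] (Var ''h'')) s1 F Q"
  proof (rule runs_Seq, rule runs_for[where N = m and F = 1 and I = I, OF _ body])
    show "I 0 s1"
      by (simp add: I_def s1_def frame_set_cell hs_def heavy_slots_def)
    fix s' assume I: "I m s'"
    then have same: "frame ?V s s'" and i: "s' ''i'' [] = real (Suc m)" and h: "s' ''h'' [] = real (length (hs m))"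
      and row: "\<forall>t<length (hs m). line_cells s' 0 (real t) = hs m ! t"
      by (auto simp: I_def)
    have "Q (set_cell ''ln'' [0] (real (length (hs m))) s')"
      by (rule Q) (use same row in \<open>auto simp: hs_def intro!: frame_set_cell\<close>)
    then have "runs (Put ''ln'' [Const 0] (Var ''h'')) s' F Q"
      using h F1 by (intro runs_Put) simp_all
    then show "\<not> holds s' ?b \<and> runs (Put ''ln'' [Const 0] (Var ''h'')) s' F Q"
      using i m frameD[OF same] by simp
  qed (use F in auto)
  then show ?thesis
    unfolding lines_com_def using F1 by (intro runs_Put_Seq) (simp_all add: s1_def)
qed

lemma runs_loose:
  assumes st: "stores m s L" and F: "length (L 0) + 1 \<le> F"
    and Q: "\<And>s'. frame {''j'', ''UX'', ''UY'', ''un''} s s' \<Longrightarrow>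
      s' ''un'' [0] = real (length (L 0)) \<Longrightarrow>
      (\<And>t. t < length (L 0) \<Longrightarrow> point_cells s' 0 (real t) = L 0 ! t) \<Longrightarrow> Q s'"
  shows "runs loose_com s F Q"
proof -
  let ?V = "{''j'', ''UX'', ''UY'', ''un''}"
  define N where "N = length (L 0)"
  have F1: "1 \<le> F" using F by simp
  have n: "s ''n'' [0] = real N" using storesD(1)[OF st, of 0] by (simp add: N_def)
  define I where "I c s' \<longleftrightarrow> frame ?V s s' \<and> s' ''j'' [] = real c \<and>
    (\<forall>t<c. point_cells s' 0 (real t) = L 0 ! t)" for c s'
  let ?b = "Less (Var ''j'') (Get ''n'' [Const 0])"
  have body: "holds s' ?b \<and> runs loose_step s' 1 (I (Suc c))" if c: "c < N" and I: "I c s'" for c s'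
  proof
    have same: "frame ?V s s'" and j: "s' ''j'' [] = real c"
      and row: "\<forall>t<c. point_cells s' 0 (real t) = L 0 ! t"
      using I by (auto simp: I_def)
    note v = frameD[OF same]
    show "holds s' ?b" using c j n v by simp
    have xy: "s ''X'' [0, real c] = fst (L 0 ! c)" "s ''Y'' [0, real c] = snd (L 0 ! c)"
      using storesD(2,3)[OF st, of 0 c] c by (simp_all add: N_def)
    define s1 where "s1 = set_cell ''j'' [] (real c + 1) (set_cell ''UY'' [0, real c] (snd (L 0 ! c))
      (set_cell ''UX'' [0, real c] (fst (L 0 ! c)) s'))"
    have "frame ?V s s1" unfolding s1_def by (intro frame_set_cell same) simp_all
    then have "I (Suc c) s1" using row by (auto simp: I_def s1_def less_Suc_eq)
    then show "runs loose_step s' 1 (I (Suc c))"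
      using j v xy by (intro runs_Put_Seq runs_Put) (simp_all add: s1_def)
  qed
  show ?thesis
    unfolding loose_com_def
  proof (rule runs_Put_Seq[OF _ F1], rule runs_Seq, rule runs_for[where N = N and F = 1 and I = I, OF _ body])
    show "I 0 (set_cell ''j'' (map (eval s) []) (eval s (Const 0)) s)"
      by (simp add: I_def frame_set_cell)
    fix s' assume I: "I N s'"
    then have same: "frame ?V s s'" and j: "s' ''j'' [] = real N"
      and row: "\<forall>t<N. point_cells s' 0 (real t) = L 0 ! t"
      by (auto simp: I_def)
    have "Q (set_cell ''un'' [0] (real N) s')"
      by (rule Q) (use same row in \<open>auto simp: N_def intro!: frame_set_cell\<close>)
    then have "runs (Put ''un'' [Const 0] (Var ''j'')) s' F Q"
      using j F1 by (intro runs_Put) simp_all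
    then show "\<not> holds s' ?b \<and> runs (Put ''un'' [Const 0] (Var ''j'')) s' F Q"
      using j n frameD[OF same] by simp
  qed (use F in \<open>auto simp: N_def\<close>)
qed

lemma tline_coefficients: "tline (coefficients s i) = slot_line s i"
  by (simp add: tline_def coefficients_def slot_line_def)

lemma set_heavy_slots: "set (heavy_slots m L) = {i\<in>{1..m}. L i \<noteq> []}"
  by (auto simp: heavy_slots_def)

lemma length_heavy_slots: "length (heavy_slots m L) \<le> m"
  unfolding heavy_slots_def using length_filter_le[of "\<lambda>i. L i \<noteq> []" "[1..<Suc m]"]
  by (simp del: upt_Suc)

lemma partial_cover_root:
  assumes st: "stores m s L" and str: "structured m L (slot_line s)" and cov: "coverable m (stored m L)"
  shows "partial_cover m (stored m L) (root m s L)"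
proof -
  have "length (L 0) \<le> m * m" using loose_le[OF str cov] stores_distinct[OF st] by simp
  moreover have "is_line (slot_line s i)" if "i \<in> set (heavy_slots m L)" for i
    using that str unfolding set_heavy_slots structured_def by blast
  moreover have "stored m L \<subseteq> (\<Union>i\<in>set (heavy_slots m L). slot_line s i) \<union> set (L 0)"
  proof
    fix p assume "p \<in> stored m L"
    then obtain i where i: "i \<le> m" "p \<in> set (L i)" by blast
    show "p \<in> (\<Union>i\<in>set (heavy_slots m L). slot_line s i) \<union> set (L 0)"
    proof (cases "i = 0")
      case False
      then have h: "i \<in> set (heavy_slots m L)" using i unfolding set_heavy_slots by auto
      then have "set (L i) \<subseteq> slot_line s i"
        using str unfolding set_heavy_slots structured_def by blast
      then show ?thesis using h i(2) by blast
    qed (use i in simp)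
  qed
  ultimately show ?thesis
    using length_heavy_slots[of m L] stores_distinct[OF st, of 0]
    by (simp add: partial_cover_def root_def image_image tline_coefficients)
qed

text \<open>As \<open>q \<le> m\<close>, a cover by \<open>q\<close> lines contains all heavy lines,
  and these are pairwise different; so at most \<open>q - length (heavy_slots m L)\<close> further
  lines remain. They cover the loose points because no heavy line does.\<close>

lemma extendable_root:
  assumes st: "stores m s L" and str: "structured m L (slot_line s)" and q: "q \<le> m"
    and cov: "coverable q (stored m L)"
  shows "extendable q (root m s L)"
proof -
  obtain Ls where Ls: "line_cover q (stored m L) Ls" using cov by (auto simp: coverable_def)
  define H where "H = slot_line s ` set (heavy_slots m L)"
  have "slot_line s i \<in> Ls" if "i \<in> {1..m}" "L i \<noteq> []" for i
    by (rule heavy_lines_in_cover[OF str stores_distinct[OF st] order_refl _ Ls q that]) simp_all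
  then have sub: "H \<subseteq> Ls" by (auto simp: H_def set_heavy_slots)
  have "inj_on (slot_line s) (set (heavy_slots m L))"
    using str unfolding structured_def set_heavy_slots by blast
  moreover have "distinct (heavy_slots m L)" by (simp add: heavy_slots_def)
  ultimately have cardH: "card H = length (heavy_slots m L)"
    unfolding H_def by (simp add: card_image distinct_card)
  have finLs: "finite Ls" and cardLs: "card Ls \<le> q" using Ls by (auto simp: line_cover_def)
  have "card (Ls - H) = card Ls - card H" using sub finLs by (meson card_Diff_subset finite_subset)
  then have 1: "card (Ls - H) \<le> q - length (heavy_slots m L)" using cardLs cardH by simp
  have 2: "length (heavy_slots m L) \<le> q" using card_mono[OF finLs sub] cardLs cardH by simp
  have "p \<in> \<Union>(Ls - H)" if p: "p \<in> set (L 0)" for p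
  proof -
    have "p \<in> stored m L" using p by auto
    then obtain l where l: "l \<in> Ls" "p \<in> l" using Ls unfolding line_cover_def by blast
    have "l \<notin> H"
    proof
      assume "l \<in> H"
      then obtain i where "i \<in> {1..m}" "L i \<noteq> []" "l = slot_line s i"
        by (auto simp: H_def set_heavy_slots)
      then have "set (L 0) \<inter> l = {}" using str unfolding structured_def by blast
      then show False using p l(2) by blast
    qed
    then show ?thesis using l by blast
  qed
  then have "line_cover (q - length (heavy_slots m L)) (set (L 0)) (Ls - H)"
    using 1 Ls unfolding line_cover_def by auto
  then show ?thesis using 2 by (auto simp: extendable_def root_def coverable_def)
qed

text \<open>The budget of a node that may receive \<open>r\<close> further lines, when it has at
  most \<open>B\<close> children and a child costs \<open>G\<close>. The summand
  \<open>3 * G * B\<close> pays for writing the children; the rest is handed on to them.\<close>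

fun potential :: "nat \<Rightarrow> nat \<Rightarrow> nat \<Rightarrow> nat" where
  "potential G B 0 = 3 * G"
| "potential G B (Suc r) = 3 * G * B + B * potential G B r"

lemma potential_pos: "1 \<le> G \<Longrightarrow> 1 \<le> B \<Longrightarrow> 1 \<le> potential G B r"
  by (cases r) (simp_all add: Suc_le_eq)

text \<open>The summand \<open>6 * G\<close> strengthens the claim so that the induction closes:
  \<open>3 * G * B + 6 * G \<le> 6 * G * B\<close> holds precisely because
  \<open>2 \<le> B\<close>.\<close>

lemma potential_bound: "2 \<le> B \<Longrightarrow> potential G B r + 6 * G \<le> 9 * G * B ^ r"
proof (induction r)
  case (Suc r)
  have "potential G B (Suc r) + 6 * G = 3 * G * B + B * potential G B r + 6 * G" by simp
  also have "\<dots> \<le> B * (potential G B r + 6 * G)"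
    using mult_le_mono1[OF Suc.prems, of "3 * G"] by (simp add: algebra_simps)
  also have "\<dots> \<le> B * (9 * G * B ^ r)" using Suc by (intro mult_le_mono2)
  finally show ?case by (simp add: algebra_simps)
qed simp

text \<open>The quotient of the two powers is \<open>(1 + 1 / m) ^ m\<close>, which is at most
  \<open>exp 1\<close>. This removes the \<open>+ 1\<close> from the base of the query time at the
  price of a constant.\<close>

lemma power_Suc_le:
  assumes "1 \<le> m"
  shows "(m + 1) ^ m \<le> 3 * m ^ m"
proof -
  have "(1 + 1 / real m) ^ m \<le> exp 1"
    using exp_ge_one_plus_x_over_n_power_n[of m 1] assms by simp
  also have "\<dots> \<le> 3" by (rule exp_le)
  finally have "(1 + 1 / real m) ^ m * real m ^ m \<le> 3 * real m ^ m"
    by (rule mult_right_mono) simp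
  moreover have "(1 + 1 / real m) ^ m * real m ^ m = (real m + 1) ^ m"
    using assms by (simp add: field_simps flip: power_mult_distrib)
  ultimately have "real ((m + 1) ^ m) \<le> real (3 * m ^ m)" by (simp add: add.commute)
  then show ?thesis by linarith
qed

lemma potential_le:
  assumes m: "1 \<le> m" and r: "r \<le> m"
  shows "potential (4 * m ^ 2) ((m + 1) ^ 2) r \<le> 324 * m ^ (2 * m + 2)"
proof -
  have "2 ^ 2 \<le> (m + 1) ^ 2" using m by (intro power_mono) auto
  then have "2 \<le> (m + 1) ^ 2" by simp
  then have "potential (4 * m ^ 2) ((m + 1) ^ 2) r \<le> 9 * (4 * m ^ 2) * ((m + 1) ^ 2) ^ r"
    using potential_bound[of "(m + 1) ^ 2" "4 * m ^ 2" r] by linarith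
  also have "\<dots> \<le> 9 * (4 * m ^ 2) * ((m + 1) ^ 2) ^ m"
    by (intro mult_le_mono2 power_increasing r) simp
  also have "((m + 1) ^ 2) ^ m = ((m + 1) ^ m) ^ 2" by (simp flip: power_mult add: mult.commute)
  also have "9 * (4 * m ^ 2) * ((m + 1) ^ m) ^ 2 \<le> 9 * (4 * m ^ 2) * (3 * m ^ m) ^ 2"
    by (intro mult_le_mono2 power_mono power_Suc_le m) simp
  \<comment> \<open>\<open>324 = 9 * 4 * 3 ^ 2\<close>, with 9 from \<open>potential_bound\<close>,
    4 from the cost of a child and 3 from \<open>power_Suc_le\<close>.\<close>
  also have "\<dots> = 324 * m ^ (2 * m + 2)"
    by (simp add: power_mult_distrib power_add mult.commute power_mult) (simp add: power2_eq_square)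
  finally show ?thesis .
qed

section \<open>Breadth-first search through the partial covers\<close>

abbreviation search_hit :: cond where
  "search_hit \<equiv> And (Equal (Get ''un'' [Var ''head'']) (Const 0)) (LessEq (Get ''ln'' [Var ''head'']) (Var ''kk''))"

text \<open>The rows from \<open>head\<close> up to \<open>tail\<close> are the open nodes. A hit
  leaves \<open>head\<close> unchanged, so that the output can read the solution from that
  row.\<close>

definition search_com :: com where
  "search_com =
    While (And (Less (Var ''head'') (Var ''tail'')) (Equal (Var ''found'') (Const 0)))
      (If search_hit
         (''found'' ::= Const 1)
         (If (Less (Get ''ln'' [Var ''head'']) (Var ''kk'')) expand_com Skip ;;
          Inc ''head''))"

abbreviation output_step :: com where
  "output_step \<equiv> Put ''a'' [Var ''t''] (Get ''LA'' [Var ''head'', Var ''t'']) ;;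
          Put ''b'' [Var ''t''] (Get ''LB'' [Var ''head'', Var ''t'']) ;;
          Put ''c'' [Var ''t''] (Get ''LC'' [Var ''head'', Var ''t'']) ;;
          Inc ''t''"

definition output_com :: com where
  "output_com =
    If (Equal (Var ''found'') (Const 0)) Skip
      (''num'' ::= Get ''ln'' [Var ''head''] ;;
       ''t'' ::= Const 0 ;;
       While (Less (Var ''t'') (Var ''num''))
         output_step)"

definition query_prog :: com where
  "query_prog =
    lines_com ;; loose_com ;;
    ''head'' ::= Const 0 ;; ''tail'' ::= Const 1 ;; ''found'' ::= Const 0 ;;
    search_com ;; output_com"

abbreviation search_vars :: "vname set" where
  "search_vars \<equiv> {''i'', ''j'', ''head'', ''found''} \<union> child_vars"

lemma length_kids: "length (kids m nd) = branching m nd * branching m nd"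
  by (simp add: kids_def length_concat comp_def sum_list_triv)

lemma set_kids: "set (kids m nd) = {kid nd i j | i j. i < branching m nd \<and> j < branching m nd}"
proof (rule set_eqI)
  fix x
  have "x \<in> set (kids m nd) \<longleftrightarrow> (\<exists>i\<in>{..<branching m nd}. \<exists>j\<in>{..<branching m nd}. x = kid nd i j)"
    unfolding kids_def by (simp only: set_concat set_map set_upt atLeast0LessThan image_image UN_iff image_iff)
  then show "x \<in> set (kids m nd) \<longleftrightarrow> x \<in> {kid nd i j | i j. i < branching m nd \<and> j < branching m nd}"
    by (simp only: mem_Collect_eq Bex_def lessThan_iff) metis
qed

lemma sum_list_map_const: "(\<And>x. x \<in> set xs \<Longrightarrow> f x = (c :: nat)) \<Longrightarrow> sum_list (map f xs) = length xs * c"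
  by (induction xs) auto

lemma length_kid: "length (fst (kid nd i j)) = Suc (length (fst nd))"
  by (simp add: kid_def Let_def)

text \<open>If \<open>q\<close> lines suffice, some open node is extendable at all times, so an
  exhausted queue proves that they do not. Conversely every node is a partial cover, so a hit yields
  a cover.\<close>

lemma runs_search:
  assumes m: "s ''m'' [] = real m" "1 \<le> m" and q: "s ''kk'' [] = real q" "q \<le> m"
    and queue: "queue s [nd0]" and v: "s ''head'' [] = 0" "s ''tail'' [] = 1" "s ''found'' [] = 0"
    and nd0: "partial_cover m P nd0" and ext: "coverable q P \<Longrightarrow> extendable q nd0"
    and F: "324 * m ^ (2 * m + 2) + 1 \<le> F"
    and none: "\<And>s'. frame search_vars s s' \<Longrightarrow> s' ''found'' [] = 0 \<Longrightarrow> \<not> coverable q P \<Longrightarrow> Q s'"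
    and some: "\<And>s' h nd. frame search_vars s s' \<Longrightarrow> s' ''found'' [] = 1 \<Longrightarrow>
      s' ''head'' [] = real h \<Longrightarrow> node_at s' h nd \<Longrightarrow> partial_cover m P nd \<Longrightarrow>
      snd nd = [] \<Longrightarrow> length (fst nd) \<le> q \<Longrightarrow> Q s'"
  shows "runs search_com s F Q"
proof -
  define G where "G = 4 * m ^ 2"
  define B where "B = (m + 1) ^ 2"
  define V where "V nd = potential G B (q - length (fst nd))" for nd :: node
  have mm: "m \<le> m * m" "1 \<le> m * m" using m(2) by auto
  have G1: "1 \<le> G" and Gm: "m + 1 \<le> G" and Gmm: "m * m + 1 \<le> G"
    using mm unfolding G_def power2_eq_square by linarith+
  \<comment> \<open>While nothing has been found, the budget \<open>n\<close> is the total potential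
    of the open nodes. After a hit the loop test fails, so the budget is left unconstrained.\<close>
  define I where "I n t \<longleftrightarrow> frame search_vars s t \<and>
    (\<exists>ns h. queue t ns \<and> t ''head'' [] = real h \<and> t ''tail'' [] = real (length ns) \<and> h \<le> length ns \<and>
      (\<forall>nd\<in>set ns. partial_cover m P nd) \<and>
      (t ''found'' [] = 0 \<and> n = sum_list (map V (drop h ns)) \<and>
         (coverable q P \<longrightarrow> (\<exists>nd\<in>set (drop h ns). extendable q nd)) \<or>
       t ''found'' [] = 1 \<and> h < length ns \<and> snd (ns ! h) = [] \<and> length (fst (ns ! h)) \<le> q))"
    for n t
  let ?b = "And (Less (Var ''head'') (Var ''tail'')) (Equal (Var ''found'') (Const 0))"
  let ?more = "Less (Get ''ln'' [Var ''head'']) (Var ''kk'')"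
  let ?next = "Inc ''head''"
  let ?body = "If search_hit (''found'' ::= Const 1) (If ?more expand_com Skip ;; ?next)"
  show ?thesis
    unfolding search_com_def
  proof (rule runs_While[where I = I])
    show "I (V nd0) s"
      unfolding I_def using queue v nd0 ext
      by (intro conjI exI[of _ "[nd0]"] exI[of _ 0]) simp_all
    have "V nd0 \<le> 324 * m ^ (2 * m + 2)"
      unfolding V_def G_def B_def using m(2) q(2) by (intro potential_le) simp_all
    then show "V nd0 + 1 \<le> F" using F by linarith
  next
    fix n t assume I: "I n t" and exit: "\<not> holds t ?b"
    obtain ns h where same: "frame search_vars s t" and queue': "queue t ns"
      and h: "t ''head'' [] = real h" "h \<le> length ns" and tail: "t ''tail'' [] = real (length ns)"
      and pc: "\<forall>nd\<in>set ns. partial_cover m P nd"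
      and res: "t ''found'' [] = 0 \<and> (coverable q P \<longrightarrow> (\<exists>nd\<in>set (drop h ns). extendable q nd)) \<or>
       t ''found'' [] = 1 \<and> h < length ns \<and> snd (ns ! h) = [] \<and> length (fst (ns ! h)) \<le> q"
      using I unfolding I_def by blast
    show "Q t"
    proof (cases "t ''found'' [] = 0")
      case True
      then have "h = length ns" using exit h tail by simp
      then have "\<not> coverable q P" using res True by simp
      then show ?thesis by (rule none[OF same True])
    next
      case False
      then have *: "t ''found'' [] = 1" "h < length ns" "snd (ns ! h) = []" "length (fst (ns ! h)) \<le> q"
        using res by auto
      have "node_at t h (ns ! h)" using queue' *(2) by (simp add: queue_def)
      then show ?thesis using some[OF same *(1) h(1)] pc * by simp
    qed
  next
    fix n t assume I: "I n t" and b: "holds t ?b"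
    have f0: "t ''found'' [] = 0" using b by simp
    obtain ns h where same: "frame search_vars s t" and queue': "queue t ns"
      and h: "t ''head'' [] = real h" "h \<le> length ns" and tail: "t ''tail'' [] = real (length ns)"
      and pc: "\<And>nd. nd \<in> set ns \<Longrightarrow> partial_cover m P nd"
      and n: "n = sum_list (map V (drop h ns))"
      and res: "coverable q P \<Longrightarrow> \<exists>nd\<in>set (drop h ns). extendable q nd"
      using I f0 unfolding I_def by auto
    have hl: "h < length ns" using b h tail by simp
    define nd where "nd = ns ! h"
    define K where "K = branching m nd"
    have nd: "node_at t h nd" using queue' hl by (simp add: queue_def nd_def)
    have pcnd: "partial_cover m P nd" using pc hl by (simp add: nd_def)
    have drop: "drop h ns = nd # drop (Suc h) ns" using hl by (simp add: nd_def Cons_nth_drop_Suc)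
    have v': "t ''m'' [] = real m" "t ''kk'' [] = real q" using m q frameD[OF same] by simp_all
    note len = node_atD(1,2)[OF nd]
    have hit: "holds t search_hit \<longleftrightarrow> snd nd = [] \<and> length (fst nd) \<le> q" using len h(1) v' by simp
    have more: "holds t ?more \<longleftrightarrow> length (fst nd) < q" using len h(1) v' by simp
    show "\<exists>F\<ge>1. runs ?body t F (\<lambda>s'. \<exists>n'. I n' s' \<and> n' + F \<le> n)"
    proof (cases "holds t search_hit")
      case True
      \<comment> \<open>Any positive potential pays for this last round, after which the budget may
        drop to 0.\<close>
      have "V nd \<ge> 1" unfolding V_def by (rule potential_pos[OF G1]) (simp add: B_def)
      then have n1: "1 \<le> n" unfolding n drop by simp
      define t1 where "t1 = set_cell ''found'' [] 1 t"
      have "I 0 t1"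
        unfolding I_def
        using same queue' h tail pc hl True unfolding hit nd_def
        by (intro conjI exI[of _ ns] exI[of _ h]) (simp_all add: t1_def frame_set_cell)
      then have "\<exists>n'. I n' t1 \<and> n' + 1 \<le> n" using n1 by auto
      then have "runs (''found'' ::= Const 1) t 1 (\<lambda>s'. \<exists>n'. I n' s' \<and> n' + 1 \<le> n)"
        by (intro runs_Put) (simp_all add: t1_def)
      then have "runs ?body t 1 (\<lambda>s'. \<exists>n'. I n' s' \<and> n' + 1 \<le> n)"
        using True by (intro runs_If) simp_all
      then show ?thesis by blast
    next
      case nohit: False
      show ?thesis
      proof (cases "length (fst nd) < q")
        case False
        define t1 where "t1 = set_cell ''head'' [] (real h + 1) t"
        define n' where "n' = sum_list (map V (drop (Suc h) ns))"
        \<comment> \<open>Without a hit and without a line to spare, the node has uncovered points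
          or already too many lines. Either way it is not extendable, so the extendable open node
          lies behind it.\<close>
        have "\<exists>nd\<in>set (drop (Suc h) ns). extendable q nd" if cov: "coverable q P"
        proof -
          have "\<not> extendable q nd"
            using extendable_kid(1)[OF pcnd _ q(2)] False nohit[unfolded hit]
            by (auto simp: extendable_def)
          then show ?thesis using res[OF cov] unfolding drop by auto
        qed
        then have I1: "I n' t1"
          unfolding I_def n'_def
          using same queue' h tail pc hl f0
          by (intro conjI exI[of _ ns] exI[of _ "Suc h"]) (auto simp: t1_def frame_set_cell)
        have "V nd \<ge> 1" unfolding V_def by (rule potential_pos[OF G1]) (simp add: B_def)
        then have "n' + 1 \<le> n" unfolding n drop n'_def by simp
        then have "\<exists>n'. I n' t1 \<and> n' + 1 \<le> n" using I1 by blast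
        then have "runs ?next t 1 (\<lambda>s'. \<exists>n'. I n' s' \<and> n' + 1 \<le> n)"
          using h(1) by (intro runs_Put) (simp_all add: t1_def)
        then have "runs (If ?more expand_com Skip ;; ?next) t 1 (\<lambda>s'. \<exists>n'. I n' s' \<and> n' + 1 \<le> n)"
          using False more by (intro runs_Seq runs_If runs_Skip) blast+
        then have "runs ?body t 1 (\<lambda>s'. \<exists>n'. I n' s' \<and> n' + 1 \<le> n)"
          using nohit by (intro runs_If) blast+
        then show ?thesis by blast
      next
        case True
        \<comment> \<open>The summand \<open>3 * G * B\<close> of \<open>potential\<close> is spent
          on this round; the remainder of \<open>V nd\<close> covers the potentials of the at most
          \<open>B\<close> children.\<close>
        define E where "E = 3 * G * B"
        define r where "r = q - Suc (length (fst nd))"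
        have r: "q - length (fst nd) = Suc r" using True by (simp add: r_def)
        have Km: "K \<le> m + 1" by (simp add: K_def branching_def)
        have KB: "K * K \<le> B"
          unfolding B_def power2_eq_square by (rule mult_le_mono[OF Km Km])
        have B1: "1 \<le> B" and mB: "m + 1 \<le> B" by (simp_all add: B_def power2_eq_square)
        have BG: "B \<le> B * G" "1 \<le> B * G" using G1 B1 by auto
        have "K * (K * G + 1) + 1 = K * K * G + K + 1" by (simp add: algebra_simps)
        also have "\<dots> \<le> B * G + B + B * G"
          using mult_le_mono1[OF KB, of G] Km mB BG(2) by linarith
        also have "\<dots> \<le> E" using BG(1) by (simp add: E_def)
        finally have KE: "branching m nd * (branching m nd * G + 1) + 1 \<le> E" by (simp add: K_def)
        have E1: "1 \<le> E" using KE by linarith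
        have G': "length (fst nd) + 1 \<le> G" "length (snd nd) + 1 \<le> G"
          using pcnd Gm Gmm unfolding partial_cover_def by linarith+
        define ns' where "ns' = ns @ kids m nd"
        have drop': "drop (Suc h) ns' = drop (Suc h) ns @ kids m nd" using hl by (simp add: ns'_def)
        define n' where "n' = sum_list (map V (drop (Suc h) ns'))"
        have n'E: "n' + E \<le> n"
        proof -
          have "sum_list (map V (kids m nd)) = length (kids m nd) * potential G B r"
            by (rule sum_list_map_const) (auto simp: set_kids V_def length_kid r_def)
          also have "\<dots> \<le> B * potential G B r"
            unfolding length_kids using KB by (simp add: K_def)
          finally have "sum_list (map V (kids m nd)) + E \<le> V nd" by (simp add: V_def r E_def)
          then show ?thesis using hl unfolding n n'_def ns'_def drop by simp
        qed
        have expand: "runs expand_com t E (\<lambda>s'. runs ?next s' E (\<lambda>s'. \<exists>n'. I n' s' \<and> n' + E \<le> n))"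
        proof (rule runs_expand[OF queue' h(1) hl nd_def[symmetric] tail v'(1) G' KE])
          fix t1 assume same1: "frame ({''i'', ''j''} \<union> child_vars) t t1"
            and queue1: "queue t1 (ns @ kids m nd)"
            and tail1: "t1 ''tail'' [] = real (length (ns @ kids m nd))"
          define t2 where "t2 = set_cell ''head'' [] (real h + 1) t1"
          have "frame search_vars s t1" by (rule frame_trans[OF same same1]) auto
          then have same2: "frame search_vars s t2"
            unfolding t2_def by (rule frame_set_cell) simp
          have pc': "partial_cover m P x" if "x \<in> set ns'" for x
            using that pc partial_cover_kid[OF pcnd less_le_trans[OF True q(2)]]
            unfolding ns'_def set_append set_kids by blast
          have ext': "\<exists>nd\<in>set (drop (Suc h) ns'). extendable q nd" if cov: "coverable q P"
          proof -
            obtain x where x: "x \<in> set (drop h ns)" "extendable q x" using res[OF cov] by blast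
            show ?thesis
            proof (cases "x \<in> set (drop (Suc h) ns)")
              case False
              then have "extendable q nd" using x unfolding drop by simp
              moreover then have "snd nd \<noteq> []" using nohit[unfolded hit] by (auto simp: extendable_def)
              ultimately obtain i j where "i < K" "j < K" "extendable q (kid nd i j)"
                using extendable_kid(2)[OF pcnd _ q(2)] unfolding K_def branching_def by blast
              then have "kid nd i j \<in> set (kids m nd)" unfolding set_kids K_def by blast
              then show ?thesis using \<open>extendable q (kid nd i j)\<close> unfolding drop' set_append by blast
            qed (use x in \<open>auto simp: drop'\<close>)
          qed
          have f2: "t2 ''found'' [] = 0" using f0 frameD[OF same1] by (simp add: t2_def)
          have "I n' t2"
            unfolding I_def n'_def
            by (intro conjI exI[of _ ns'] exI[of _ "Suc h"])
              (use same2 pc' ext' f2 hl queue1 tail1 in \<open>auto simp: t2_def ns'_def\<close>)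
          then have "\<exists>n'. I n' t2 \<and> n' + E \<le> n" using n'E by blast
          then show "runs ?next t1 E (\<lambda>s'. \<exists>n'. I n' s' \<and> n' + E \<le> n)"
            using h(1) frameD[OF same1] E1 by (intro runs_Put) (simp_all add: t2_def)
        qed
        have "runs (If ?more expand_com Skip ;; ?next) t E (\<lambda>s'. \<exists>n'. I n' s' \<and> n' + E \<le> n)"
          using True more E1 by (intro runs_Seq runs_If expand) blast+
        then have "runs ?body t E (\<lambda>s'. \<exists>n'. I n' s' \<and> n' + E \<le> n)"
          using nohit E1 by (intro runs_If) blast+
        then show ?thesis using E1 by blast
      qed
    qed
  qed
qed

section \<open>Output and the complete query\<close>

abbreviation output_vars :: "vname set" where
  "output_vars \<equiv> {''num'', ''t'', ''a'', ''b'', ''c''}"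

lemma runs_output:
  assumes h: "s ''found'' [] = 1" "s ''head'' [] = real h" and nd: "node_at s h nd"
    and F: "length (fst nd) + 1 \<le> F"
    and Q: "\<And>s'. frame output_vars s s' \<Longrightarrow> answer s' = Some (tline ` set (fst nd)) \<Longrightarrow> Q s'"
  shows "runs output_com s F Q"
proof -
  let ?V = "output_vars"
  define N where "N = length (fst nd)"
  have F1: "1 \<le> F" using F by simp
  define row :: "state \<Rightarrow> nat \<Rightarrow> real \<times> real \<times> real" where
    "row s' t = (s' ''a'' [real t], s' ''b'' [real t], s' ''c'' [real t])" for s' t
  define I where "I c s' \<longleftrightarrow> frame ?V s s' \<and> s' ''num'' [] = real N \<and> s' ''t'' [] = real c \<and>
    (\<forall>t<c. row s' t = fst nd ! t)" for c s'
  let ?b = "Less (Var ''t'') (Var ''num'')"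
  have body: "holds s' ?b \<and> runs output_step s' 1 (I (Suc c))" if c: "c < N" and I: "I c s'" for c s'
  proof
    have same: "frame ?V s s'" and num: "s' ''num'' [] = real N" and t: "s' ''t'' [] = real c"
      and row: "\<forall>t<c. row s' t = fst nd ! t"
      using I by (auto simp: I_def)
    show "holds s' ?b" using c num t by simp
    define s1 where "s1 = set_cell ''t'' [] (real c + 1) (set_cell ''c'' [real c] (snd (snd (fst nd ! c)))
      (set_cell ''b'' [real c] (fst (snd (fst nd ! c))) (set_cell ''a'' [real c] (fst (fst nd ! c)) s')))"
    have "frame ?V s s1" unfolding s1_def by (intro frame_set_cell same) simp_all
    then have "I (Suc c) s1" using row num by (auto simp: I_def s1_def row_def less_Suc_eq)
    then show "runs output_step s' 1 (I (Suc c))"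
      using t h(2) frameD[OF same] node_atD(3-5)[OF nd, of c] c
      by (intro runs_Put_Seq runs_Put) (simp_all add: s1_def N_def)
  qed
  have final: "Q s'" if I: "I N s'" for s'
  proof -
    have same: "frame ?V s s'" and num: "s' ''num'' [] = real N"
      and row: "\<And>t. t < N \<Longrightarrow> row s' t = fst nd ! t"
      using I by (auto simp: I_def)
    have "{line_of (s' ''a'' [real i]) (s' ''b'' [real i]) (s' ''c'' [real i]) | i :: nat. real i < s' ''num'' []} =
      (\<lambda>i. tline (row s' i)) ` {..<N}"
      using num by (auto simp: row_def tline_def)
    also have "\<dots> = (\<lambda>i. tline (fst nd ! i)) ` {..<N}" using row by simp
    also have "\<dots> = tline ` set (fst nd)"
    proof -
      have "set (fst nd) = (\<lambda>i. fst nd ! i) ` {..<N}"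
        unfolding N_def set_conv_nth by blast
      then show ?thesis by (simp add: image_image)
    qed
    finally have "answer s' = Some (tline ` set (fst nd))"
      using h(1) frameD[OF same] by (simp add: answer_def)
    then show ?thesis using Q same by blast
  qed
  define s2 where "s2 = set_cell ''t'' [] 0 (set_cell ''num'' [] (real N) s)"
  have "runs (While ?b output_step) s2 F Q"
  proof (rule runs_for[where N = N and F = 1 and I = I, OF _ body])
    show "I 0 s2" by (simp add: I_def s2_def frame_set_cell)
    show "\<not> holds s' ?b \<and> Q s'" if "I N s'" for s' using that final[OF that] by (simp add: I_def)
  qed (use F in \<open>auto simp: N_def\<close>)
  then have "runs (''num'' ::= Get ''ln'' [Var ''head''] ;; ''t'' ::= Const 0 ;; While ?b output_step) s F Q"
    using h(2) node_atD(1)[OF nd] F1 by (intro runs_Put_Seq) (simp_all add: s2_def N_def)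
  then show ?thesis
    unfolding output_com_def using h(1) F1 by (intro runs_If) simp_all
qed

abbreviation query_vars :: "vname set" where
  "query_vars \<equiv> search_vars \<union> output_vars \<union> {''h''}"

lemma valid_cong:
  assumes valid: "valid m q s P"
    and same: "frame V s s'"
    and V: "V \<inter> {''m'', ''kk'', ''n'', ''X'', ''Y'', ''W'', ''pos'', ''A'', ''B'', ''C''} = {}"
  shows "valid m q s' P"
proof -
  have eq: "s' v = s v" if "v \<in> {''m'', ''kk'', ''n'', ''X'', ''Y'', ''W'', ''pos'', ''A'', ''B'', ''C''}" for v
    using frameD[OF same] V that by blast
  obtain L where "stores m s L" "structured m L (slot_line s)" "P = stored m L"
    using valid unfolding valid_def by blast
  moreover have "slot_line s' = slot_line s" by (rule slot_line_cong) (simp_all add: eq)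
  moreover have "stores m s' L" by (rule stores_cong[OF \<open>stores m s L\<close>]) (simp_all add: eq)
  ultimately show ?thesis using valid eq unfolding valid_def by auto
qed

lemma runs_query:
  assumes valid: "valid m q s P" and q: "q = min k m" and cov: "coverable m P" and m1: "1 \<le> m"
  shows "runs query_prog s (325 * m ^ (2 * m + 2))
    (\<lambda>s'. valid m q s' P \<and> correct_answer k P (answer s'))"
proof -
  define F where "F = 325 * m ^ (2 * m + 2)"
  define Q where "Q s' \<longleftrightarrow> valid m q s' P \<and> correct_answer k P (answer s')" for s'
  obtain L where m: "s ''m'' [] = real m" and kk: "s ''kk'' [] = real q" and st: "stores m s L"
    and str: "structured m L (slot_line s)" and P: "P = stored m L"
    using valid unfolding valid_def by blast
  have qm: "q \<le> m" using q by simp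
  have len: "length (L 0) \<le> m * m"
    using loose_le[OF str] cov stores_distinct[OF st] P by simp
  have big: "m * m \<le> m ^ (2 * m + 2)"
    using power_increasing[of 2 "2 * m + 2" m] m1 by (simp add: power2_eq_square)
  have mm: "m \<le> m * m" "1 \<le> m * m" using m1 by auto
  \<comment> \<open>The search asks for \<open>324 * m ^ (2 * m + 2) + 1\<close>, and
    \<open>1 \<le> m\<close> allows the last unit to be rounded up to one more
    \<open>m ^ (2 * m + 2)\<close>. The other parts need at most \<open>m * m + 1\<close>.\<close>
  have F1: "1 \<le> F" and Fm: "m + 1 \<le> F" and Fl: "length (L 0) + 1 \<le> F"
    and Fs: "324 * m ^ (2 * m + 2) + 1 \<le> F"
    using mm big len unfolding F_def by linarith+
  define nd0 where "nd0 = root m s L"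
  have nd0: "partial_cover m P nd0" "coverable q P \<Longrightarrow> extendable q nd0"
    unfolding nd0_def P using partial_cover_root[OF st str] extendable_root[OF st str qm] cov P by simp_all
  \<comment> \<open>For \<open>m < k\<close> both sides are true, since the promise already provides
    a cover by \<open>m\<close> lines; searching with \<open>q = m\<close> then gives the correct
    answer for \<open>k\<close>.\<close>
  have cov_iff: "coverable q P \<longleftrightarrow> coverable k P"
  proof (cases "k \<le> m")
    case False
    then have "m \<le> k" "q = m" using q by auto
    then show ?thesis using cov coverable_mono by blast
  qed (use q in simp)
  have done_valid: "valid m q s' P" if "frame query_vars s s'" for s'
    by (rule valid_cong[OF valid that]) simp
  have search: "runs (search_com ;; output_com) t F Q"
    if same: "frame query_vars s t" and queue: "queue t [nd0]"
      and v: "t ''head'' [] = 0" "t ''tail'' [] = 1" "t ''found'' [] = 0" for t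
  proof -
    have v': "t ''m'' [] = real m" "t ''kk'' [] = real q" using m kk frameD[OF same] by simp_all
    show ?thesis
    proof (rule runs_Seq, rule runs_search[OF v'(1) m1 v'(2) qm queue v nd0 Fs])
      fix t1 assume same1: "frame search_vars t t1" and f: "t1 ''found'' [] = 0" and no: "\<not> coverable q P"
      have "frame query_vars s t1" by (rule frame_trans[OF same same1]) auto
      then have "Q t1" using done_valid no f cov_iff by (simp add: Q_def answer_def)
      then show "runs output_com t1 F Q"
        unfolding output_com_def using f F1 by (intro runs_If runs_Skip) simp_all
    next
      fix t1 h nd assume same1: "frame search_vars t t1" and f: "t1 ''found'' [] = 1"
        and h: "t1 ''head'' [] = real h" "node_at t1 h nd"
        and nd: "partial_cover m P nd" "snd nd = []" "length (fst nd) \<le> q"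
      have same': "frame query_vars s t1" by (rule frame_trans[OF same same1]) auto
      have lF: "length (fst nd) + 1 \<le> F" using nd(3) qm Fm by linarith
      show "runs output_com t1 F Q"
      proof (rule runs_output[OF f h lF])
        fix t2 assume same2: "frame output_vars t1 t2" and ans: "answer t2 = Some (tline ` set (fst nd))"
        have "frame query_vars s t2" by (rule frame_trans[OF same' same2]) auto
        moreover have "card (tline ` set (fst nd)) \<le> k"
          using card_image_le[of "set (fst nd)" tline] card_length[of "fst nd"] nd(3) q by simp
        then have "line_cover k P (tline ` set (fst nd))"
          using nd(1,2) unfolding line_cover_def partial_cover_def by auto
        ultimately show "Q t2" using done_valid ans by (simp add: Q_def)
      qed
    qed
  qed
  have "runs query_prog s F Q"
    unfolding query_prog_def
  proof (rule runs_Seq, rule runs_lines[OF st m Fm])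
    fix s1 assume same1: "frame {''h'', ''i'', ''LA'', ''LB'', ''LC'', ''ln''} s s1"
      and ln: "s1 ''ln'' [0] = real (length (heavy_slots m L))"
      and ls: "\<And>t. t < length (heavy_slots m L) \<Longrightarrow>
        line_cells s1 0 (real t) =
        map (coefficients s) (heavy_slots m L) ! t"
    have st1: "stores m s1 L" by (rule stores_cong[OF st]) (simp_all add: frameD[OF same1])
    let ?rest = "''head'' ::= Const 0 ;; ''tail'' ::= Const 1 ;; ''found'' ::= Const 0 ;;
      search_com ;; output_com"
    show "runs (loose_com ;; ?rest) s1 F Q"
    proof (rule runs_Seq, rule runs_loose[OF st1 Fl])
      fix s2 assume same2: "frame {''j'', ''UX'', ''UY'', ''un''} s1 s2"
        and un: "s2 ''un'' [0] = real (length (L 0))"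
        and us: "\<And>t. t < length (L 0) \<Longrightarrow> point_cells s2 0 (real t) = L 0 ! t"
      have "node_at s2 0 nd0"
        using ln ls un us frameD[OF same2] by (simp add: node_at_def nd0_def root_def)
      then have queue2: "queue s2 [nd0]" by (simp add: queue_def)
      define s3 where "s3 = set_cell ''found'' [] 0 (set_cell ''tail'' [] 1 (set_cell ''head'' [] 0 s2))"
      have "frame query_vars s s1" using same1 by (rule frame_trans[OF frame_refl[of "{}"]]) auto
      then have "frame query_vars s s2" by (rule frame_trans[OF _ same2]) auto
      then have "frame query_vars s s3" unfolding s3_def by (intro frame_set_cell) simp_all
      then have "runs (search_com ;; output_com) s3 F Q"
        using queue2 by (intro search) (simp_all add: s3_def)
      then show "runs ?rest s2 F Q" using F1 by (intro runs_Put_Seq) (simp_all add: s3_def)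
    qed
  qed
  then show ?thesis unfolding F_def Q_def .
qed

section \<open>Initialisation and conclusion\<close>

text \<open>\<open>m\<close> becomes \<open>g k\<close>, raised to 1 if \<open>g k = 0\<close>; this
  only weakens the promise, and it makes a single point on a line light. The input \<open>in\<close>
  survives the run of \<open>ren_com c\<close>, which writes only arrays starting with
  \<open>#\<close>.\<close>

definition init_prog :: "com \<Rightarrow> com" where
  "init_prog c =
    ''#in'' ::= Var ''in'' ;; ren_com c ;;
    ''m'' ::= Var ''#out'' ;;
    If (Less (Var ''m'') (Const 1)) (''m'' ::= Const 1) Skip ;;
    If (Less (Var ''in'') (Var ''m'')) (''kk'' ::= Var ''in'') (''kk'' ::= Var ''m'')"

lemma init_valid:
  assumes c: "exec c (start_state k) t s" "s ''out'' [] = real n"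
  shows "\<exists>u s'. exec (init_prog c) (start_state k) u s' \<and> valid (max 1 n) (min k (max 1 n)) s' {}"
proof -
  define m where "m = max 1 n"
  define s1 where "s1 = set_cell ''#in'' [] (real k) (start_state k)"
  \<comment> \<open>The arrays of \<open>s1\<close> that start with \<open>#\<close> hold
    \<open>k\<close> in \<open>#in\<close> and zero elsewhere: they are \<open>start_state k\<close>
    under the new names, so the run of \<open>c\<close> can be transferred.\<close>
  have "overlay s1 (start_state k) = s1"
    by (auto simp: overlay_def s1_def start_state_def fun_eq_iff split: list.split)
  define s2 where "s2 = overlay s1 s"
  obtain u2 where s2: "exec (ren_com c) s1 u2 s2"
    using exec_ren[OF c(1), of s1] \<open>overlay s1 (start_state k) = s1\<close> by (auto simp: s2_def)
  have out: "s2 ''#out'' [] = real n" using c(2) by (simp add: s2_def overlay_def)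
  have in2: "s2 ''in'' [] = real k" by (simp add: s2_def overlay_def s1_def start_state_def)
  define Q where "Q s' \<longleftrightarrow> valid m (min k m) s' {}" for s'
  let ?kk = "If (Less (Var ''in'') (Var ''m'')) (''kk'' ::= Var ''in'') (''kk'' ::= Var ''m'')"
  define s3 where "s3 = set_cell ''m'' [] (real m) s2"
  have Q: "Q (set_cell ''kk'' [] (real (min k m)) s3)"
  proof -
    let ?s = "set_cell ''kk'' [] (real (min k m)) s3"
    have "stores m ?s (\<lambda>_. [])" by (simp add: stores_def s3_def s2_def overlay_def s1_def start_state_def)
    moreover have "structured m (\<lambda>_. []) l" for l by (simp add: structured_def)
    ultimately show ?thesis unfolding Q_def valid_def by (auto simp: s3_def intro!: exI[of _ "\<lambda>_. []"])
  qed
  have kk: "runs ?kk s3 1 Q"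
  proof (rule runs_If)
    assume "holds s3 (Less (Var ''in'') (Var ''m''))"
    then have "min k m = k" using in2 by (simp add: s3_def)
    then show "runs (''kk'' ::= Var ''in'') s3 1 Q" using Q in2 by (intro runs_Put) (simp_all add: s3_def)
  next
    assume "\<not> holds s3 (Less (Var ''in'') (Var ''m''))"
    then have "min k m = m" using in2 by (simp add: s3_def)
    then show "runs (''kk'' ::= Var ''m'') s3 1 Q" using Q by (intro runs_Put) (simp_all add: s3_def)
  qed simp
  define s2m where "s2m = set_cell ''m'' [] (real n) s2"
  have "runs (If (Less (Var ''m'') (Const 1)) (''m'' ::= Const 1) Skip ;; ?kk) s2m 1 Q"
  proof (rule runs_Seq, rule runs_If)
    assume "holds s2m (Less (Var ''m'') (Const 1))"
    then have "m = 1" by (simp add: s2m_def m_def)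
    then have "set_cell ''m'' [] 1 s2m = s3" by (simp add: s2m_def s3_def set_cell_def fun_eq_iff)
    then show "runs (''m'' ::= Const 1) s2m 1 (\<lambda>s'. runs ?kk s' 1 Q)" using kk by (intro runs_Put) simp_all
  next
    assume "\<not> holds s2m (Less (Var ''m'') (Const 1))"
    then have "s2m = s3" by (simp add: s2m_def s3_def m_def)
    then show "runs Skip s2m 1 (\<lambda>s'. runs ?kk s' 1 Q)" using kk by (intro runs_Skip) simp_all
  qed simp
  then have "runs (''m'' ::= Var ''#out'' ;; If (Less (Var ''m'') (Const 1)) (''m'' ::= Const 1) Skip ;; ?kk) s2 1 Q"
    using out by (intro runs_Put_Seq) (simp_all add: s2m_def)
  then obtain u3 s4 where "exec (''m'' ::= Var ''#out'' ;; If (Less (Var ''m'') (Const 1)) (''m'' ::= Const 1) Skip ;; ?kk) s2 u3 s4"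
    "Q s4" unfolding runs_def by blast
  moreover have "exec (''#in'' ::= Var ''in'') (start_state k) (1 + sum_list (map exp_cost []) + exp_cost (Var ''in'')) s1"
    using exec.Put[of "''#in''" "[]" "Var ''in''" "start_state k"] by (simp add: s1_def start_state_def)
  ultimately have "exec (init_prog c) (start_state k)
      (1 + sum_list (map exp_cost []) + exp_cost (Var ''in'') + (u2 + u3)) s4"
    unfolding init_prog_def using s2 exec.Seq by blast
  then show ?thesis using \<open>Q s4\<close> unfolding Q_def m_def by blast
qed

definition dynamic_cover :: "com \<Rightarrow> dynamic_algorithm" where
  "dynamic_cover c =
    \<lparr>init_com = init_prog c, insert_com = insert_prog, delete_com = delete_prog, query_com = query_prog\<rparr>"

lemma points_after_snoc: "points_after (ops @ [opn]) = apply_op opn (points_after ops)"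
  by (simp add: points_after_def)

lemma promise_snoc:
  "promise m (ops @ [opn]) \<longleftrightarrow> promise m ops \<and> coverable m (points_after (ops @ [opn]))"
proof -
  have "(\<forall>n\<le>Suc (length ops). R n) \<longleftrightarrow> (\<forall>n\<le>length ops. R n) \<and> R (Suc (length ops))" for R
    by (auto simp: le_Suc_eq)
  then show ?thesis by (simp add: promise_def)
qed

lemma promise_coverable: "promise m ops \<Longrightarrow> coverable m (points_after ops)"
  unfolding promise_def by (drule spec[of _ "length ops"]) simp

definition time_bound :: "nat \<Rightarrow> operation \<Rightarrow> nat" where
  "time_bound m opn = (case opn of Insert p \<Rightarrow> weight insert_prog * (4 * m ^ 2)
     | Delete p \<Rightarrow> weight delete_prog * (5 * m ^ 3)
     | Query \<Rightarrow> weight query_prog * (325 * m ^ (2 * m + 2)))"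

text \<open>Both coverability assumptions are present because an insertion relies on the promise
  after the operation, a deletion and a query on the promise before it.\<close>

lemma operation_correct:
  fixes m k
  assumes valid: "valid m (min k m) s P" and cov: "coverable m P" "coverable m (apply_op opn P)" and m1: "1 \<le> m"
  shows "\<exists>t s'. exec (op_com (dynamic_cover c) opn) (load opn s) t s' \<and>
    t \<le> time_bound m opn \<and>
    valid m (min k m) s' (apply_op opn P) \<and> (opn = Query \<longrightarrow> correct_answer k P (answer s'))"
proof (cases opn)
  case (Insert p)
  have "valid m (min k m) (load opn s) P"
    by (rule valid_cong[OF valid, of "{''x'', ''y''}"]) (simp_all add: Insert frame_set_cell)
  then have "runs insert_prog (load opn s) (4 * m ^ 2) (\<lambda>s'. valid m (min k m) s' (insert p P))"
    by (rule runs_insert) (use cov m1 in \<open>simp_all add: Insert\<close>)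
  then show ?thesis unfolding runs_def by (auto simp: Insert dynamic_cover_def time_bound_def)
next
  case (Delete p)
  have "valid m (min k m) (load opn s) P"
    by (rule valid_cong[OF valid, of "{''x'', ''y''}"]) (simp_all add: Delete frame_set_cell)
  then have "runs delete_prog (load opn s) (5 * m ^ 3) (\<lambda>s'. valid m (min k m) s' (P - {p}))"
    by (rule runs_delete) (use cov m1 in \<open>simp_all add: Delete\<close>)
  then show ?thesis unfolding runs_def by (auto simp: Delete dynamic_cover_def time_bound_def)
next
  case Query
  show ?thesis
    using runs_query[OF valid refl cov(1) m1] unfolding runs_def by (auto simp: Query dynamic_cover_def time_bound_def)
qed

theorem theorem4:
  fixes g :: "nat \<Rightarrow> nat"
  assumes "computable g"
  shows "\<exists>A (C :: nat). \<forall>k. solves_point_line_cover A k (g k)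
    (\<lambda>opn. case opn of
        Insert p \<Rightarrow> C * max 1 (g k) ^ 2
      | Delete p \<Rightarrow> C * max 1 (g k) ^ 3
      | Query \<Rightarrow> C * max 1 (g k) ^ (2 * g k + 2))"
proof -
  obtain c where c: "\<And>n. \<exists>t s. exec c (start_state n) t s \<and> s ''out'' [] = real (g n)"
    using assms unfolding computable_def by blast
  define C where "C = 4 * weight insert_prog + 5 * weight delete_prog + 325 * weight query_prog"
  let ?A = "dynamic_cover c"
  have "solves_point_line_cover ?A k (g k)
    (\<lambda>opn. case opn of
        Insert p \<Rightarrow> C * max 1 (g k) ^ 2
      | Delete p \<Rightarrow> C * max 1 (g k) ^ 3
      | Query \<Rightarrow> C * max 1 (g k) ^ (2 * g k + 2))" for k
  proof -
    define m where "m = max 1 (g k)"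
    have m1: "1 \<le> m" and gm: "g k \<le> m" by (simp_all add: m_def)
    \<comment> \<open>For \<open>g k = 0\<close> the exponents differ, but then \<open>m = 1\<close>
      and both powers are 1.\<close>
    have pow: "m ^ (2 * m + 2) = m ^ (2 * g k + 2)" by (cases "g k = 0") (simp_all add: m_def)
    obtain t0 s0 where start: "exec (init_com ?A) (start_state k) t0 s0" "valid m (min k m) s0 {}"
      using c[of k] init_valid unfolding m_def dynamic_cover_def by fastforce
    have cov: "promise (g k) ops \<Longrightarrow> coverable m (points_after ops)" for ops
      using promise_coverable coverable_mono[OF _ order_refl gm] by blast
    \<comment> \<open>\<open>reaches\<close> admits any run of the programs, whereas
      \<open>operation_correct\<close> and \<open>init_valid\<close> only provide one; by
      determinism the two agree.\<close>
    have inv: "valid m (min k m) s (points_after ops)" if "reaches ?A k ops s" "promise (g k) ops" for ops s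
      using that
    proof (induction rule: reaches.induct)
      case (init t s)
      then have "s = s0" using start(1) exec_deterministic by blast
      then show ?case using start(2) by (simp add: points_after_def)
    next
      case (step ops s opn t s')
      have pr: "promise (g k) ops" using step.prems promise_snoc by blast
      obtain t' s'' where "exec (op_com ?A opn) (load opn s) t' s''"
        "valid m (min k m) s'' (apply_op opn (points_after ops))"
        using operation_correct[OF step.IH[OF pr] cov[OF pr] _ m1, of opn c] cov[OF step.prems]
        by (auto simp: points_after_snoc)
      then show ?case using exec_deterministic step.hyps(2) unfolding points_after_snoc by blast
    qed
    show ?thesis
      unfolding solves_point_line_cover_def
    proof (intro conjI allI impI)
      show "\<exists>s. reaches ?A k [] s" using reaches.init[OF start(1)] by blast
      fix ops opn s assume pr: "promise (g k) (ops @ [opn])" and re: "reaches ?A k ops s"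
      have pr': "promise (g k) ops" using pr promise_snoc by blast
      have cov': "coverable m (apply_op opn (points_after ops))"
        using cov[OF pr] by (simp add: points_after_snoc)
      obtain t s' where e: "exec (op_com ?A opn) (load opn s) t s'"
        "opn = Query \<longrightarrow> correct_answer k (points_after ops) (answer s')"
        and t: "t \<le> time_bound m opn"
        using operation_correct[OF inv[OF re pr'] cov[OF pr'] cov' m1, of c] by blast
      note t
      also have "time_bound m opn \<le>
        (case opn of Insert p \<Rightarrow> C * max 1 (g k) ^ 2 | Delete p \<Rightarrow> C * max 1 (g k) ^ 3
          | Query \<Rightarrow> C * max 1 (g k) ^ (2 * g k + 2))"
        unfolding m_def[symmetric] pow C_def time_bound_def by (cases opn) (simp_all add: algebra_simps)
      finally show "\<exists>t s'. exec (op_com ?A opn) (load opn s) t s' \<and>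
          t \<le> (case opn of Insert p \<Rightarrow> C * max 1 (g k) ^ 2 | Delete p \<Rightarrow> C * max 1 (g k) ^ 3
            | Query \<Rightarrow> C * max 1 (g k) ^ (2 * g k + 2)) \<and>
          (opn = Query \<longrightarrow> correct_answer k (points_after ops) (answer s'))"
        using e by blast
    qed
  qed
  then show ?thesis by blast
qed

end
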